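(* Let $G$ be a reductive algebraic group over an algebraically closed field $\mathbb{K}$ of characteristic $p>0$, and let $r,s\in\mathbb{N}$. If $r\ge s$, then $\Upsilon_{r,s}:U^{[r]}(G)\to U^{[r-s]}(G)$ is surjective.
   Context: $\mathbb{N}=\{0,1,2,\dots\}$. With $I_1=\{f\in\mathbb{K}[G]: f(1)=0\}$, $\mathrm{Dist}_k(G)$ is the space of linear maps $\mu:\mathbb{K}[G]\to\mathbb{K}$ with $\mu(I_1^{k+1})=0$, $\mathrm{Dist}_k^{+}(G)=\{\mu\in\mathrm{Dist}_k(G):\mu(1)=0\}$, and $\mathrm{Dist}(G)=\bigcup_k\mathrm{Dist}_k(G)$ is the distribution algebra with product $\mu\rho=(\mu\otimes\rho)\circ\Delta$. $U^{[r]}(G)=T(\mathrm{Dist}^+_{p^{r+1}-1}(G))/Q$, where $T$ is the tensor algebra and $Q$ is the two-sided ideal generated by the relations (i) $x\otimes y=xy$ for $x\in\mathrm{Dist}^+_i(G)$, $y\in\mathrm{Dist}^+_j(G)$ with $i+j<p^{r+1}$; (ii) $x\otimes y-y\otimes x=[x,y]$ for $x\in\mathrm{Dist}^+_i(G)$, $y\in\mathrm{Dist}^+_j(G)$ with $i+j\le p^{r+1}$ (right-hand sides computed in $\mathrm{Dist}(G)$). In particular $U^{[0]}(G)=U(\mathfrak g)$, $\mathfrak g=\mathrm{Lie}(G)$. A reductive group is defined over $\mathbb{F}_p$; fix the (split) form, so $\mathbb{K}[G]=\mathbb{F}_p[G]\otimes_{\mathbb{F}_p}\mathbb{K}$. The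 map $\Xi_s:\mathrm{Dist}(G)\to\mathrm{Dist}(G)$, $\Xi_s(\delta)(f\otimes a)=\delta(f^{p^s}\otimes a)$ ($f\in\mathbb{F}_p[G]$, $a\in\mathbb{K}$), is the Hopf algebra homomorphism induced by the geometric Frobenius endomorphism $F_g^s$ of $G$. For $s\le r$ it maps $\mathrm{Dist}^+_{p^{r+1}-1}(G)$ into $\mathrm{Dist}^+_{p^{r-s+1}-1}(G)$ and induces the Hopf algebra homomorphism $\Upsilon_{r,s}:U^{[r]}(G)\to U^{[r-s]}(G)$ sending the class of $\delta$ to the class of $\Xi_s(\delta)$. *)

theory Defs
  imports
    "HOL-Analysis.Abstract_Topology"
    "HOL-Computational_Algebra.Polynomial"
    "HOL-Library.FuncSet"
    "HOL-Library.Poly_Mapping"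
    "HOL-Algebra.QuotRing"
    "HOL-Algebra.Ideal_Product"
    "HOL-Algebra.Subrings"
begin

section \<open>Affine algebraic groups\<close>

text \<open>
  The ground field is a type \<open>'k\<close> of class \<^class>\<open>alg_closed_field\<close>. An affine algebraic group is
  a group \<open>G\<close> together with its coordinate algebra \<open>A\<close> of \<open>'k\<close>-valued functions on \<open>carrier G\<close>.
  Functions on a set are represented by total functions that vanish outside the set, so that equality
  of representatives is equality of functions and the vector space operations are pointwise.
\<close>

definition ext0 :: "'a set \<Rightarrow> ('a \<Rightarrow> 'k::zero) \<Rightarrow> 'a \<Rightarrow> 'k" where
  "ext0 X f = (\<lambda>x. if x \<in> X then f x else 0)"

definition function_ring :: "'g set \<Rightarrow> ('g \<Rightarrow> 'k::field) ring" where
  "function_ring X =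
    \<lparr>carrier = {f. \<forall>x. x \<notin> X \<longrightarrow> f x = 0},
     mult = (\<lambda>f g x. f x * g x),
     one = ext0 X (\<lambda>_. 1),
     zero = (\<lambda>_. 0),
     add = (\<lambda>f g x. f x + g x)\<rparr>"

definition function_subalgebra :: "'g set \<Rightarrow> ('g \<Rightarrow> 'k::field) set \<Rightarrow> bool" where
  "function_subalgebra X A \<longleftrightarrow>
     subring A (function_ring X) \<and> (\<forall>c. ext0 X (\<lambda>_. c) \<in> A)"

definition coordinate_ring :: "('g, 'm) monoid_scheme \<Rightarrow> ('g \<Rightarrow> 'k::field) set \<Rightarrow> ('g \<Rightarrow> 'k) ring" where
  "coordinate_ring G A = (function_ring (carrier G))\<lparr>carrier := A\<rparr>"

definition linear_on :: "('x \<Rightarrow> 'k::field) set \<Rightarrow> (('x \<Rightarrow> 'k) \<Rightarrow> 'k) \<Rightarrow> bool" where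
  "linear_on A \<mu> \<longleftrightarrow>
     (\<forall>f\<in>A. \<forall>g\<in>A. \<mu> (\<lambda>x. f x + g x) = \<mu> f + \<mu> g) \<and>
     (\<forall>f\<in>A. \<forall>c. \<mu> (\<lambda>x. c * f x) = c * \<mu> f)"

definition character_of_algebra :: "'g set \<Rightarrow> ('g \<Rightarrow> 'k::field) set \<Rightarrow> (('g \<Rightarrow> 'k) \<Rightarrow> 'k) \<Rightarrow> bool" where
  "character_of_algebra X A \<phi> \<longleftrightarrow>
     linear_on A \<phi> \<and> \<phi> (ext0 X (\<lambda>_. 1)) = 1 \<and>
     (\<forall>f\<in>A. \<forall>g\<in>A. \<phi> (\<lambda>x. f x * g x) = \<phi> f * \<phi> g)"

text \<open>
  The condition \<open>points\<close> says that evaluation identifies \<open>X\<close> with the set of algebra homomorphisms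
  from \<open>A\<close> to the ground field, that is, with the maximal spectrum of \<open>A\<close>.
\<close>

locale affine_variety =
  fixes X :: "'g set" and A :: "('g \<Rightarrow> 'k::alg_closed_field) set"
  assumes algebra: "function_subalgebra X A"
    and finitely_generated:
      "\<exists>S\<subseteq>A. finite S \<and> (\<forall>B. function_subalgebra X B \<and> S \<subseteq> B \<longrightarrow> A \<subseteq> B)"
    and points: "character_of_algebra X A \<phi> \<Longrightarrow> \<exists>!x. x \<in> X \<and> (\<forall>f\<in>A. \<phi> f = f x)"

text \<open>
  \<open>A \<otimes> B\<close> is identified with the functions \<open>(x, y) \<mapsto> \<Sum>i. g\<^sub>i x * h\<^sub>i y\<close>; since \<open>A\<close> and \<open>B\<close> consist
  of functions, this identification is injective.
\<close>

definition in_tensor_square :: "'g set \<Rightarrow> ('g \<Rightarrow> 'k::field) set \<Rightarrow> ('g \<Rightarrow> 'g \<Rightarrow> 'k) \<Rightarrow> bool" where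
  "in_tensor_square X A F \<longleftrightarrow>
     (\<exists>(n::nat) g h. (\<forall>i<n. g i \<in> A \<and> h i \<in> A) \<and>
        (\<forall>x\<in>X. \<forall>y\<in>X. F x y = (\<Sum>i<n. g i x * h i y)))"

locale affine_algebraic_group =
  group G + affine_variety "carrier G" A
  for G :: "('g, 'm) monoid_scheme" (structure) and A :: "('g \<Rightarrow> 'k::alg_closed_field) set" +
  assumes comult: "f \<in> A \<Longrightarrow> in_tensor_square (carrier G) A (\<lambda>x y. f (x \<otimes> y))"
    and antipode: "f \<in> A \<Longrightarrow> ext0 (carrier G) (\<lambda>x. f (inv x)) \<in> A"

definition zariski :: "('g, 'm) monoid_scheme \<Rightarrow> ('g \<Rightarrow> 'k::field) set \<Rightarrow> 'g topology" where
  "zariski G A = topology (\<lambda>U. \<exists>S\<subseteq>A. U = {x \<in> carrier G. \<exists>f\<in>S. f x \<noteq> 0})"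

lemma openin_zariski:
  fixes A :: "('g \<Rightarrow> 'k::field) set"
  assumes A: "function_subalgebra (carrier G) A"
  shows "openin (zariski G A) U \<longleftrightarrow> (\<exists>S\<subseteq>A. U = {x \<in> carrier G. \<exists>f\<in>S. f x \<noteq> 0})"
proof -
  define D where "D S = {x \<in> carrier G. \<exists>f\<in>S. f x \<noteq> 0}" for S :: "('g \<Rightarrow> 'k) set"
  have mult: "(\<lambda>x. f x * g x) \<in> A" if "f \<in> A" "g \<in> A" for f g
    using A subringE(6)[of A "function_ring (carrier G)" f g] that
    by (simp add: function_subalgebra_def function_ring_def)
  have "istopology (\<lambda>U. \<exists>S\<subseteq>A. U = D S)"
    unfolding istopology_def
  proof (intro conjI allI impI)
    fix U V
    assume "\<exists>S\<subseteq>A. U = D S" "\<exists>S\<subseteq>A. V = D S"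
    then obtain S T where ST: "S \<subseteq> A" "U = D S" "T \<subseteq> A" "V = D T"
      by (elim exE conjE)
    let ?P = "(\<lambda>(f, g) x. f x * g x) ` (S \<times> T)"
    have "U \<inter> V = D ?P"
      unfolding ST(2,4) D_def by auto
    moreover have "?P \<subseteq> A"
      using ST(1,3) by (auto intro: mult)
    ultimately show "\<exists>S\<subseteq>A. U \<inter> V = D S"
      by (intro exI[of _ ?P] conjI)
  next
    fix \<U> assume "\<forall>U\<in>\<U>. \<exists>S\<subseteq>A. U = D S"
    then obtain S where S: "\<forall>U\<in>\<U>. S U \<subseteq> A \<and> U = D (S U)"
      by (rule bchoice[THEN exE])
    have "\<Union>\<U> = (\<Union>U\<in>\<U>. D (S U))"
      using S by auto
    also have "\<dots> = D (\<Union>(S ` \<U>))"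
      unfolding D_def by auto
    finally have "\<Union>\<U> = D (\<Union>(S ` \<U>))" .
    moreover have "\<Union>(S ` \<U>) \<subseteq> A"
      using S by auto
    ultimately show "\<exists>S\<subseteq>A. \<Union>\<U> = D S"
      by (intro exI[of _ "\<Union>(S ` \<U>)"] conjI)
  qed
  then show ?thesis
    unfolding zariski_def D_def by (simp only: topology_inverse')
qed


section \<open>Reductive groups\<close>

text \<open>An element is unipotent iff its right translation on the coordinate algebra is locally unipotent.\<close>

definition unipotent_element ::
  "('g, 'm) monoid_scheme \<Rightarrow> ('g \<Rightarrow> 'k::field) set \<Rightarrow> 'g \<Rightarrow> bool" where
  "unipotent_element G A u \<longleftrightarrow>
     u \<in> carrier G \<and>
     (\<forall>f\<in>A. \<exists>n. ((\<lambda>h. ext0 (carrier G) (\<lambda>x. h (x \<otimes>\<^bsub>G\<^esub> u) - h x)) ^^ n) f = (\<lambda>_. 0))"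

definition unipotent_radical :: "('g, 'm) monoid_scheme \<Rightarrow> ('g \<Rightarrow> 'k::field) set \<Rightarrow> 'g set" where
  "unipotent_radical G A =
     (GREATEST N. N \<lhd> G \<and> closedin (zariski G A) N \<and> connectedin (zariski G A) N \<and>
        (\<forall>u\<in>N. unipotent_element G A u))"

definition reductive_group ::
  "('g, 'm) monoid_scheme \<Rightarrow> ('g \<Rightarrow> 'k::alg_closed_field) set \<Rightarrow> bool" where
  "reductive_group G A \<longleftrightarrow>
     affine_algebraic_group G A \<and> unipotent_radical G A = {\<one>\<^bsub>G\<^esub>}"


section \<open>Split forms over the prime field\<close>

definition prime_subfield :: "'k::ring_1 set" where
  "prime_subfield = range of_int"

text \<open>
  \<open>spans\<close> and \<open>independent\<close> say that the canonical map \<open>A\<^sub>0 \<otimes> K \<rightarrow> A\<close> is surjective and injective,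
  the tensor product being over the prime field. The remaining conditions make \<open>A\<^sub>0\<close> a Hopf algebra
  over the prime field.
\<close>

locale prime_field_form =
  fixes G :: "('g, 'm) monoid_scheme" (structure) and A A\<^sub>0 :: "('g \<Rightarrow> 'k::field) set"
  assumes subset: "A\<^sub>0 \<subseteq> A"
    and subring: "subring A\<^sub>0 (coordinate_ring G A)"
    and spans:
      "f \<in> A \<Longrightarrow> \<exists>(n::nat) c g. (\<forall>i<n. g i \<in> A\<^sub>0) \<and> f = (\<lambda>x. \<Sum>i<n. c i * g i x)"
    and independent:
      "\<lbrakk>\<forall>i<n::nat. g i \<in> A\<^sub>0;
        \<forall>c. (\<forall>i<n. c i \<in> prime_subfield) \<and> (\<lambda>x. \<Sum>i<n. c i * g i x) = (\<lambda>_. 0) \<longrightarrow> (\<forall>i<n. c i = 0);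
        (\<lambda>x. \<Sum>i<n. d i * g i x) = (\<lambda>_. 0)\<rbrakk>
       \<Longrightarrow> \<forall>i<n. d i = 0"
    and comult: "f \<in> A\<^sub>0 \<Longrightarrow> in_tensor_square (carrier G) A\<^sub>0 (\<lambda>x y. f (x \<otimes> y))"
    and antipode: "f \<in> A\<^sub>0 \<Longrightarrow> ext0 (carrier G) (\<lambda>x. f (inv x)) \<in> A\<^sub>0"
    and counit: "f \<in> A\<^sub>0 \<Longrightarrow> f \<one> \<in> prime_subfield"

text \<open>
  \<open>\<chi>\<close> is an isomorphism of algebraic groups from the closed subgroup \<open>T\<close> onto the \<open>n\<close>-fold product of
  the multiplicative group: a bijective homomorphism whose coordinates are regular and such that
  every regular function on \<open>T\<close> is a Laurent polynomial in the coordinates.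
\<close>

definition torus_coordinates ::
  "('g, 'm) monoid_scheme \<Rightarrow> ('g \<Rightarrow> 'k::field) set \<Rightarrow> 'g set \<Rightarrow> nat \<Rightarrow> (nat \<Rightarrow> 'g \<Rightarrow> 'k) \<Rightarrow> bool" where
  "torus_coordinates G A T n \<chi> \<longleftrightarrow>
     (\<forall>i<n. \<chi> i \<in> ext0 T ` A \<and> (\<forall>x\<in>T. \<forall>y\<in>T. \<chi> i (x \<otimes>\<^bsub>G\<^esub> y) = \<chi> i x * \<chi> i y)) \<and>
     bij_betw (\<lambda>x. \<lambda>i\<in>{..<n}. \<chi> i x) T ({..<n} \<rightarrow>\<^sub>E UNIV - {0}) \<and>
     (\<forall>f\<in>A. \<exists>M c. finite M \<and> (\<forall>x\<in>T. f x = (\<Sum>m\<in>M. c m * (\<Prod>i<n. \<chi> i x powi m i))))"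

definition torus :: "('g, 'm) monoid_scheme \<Rightarrow> ('g \<Rightarrow> 'k::field) set \<Rightarrow> 'g set \<Rightarrow> bool" where
  "torus G A T \<longleftrightarrow>
     subgroup T G \<and> closedin (zariski G A) T \<and> (\<exists>n \<chi>. torus_coordinates G A T n \<chi>)"

definition maximal_torus :: "('g, 'm) monoid_scheme \<Rightarrow> ('g \<Rightarrow> 'k::field) set \<Rightarrow> 'g set \<Rightarrow> bool" where
  "maximal_torus G A T \<longleftrightarrow> torus G A T \<and> (\<forall>T'. torus G A T' \<and> T \<subseteq> T' \<longrightarrow> T' = T)"

text \<open>
  The first condition says that the vanishing ideal of \<open>T\<close> is spanned by its members in \<open>A\<^sub>0\<close>, that is,
  \<open>T\<close> is defined over the prime field; the second says that \<open>T\<close> has coordinates with values in the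
  multiplicative group that are defined over the prime field.
\<close>

definition split_over_prime_field ::
  "('g, 'm) monoid_scheme \<Rightarrow> ('g \<Rightarrow> 'k::field) set \<Rightarrow> ('g \<Rightarrow> 'k) set \<Rightarrow> 'g set \<Rightarrow> bool" where
  "split_over_prime_field G A A\<^sub>0 T \<longleftrightarrow>
     (\<forall>f\<in>A. (\<forall>x\<in>T. f x = 0) \<longrightarrow>
        (\<exists>(n::nat) c g. (\<forall>i<n. g i \<in> A\<^sub>0 \<and> (\<forall>x\<in>T. g i x = 0)) \<and> f = (\<lambda>x. \<Sum>i<n. c i * g i x))) \<and>
     (\<exists>n \<chi>. torus_coordinates G A T n \<chi> \<and> (\<forall>i<n. \<chi> i \<in> ext0 T ` A\<^sub>0))"

definition split_prime_field_form ::
  "('g, 'm) monoid_scheme \<Rightarrow> ('g \<Rightarrow> 'k::field) set \<Rightarrow> ('g \<Rightarrow> 'k) set \<Rightarrow> bool" where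
  "split_prime_field_form G A A\<^sub>0 \<longleftrightarrow>
     prime_field_form G A A\<^sub>0 \<and>
     (\<exists>T. maximal_torus G A T \<and> split_over_prime_field G A A\<^sub>0 T)"


section \<open>Distributions\<close>

text \<open>Linear functionals on \<open>A\<close> are represented by functionals that vanish outside \<open>A\<close>.\<close>

type_synonym ('g, 'k) functional = "('g \<Rightarrow> 'k) \<Rightarrow> 'k"

definition dual_space :: "('g \<Rightarrow> 'k::field) set \<Rightarrow> ('g, 'k) functional set" where
  "dual_space A = {\<mu>. linear_on A \<mu> \<and> (\<forall>f. f \<notin> A \<longrightarrow> \<mu> f = 0)}"

definition augmentation_ideal ::
  "('g, 'm) monoid_scheme \<Rightarrow> ('g \<Rightarrow> 'k::field) set \<Rightarrow> ('g \<Rightarrow> 'k) set" where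
  "augmentation_ideal G A = {f \<in> A. f \<one>\<^bsub>G\<^esub> = 0}"

definition Dist :: "('g, 'm) monoid_scheme \<Rightarrow> ('g \<Rightarrow> 'k::field) set \<Rightarrow> nat \<Rightarrow> ('g, 'k) functional set" where
  "Dist G A k =
     {\<mu> \<in> dual_space A.
        \<forall>f \<in> augmentation_ideal G A [^]\<^bsub>ideals_set (coordinate_ring G A)\<^esub> (k + 1). \<mu> f = 0}"

definition Dist_plus ::
  "('g, 'm) monoid_scheme \<Rightarrow> ('g \<Rightarrow> 'k::field) set \<Rightarrow> nat \<Rightarrow> ('g, 'k) functional set" where
  "Dist_plus G A k = {\<mu> \<in> Dist G A k. \<mu> (\<one>\<^bsub>coordinate_ring G A\<^esub>) = 0}"

text \<open>
  If \<open>f (x \<otimes> y) = (\<Sum>i. g\<^sub>i x * h\<^sub>i y)\<close> then \<open>(\<mu> \<otimes> \<rho>) (\<Delta> f) = (\<Sum>i. \<mu> g\<^sub>i * \<rho> h\<^sub>i)\<close> is the result of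
  applying \<open>\<rho>\<close> in the variable \<open>y\<close> and then \<open>\<mu>\<close> in the variable \<open>x\<close>.
\<close>

definition functional_tensor ::
  "'g set \<Rightarrow> ('g, 'k::field) functional \<Rightarrow> ('g, 'k) functional \<Rightarrow> ('g \<Rightarrow> 'g \<Rightarrow> 'k) \<Rightarrow> 'k" where
  "functional_tensor X \<mu> \<rho> F = \<mu> (ext0 X (\<lambda>x. \<rho> (ext0 X (\<lambda>y. F x y))))"

definition dist_mult ::
  "('g, 'm) monoid_scheme \<Rightarrow> ('g \<Rightarrow> 'k::field) set \<Rightarrow>
    ('g, 'k) functional \<Rightarrow> ('g, 'k) functional \<Rightarrow> ('g, 'k) functional" where
  "dist_mult G A \<mu> \<rho> = ext0 A (\<lambda>f. functional_tensor (carrier G) \<mu> \<rho> (\<lambda>x y. f (x \<otimes>\<^bsub>G\<^esub> y)))"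

definition dist_commutator ::
  "('g, 'm) monoid_scheme \<Rightarrow> ('g \<Rightarrow> 'k::field) set \<Rightarrow>
    ('g, 'k) functional \<Rightarrow> ('g, 'k) functional \<Rightarrow> ('g, 'k) functional" where
  "dist_commutator G A \<mu> \<rho> = (\<lambda>f. dist_mult G A \<mu> \<rho> f - dist_mult G A \<rho> \<mu> f)"

definition frobenius_dist ::
  "('g \<Rightarrow> 'k::field) set \<Rightarrow> ('g \<Rightarrow> 'k) set \<Rightarrow> nat \<Rightarrow> ('g, 'k) functional \<Rightarrow> ('g, 'k) functional" where
  "frobenius_dist A A\<^sub>0 s \<delta> =
     (THE \<eta>. \<eta> \<in> dual_space A \<and>
        (\<forall>f\<in>A\<^sub>0. \<forall>a. \<eta> (\<lambda>x. a * f x) = \<delta> (\<lambda>x. a * f x ^ (CHAR('k) ^ s))))"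


section \<open>Tensor algebras\<close>

datatype 'v free_monoid = Word (letters: "'v list")

instantiation free_monoid :: (type) monoid_add
begin

definition "0 = Word []"

definition "v + w = Word (letters v @ letters w)"

instance
  by standard (simp_all add: zero_free_monoid_def plus_free_monoid_def)

end

text \<open>The monoid algebra of a free monoid is a free associative algebra.\<close>

type_synonym ('v, 'k) free_algebra = "'v free_monoid \<Rightarrow>\<^sub>0 'k"

definition free_algebra :: "'v set \<Rightarrow> ('v, 'k::field) free_algebra ring" where
  "free_algebra V =
    \<lparr>carrier = {t. \<forall>w \<in> Poly_Mapping.keys t. set (letters w) \<subseteq> V},
     mult = (*), one = 1, zero = 0, add = (+)\<rparr>"

definition free_scalar :: "'k::field \<Rightarrow> ('v, 'k) free_algebra" where
  "free_scalar c = Poly_Mapping.single 0 c"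

definition free_gen :: "'v \<Rightarrow> ('v, 'k::field) free_algebra" where
  "free_gen v = Poly_Mapping.single (Word [v]) 1"

text \<open>
  The tensor algebra of a vector space \<open>V\<close> of functions is the free associative algebra on the set \<open>V\<close>
  modulo the relations that make \<open>V \<rightarrow> T(V)\<close> linear.
\<close>

definition linearity_ideal :: "('x \<Rightarrow> 'k::field) set \<Rightarrow> ('x \<Rightarrow> 'k, 'k) free_algebra set" where
  "linearity_ideal V = Idl\<^bsub>free_algebra V\<^esub>
     ({free_gen (\<lambda>x. v x + w x) - free_gen v - free_gen w | v w. v \<in> V \<and> w \<in> V} \<union>
      {free_gen (\<lambda>x. c * v x) - free_scalar c * free_gen v | c v. v \<in> V})"

definition tensor_algebra :: "('x \<Rightarrow> 'k::field) set \<Rightarrow> ('x \<Rightarrow> 'k, 'k) free_algebra set ring" where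
  "tensor_algebra V = free_algebra V Quot linearity_ideal V"

definition tensor_scalar :: "('x \<Rightarrow> 'k::field) set \<Rightarrow> 'k \<Rightarrow> ('x \<Rightarrow> 'k, 'k) free_algebra set" where
  "tensor_scalar V c = linearity_ideal V +>\<^bsub>free_algebra V\<^esub> free_scalar c"

definition tensor_gen :: "('x \<Rightarrow> 'k::field) set \<Rightarrow> ('x \<Rightarrow> 'k) \<Rightarrow> ('x \<Rightarrow> 'k, 'k) free_algebra set" where
  "tensor_gen V v = linearity_ideal V +>\<^bsub>free_algebra V\<^esub> free_gen v"


section \<open>Higher universal enveloping algebras\<close>

type_synonym ('g, 'k) hue = "(('g, 'k) functional, 'k) free_algebra set set"

abbreviation hue_space ::
  "('g, 'm) monoid_scheme \<Rightarrow> ('g \<Rightarrow> 'k::field) set \<Rightarrow> nat \<Rightarrow> ('g, 'k) functional set" where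
  "hue_space G A r \<equiv> Dist_plus G A (CHAR('k) ^ (r + 1) - 1)"

text \<open>
  The bounds \<open>i, j < p\<^bsup>r+1\<^esup>\<close> ensure that \<open>x\<close> and \<open>y\<close> belong to \<open>hue_space G A r\<close>, so that the relations
  are between elements of the tensor algebra. They only exclude \<open>{i, j} = {0, p\<^bsup>r+1\<^esup>}\<close> in the
  second family, where one of the factors is zero because \<open>Dist_plus G A 0 = {0}\<close>.
\<close>

definition hue_ideal ::
  "('g, 'm) monoid_scheme \<Rightarrow> ('g \<Rightarrow> 'k::field) set \<Rightarrow> nat \<Rightarrow>
    (('g, 'k) functional, 'k) free_algebra set set" where
  "hue_ideal G A r =
    (let q = CHAR('k) ^ (r + 1); V = hue_space G A r; T = tensor_algebra V; \<iota> = tensor_gen V in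
     Idl\<^bsub>T\<^esub>
      ({\<iota> x \<otimes>\<^bsub>T\<^esub> \<iota> y \<ominus>\<^bsub>T\<^esub> \<iota> (dist_mult G A x y) | x y i j.
          x \<in> Dist_plus G A i \<and> y \<in> Dist_plus G A j \<and> i + j < q} \<union>
       {\<iota> x \<otimes>\<^bsub>T\<^esub> \<iota> y \<ominus>\<^bsub>T\<^esub> \<iota> y \<otimes>\<^bsub>T\<^esub> \<iota> x \<ominus>\<^bsub>T\<^esub> \<iota> (dist_commutator G A x y) | x y i j.
          x \<in> Dist_plus G A i \<and> y \<in> Dist_plus G A j \<and> i < q \<and> j < q \<and> i + j \<le> q}))"

definition hue_algebra ::
  "('g, 'm) monoid_scheme \<Rightarrow> ('g \<Rightarrow> 'k::field) set \<Rightarrow> nat \<Rightarrow> ('g, 'k) hue ring" where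
  "hue_algebra G A r = tensor_algebra (hue_space G A r) Quot hue_ideal G A r"

definition hue_scalar ::
  "('g, 'm) monoid_scheme \<Rightarrow> ('g \<Rightarrow> 'k::field) set \<Rightarrow> nat \<Rightarrow> 'k \<Rightarrow> ('g, 'k) hue" where
  "hue_scalar G A r c =
     hue_ideal G A r +>\<^bsub>tensor_algebra (hue_space G A r)\<^esub> tensor_scalar (hue_space G A r) c"

definition hue_class ::
  "('g, 'm) monoid_scheme \<Rightarrow> ('g \<Rightarrow> 'k::field) set \<Rightarrow> nat \<Rightarrow> ('g, 'k) functional \<Rightarrow> ('g, 'k) hue" where
  "hue_class G A r \<delta> =
     hue_ideal G A r +>\<^bsub>tensor_algebra (hue_space G A r)\<^esub> tensor_gen (hue_space G A r) \<delta>"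

text \<open>
  The classes of distributions generate the algebra, so at most one homomorphism of algebras has the
  prescribed values on them; \<^const>\<open>extensional\<close> fixes its values outside the carrier.
\<close>

definition upsilon ::
  "('g, 'm) monoid_scheme \<Rightarrow> ('g \<Rightarrow> 'k::field) set \<Rightarrow> ('g \<Rightarrow> 'k) set \<Rightarrow> nat \<Rightarrow> nat \<Rightarrow>
    ('g, 'k) hue \<Rightarrow> ('g, 'k) hue" where
  "upsilon G A A\<^sub>0 r s =
     (THE h. h \<in> ring_hom (hue_algebra G A r) (hue_algebra G A (r - s)) \<and>
        h \<in> extensional (carrier (hue_algebra G A r)) \<and>
        (\<forall>c. h (hue_scalar G A r c) = hue_scalar G A (r - s) c) \<and>
        (\<forall>\<delta>\<in>hue_space G A r.
           h (hue_class G A r \<delta>) = hue_class G A (r - s) (frobenius_dist A A\<^sub>0 s \<delta>)))"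

end

theory Submission
  imports Defs "HOL-Library.Function_Algebras"
begin

text \<open>
  The map \<open>\<Upsilon>\<close> is induced by applying \<open>\<Xi>\<close> to the letters of words in distributions, so it is surjective
  as soon as \<open>\<Xi>\<close> maps the distributions of degree below \<open>p\<^bsup>r+1\<^esup>\<close> onto those of degree below
  \<open>p\<^bsup>r-s+1\<^esup>\<close>. Extending functionals, this means that the geometric Frobenius map \<open>\<phi>\<close> of the
  coordinate algebra reflects the order of vanishing at the identity: \<open>\<phi> f \<in> J\<^bsup>m q\<^esup>\<close> implies \<open>f \<in> J\<^bsup>m\<^esup>\<close>
  for \<open>q = p\<^bsup>s\<^esup>\<close> and \<open>m\<close> a power of \<open>p\<close>, where \<open>J\<close> is the augmentation ideal.

  That is a consequence of smoothness at the identity, which has an elementary proof for groups. Let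
  \<open>x\<^sub>1, \<dots>, x\<^sub>n \<in> J\<close> represent a basis of \<open>J / J\<^sup>2\<close>. By Nakayama's lemma the monomials with exponents below
  \<open>p\<close> span the algebra over its subring of \<open>p\<close>-th powers near the identity; they are independent there
  because invariant derivations dual to the \<open>x\<^sub>i\<close> separate them. As the algebra is reduced, \<open>p\<close>-th
  roots can be taken in relations, so by induction the monomials with exponents below \<open>Q = p\<^sup>e\<close> are
  linearly independent modulo the ideal generated by the \<open>Q\<close>-th powers of \<open>J\<close>. Hence Taylor
  polynomials of degree below \<open>Q\<close> are unique, and \<open>\<phi>\<close> raises the coordinates to the power \<open>q\<close>.
\<close>

section \<open>Augmented algebras\<close>

text \<open>The obstacle is that \<open>A\<close> may have zero divisors, as \<open>G\<close> may be
  disconnected. "Near the identity" therefore means: after multiplication by some element whose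
  value at the identity is nonzero. Every relation carries such a factor, and the factors accumulate
  in the inductions. That \<open>Q = m q\<close> is a power of \<open>p\<close> allows roots to be
  extracted one factor \<open>p\<close> at a time; the scalars have roots because the field is
  algebraically closed. Only \<open>m = p^(r-s+1)\<close> matters, with
  \<open>m q = p^(r+1)\<close>: these are the two orders that define the spaces of generators. Both
  \<open>upsilon\<close> and \<open>frobenius_dist\<close> are definite descriptions, so existence
  has to be shown as well. The \<open>q\<close>-th power map extends linearly from the form to
  \<open>A\<close> because linear relations descend to the prime field, whose elements it fixes. For
  \<open>upsilon\<close>, the relations of level \<open>r\<close> must go to relations of level
  \<open>r - s\<close>: degrees are divided by \<open>q\<close> and rounded down. The right-hand
  sides must also be generators, and for commutators of total degree exactly \<open>p^(r+1)\<close>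
  this needs a drop of one degree, which comes from the symmetry of the comultiplication to leading
  order.\<close>

inductive_set combos :: "'a::comm_ring set \<Rightarrow> 'a set \<Rightarrow> 'a set" for C S where
  combos_0: "0 \<in> combos C S"
| combos_step: "\<lbrakk>c \<in> C; s \<in> S; t \<in> combos C S\<rbrakk> \<Longrightarrow> c * s + t \<in> combos C S"

lemma combos_gen: "\<lbrakk>c \<in> C; s \<in> S\<rbrakk> \<Longrightarrow> c * s \<in> combos C S"
  using combos_step[OF _ _ combos_0] by fastforce

lemma combos_add:
  assumes "t \<in> combos C S" "u \<in> combos C S"
  shows "t + u \<in> combos C S"
  using assms(1) by induction (auto simp: add.assoc intro: assms(2) combos_step)

lemma combos_sum: "(\<And>i. i \<in> E \<Longrightarrow> f i \<in> combos C S) \<Longrightarrow> sum f E \<in> combos C S"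
  by (induction E rule: infinite_finite_induct) (auto intro: combos_0 combos_add)

lemma combos_subset:
  assumes "0 \<in> T" "\<And>x y. \<lbrakk>x \<in> T; y \<in> T\<rbrakk> \<Longrightarrow> x + y \<in> T" "\<And>c s. \<lbrakk>c \<in> C; s \<in> S\<rbrakk> \<Longrightarrow> c * s \<in> T"
  shows "combos C S \<subseteq> T"
proof
  fix t assume "t \<in> combos C S"
  then show "t \<in> T" by induction (auto intro: assms)
qed

lemma combos_mono: "\<lbrakk>C \<subseteq> D; S \<subseteq> T\<rbrakk> \<Longrightarrow> combos C S \<subseteq> combos D T"
  by (rule combos_subset) (auto intro: combos_0 combos_add combos_gen)

lemma combos_mult:
  assumes "t \<in> combos C S" "\<And>c s. \<lbrakk>c \<in> C; s \<in> S\<rbrakk> \<Longrightarrow> d * (c * s) \<in> combos C' S'"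
  shows "d * t \<in> combos C' S'"
  using assms(1) by induction (auto simp: distrib_left intro: assms(2) combos_0 combos_add)

lemma combos_mult2:
  assumes "t \<in> combos C S" "u \<in> combos C' S'"
    "\<And>c s c' s'. \<lbrakk>c \<in> C; s \<in> S; c' \<in> C'; s' \<in> S'\<rbrakk> \<Longrightarrow> (c * s) * (c' * s') \<in> combos D T"
  shows "t * u \<in> combos D T"
proof -
  have "(c * s) * u \<in> combos D T" if "c \<in> C" "s \<in> S" for c s
    using assms(2) by (rule combos_mult) (use assms(3) that in auto)
  then have "u * t \<in> combos D T"
    using combos_mult[OF assms(1), of u D T] by (simp add: mult.commute)
  then show ?thesis by (simp add: mult.commute)
qed

lemma combos_image:
  assumes "t \<in> combos C (m ` E)" "finite E" "0 \<in> C" "\<And>x y. \<lbrakk>x \<in> C; y \<in> C\<rbrakk> \<Longrightarrow> x + y \<in> C"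
  obtains c where "\<And>i. c i \<in> C" "t = (\<Sum>i\<in>E. c i * m i)"
proof -
  have "\<exists>c. (\<forall>i. c i \<in> C) \<and> t = (\<Sum>i\<in>E. c i * m i)"
    using assms(1)
  proof induction
    case combos_0
    then show ?case by (intro exI[of _ "\<lambda>_. 0"]) (simp add: assms(3))
  next
    case (combos_step d s t)
    then obtain c i where c: "\<forall>i. c i \<in> C" "t = (\<Sum>i\<in>E. c i * m i)" and i: "i \<in> E" "s = m i"
      by blast
    have "d * s + t = (\<Sum>j\<in>E. (if j = i then d * m j else 0)) + t"
      using i by (simp add: sum.delta[OF assms(2)])
    also have "\<dots> = (\<Sum>j\<in>E. ((if j = i then d else 0) + c j) * m j)"
      unfolding c(2) sum.distrib[symmetric] by (intro sum.cong) (auto simp: distrib_right)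
    finally show ?case
      using c(1) combos_step.hyps(1) assms(3,4)
      by (intro exI[of _ "\<lambda>j. (if j = i then d else 0) + c j"]) auto
  qed
  then show ?thesis using that by blast
qed

text \<open>The algebra is a subset that shares the unit of its type, so that powers and
  \<open>prod_mset\<close> of the type class, including empty products, are those of the
  algebra.\<close>

locale augmented_algebra =
  fixes A :: "'a::comm_ring_1 set" and \<kappa> :: "'k::alg_closed_field \<Rightarrow> 'a" and \<epsilon> :: "'a \<Rightarrow> 'k"
  assumes A_add: "\<lbrakk>x \<in> A; y \<in> A\<rbrakk> \<Longrightarrow> x + y \<in> A"
    and A_mult: "\<lbrakk>x \<in> A; y \<in> A\<rbrakk> \<Longrightarrow> x * y \<in> A"
    and \<kappa>_in: "\<kappa> c \<in> A"
    and \<kappa>_add: "\<kappa> (c + d) = \<kappa> c + \<kappa> d"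
    and \<kappa>_mult: "\<kappa> (c * d) = \<kappa> c * \<kappa> d"
    and \<kappa>_1: "\<kappa> 1 = 1"
    and \<epsilon>_add: "\<lbrakk>x \<in> A; y \<in> A\<rbrakk> \<Longrightarrow> \<epsilon> (x + y) = \<epsilon> x + \<epsilon> y"
    and \<epsilon>_mult: "\<lbrakk>x \<in> A; y \<in> A\<rbrakk> \<Longrightarrow> \<epsilon> (x * y) = \<epsilon> x * \<epsilon> y"
    and \<epsilon>_\<kappa>: "\<epsilon> (\<kappa> c) = c"
begin

lemma \<kappa>_0: "\<kappa> 0 = 0"
  using \<kappa>_add[of 0 0] by simp

lemma \<kappa>_uminus: "\<kappa> (- c) = - \<kappa> c"
  using \<kappa>_add[of c "- c"] \<kappa>_0 by (simp add: eq_neg_iff_add_eq_0 add.commute)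

lemma \<kappa>_diff: "\<kappa> (c - d) = \<kappa> c - \<kappa> d"
  using \<kappa>_add[of c "- d"] by (simp add: \<kappa>_uminus)

lemma A_0: "0 \<in> A" and A_1: "1 \<in> A"
  using \<kappa>_in \<kappa>_0 \<kappa>_1 by metis+

lemma A_uminus: "x \<in> A \<Longrightarrow> - x \<in> A"
  using A_mult[OF \<kappa>_in, of x "-1"] by (simp add: \<kappa>_uminus \<kappa>_1)

lemma A_diff: "\<lbrakk>x \<in> A; y \<in> A\<rbrakk> \<Longrightarrow> x - y \<in> A"
  using A_add[OF _ A_uminus, of x y] by simp

lemma A_power: "x \<in> A \<Longrightarrow> x ^ n \<in> A"
  by (induction n) (auto intro: A_1 A_mult)

lemma A_sum: "(\<And>i. i \<in> E \<Longrightarrow> f i \<in> A) \<Longrightarrow> sum f E \<in> A"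
  by (induction E rule: infinite_finite_induct) (auto intro: A_0 A_add)

lemma A_combos: "\<lbrakk>C \<subseteq> A; S \<subseteq> A\<rbrakk> \<Longrightarrow> combos C S \<subseteq> A"
  by (rule combos_subset) (auto intro: A_0 A_add A_mult)

lemma A_prod_mset: "set_mset M \<subseteq> A \<Longrightarrow> prod_mset M \<in> A"
  by (induction M) (auto intro: A_1 A_mult)

lemmas A_intros = A_0 A_1 A_add A_mult A_uminus A_diff A_power A_sum A_prod_mset \<kappa>_in

lemma \<epsilon>_0 [simp]: "\<epsilon> 0 = 0" and \<epsilon>_1 [simp]: "\<epsilon> 1 = 1"
  using \<epsilon>_\<kappa>[of 0] \<epsilon>_\<kappa>[of 1] by (simp_all add: \<kappa>_0 \<kappa>_1)

lemma \<epsilon>_uminus: "x \<in> A \<Longrightarrow> \<epsilon> (- x) = - \<epsilon> x"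
  using \<epsilon>_add[of x "- x"] by (simp add: A_uminus eq_neg_iff_add_eq_0 add.commute)

lemma \<epsilon>_diff: "\<lbrakk>x \<in> A; y \<in> A\<rbrakk> \<Longrightarrow> \<epsilon> (x - y) = \<epsilon> x - \<epsilon> y"
  using \<epsilon>_add[of x "- y"] by (simp add: A_uminus \<epsilon>_uminus)

definition I :: "'a set" where
  "I = {x \<in> A. \<epsilon> x = 0}"

lemma I_subset: "I \<subseteq> A" and I_A: "x \<in> I \<Longrightarrow> x \<in> A" and I_\<epsilon>: "x \<in> I \<Longrightarrow> \<epsilon> x = 0"
  by (auto simp: I_def)

lemma I_0: "0 \<in> I"
  by (simp add: I_def A_0)

lemma I_add: "\<lbrakk>x \<in> I; y \<in> I\<rbrakk> \<Longrightarrow> x + y \<in> I"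
  by (simp add: I_def A_add \<epsilon>_add)

lemma I_mult: "\<lbrakk>x \<in> A; y \<in> I\<rbrakk> \<Longrightarrow> x * y \<in> I"
  by (simp add: I_def A_mult \<epsilon>_mult)

lemma I_mult_right: "\<lbrakk>x \<in> I; y \<in> A\<rbrakk> \<Longrightarrow> x * y \<in> I"
  by (simp add: I_def A_mult \<epsilon>_mult)

lemma I_minus_\<epsilon>: "x \<in> A \<Longrightarrow> x - \<kappa> (\<epsilon> x) \<in> I"
  by (simp add: I_def A_diff \<kappa>_in \<epsilon>_diff \<epsilon>_\<kappa>)

text \<open>The powers of the maximal ideal \<open>I\<close> of the base point, with the whole
  algebra as power zero; membership in \<open>P k\<close> is vanishing to order
  \<open>k\<close>.\<close>

primrec P :: "nat \<Rightarrow> 'a set" where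
  "P 0 = A"
| "P (Suc k) = combos (P k) I"

lemma P_ideal: "0 \<in> P k \<and> (\<forall>x\<in>P k. \<forall>y\<in>P k. x + y \<in> P k) \<and> (\<forall>a\<in>A. \<forall>x\<in>P k. a * x \<in> P k) \<and> P k \<subseteq> A"
proof (induction k)
  case 0
  then show ?case by (auto intro: A_intros)
next
  case (Suc k)
  have "a * x \<in> combos (P k) I" if "a \<in> A" "x \<in> combos (P k) I" for a x
    using that(2)
    by (rule combos_mult) (use Suc that(1) in \<open>auto simp: mult.assoc[symmetric] intro: combos_gen\<close>)
  then show ?case
    using A_combos[of "P k" I] Suc I_subset by (auto intro: combos_0 combos_add)
qed

lemma P_0: "0 \<in> P k" and P_add: "\<lbrakk>x \<in> P k; y \<in> P k\<rbrakk> \<Longrightarrow> x + y \<in> P k"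
  and P_mult: "\<lbrakk>a \<in> A; x \<in> P k\<rbrakk> \<Longrightarrow> a * x \<in> P k" and P_A: "x \<in> P k \<Longrightarrow> x \<in> A"
  using P_ideal by auto

lemma P_mult_right: "\<lbrakk>x \<in> P k; a \<in> A\<rbrakk> \<Longrightarrow> x * a \<in> P k"
  using P_mult by (simp add: mult.commute)

lemma P_uminus: "x \<in> P k \<Longrightarrow> - x \<in> P k"
  using P_mult[of "- 1" x k] by (simp add: A_1 A_uminus)

lemma P_diff: "\<lbrakk>x \<in> P k; y \<in> P k\<rbrakk> \<Longrightarrow> x - y \<in> P k"
  using P_add[OF _ P_uminus, of x k y] by simp

lemma P_sum: "(\<And>i. i \<in> E \<Longrightarrow> f i \<in> P k) \<Longrightarrow> sum f E \<in> P k"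
  by (induction E rule: infinite_finite_induct) (auto intro: P_0 P_add)

lemma P_Suc_subset: "P (Suc k) \<subseteq> P k"
  by (simp, rule combos_subset) (auto intro: P_0 P_add P_mult_right I_A)

lemma P_antimono: "j \<le> k \<Longrightarrow> P k \<subseteq> P j"
  by (rule lift_Suc_antimono_le[of P]) (rule P_Suc_subset)

lemma P_1: "P (Suc 0) = I"
proof
  show "P (Suc 0) \<subseteq> I"
    by (simp, rule combos_subset) (auto intro: I_0 I_add I_mult)
  show "I \<subseteq> P (Suc 0)"
    using combos_gen[of 1 A _ I] A_1 by auto
qed

lemma P_mult_P: "\<lbrakk>x \<in> P j; y \<in> P k\<rbrakk> \<Longrightarrow> x * y \<in> P (j + k)"
proof (induction k arbitrary: y)
  case 0
  then show ?case by (simp add: P_mult_right)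
next
  case (Suc k)
  have "x * y \<in> combos (P (j + k)) I"
    using Suc.prems(2)[simplified]
    by (rule combos_mult) (use Suc in \<open>auto simp: mult.assoc[symmetric] intro: combos_gen\<close>)
  then show ?case by simp
qed

lemma P_prod_mset: "set_mset M \<subseteq> I \<Longrightarrow> prod_mset M \<in> P (size M)"
proof (induction M)
  case empty
  then show ?case by (simp add: A_1)
next
  case (add x M)
  then show ?case
    using P_mult_P[of "prod_mset M" "size M" x 1] by (auto simp: P_1 mult.commute simp del: P.simps(2))
qed

text \<open>
  Elimination: if the columns of a matrix are independent at the base point, they are independent near
  the base point, where being zero near the base point means being killed by some \<open>w\<close> with \<open>\<epsilon> w \<noteq> 0\<close>.
\<close>

lemma independent_near:
  assumes "finite S" "\<And>r b. \<lbrakk>r \<in> R; b \<in> S\<rbrakk> \<Longrightarrow> r b \<in> A"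
    and "\<And>c b. \<lbrakk>\<And>r. r \<in> R \<Longrightarrow> (\<Sum>b\<in>S. c b * \<epsilon> (r b)) = 0; b \<in> S\<rbrakk> \<Longrightarrow> c b = 0"
  shows "\<exists>w\<in>A. \<epsilon> w \<noteq> 0 \<and>
    (\<forall>\<beta>. (\<forall>r\<in>R. (\<Sum>b\<in>S. \<beta> b * r b) = 0) \<longrightarrow> (\<forall>b\<in>S. w * \<beta> b = 0))"
  using assms
proof (induction S arbitrary: R rule: finite_induct)
  case empty
  then show ?case by (intro bexI[of _ 1]) (auto intro: A_1)
next
  case (insert s S)
  have "\<exists>r0\<in>R. \<epsilon> (r0 s) \<noteq> 0"
  proof (rule ccontr)
    assume "\<not> ?thesis"
    then have "\<epsilon> (r s) = 0" if "r \<in> R" for r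
      using that by blast
    moreover have "(\<Sum>b\<in>S. (if b = s then 1 else 0) * \<epsilon> (r b)) = 0" for r
      using insert.hyps(2) by (intro sum.neutral) auto
    ultimately have "(1::'k) = 0"
      using insert.prems(2)[of "\<lambda>b. if b = s then 1 else 0" s] insert.hyps by auto
    then show False by simp
  qed
  then obtain r0 where r0: "r0 \<in> R" "\<epsilon> (r0 s) \<noteq> 0"
    by blast
  have A: "r b \<in> A" if "r \<in> R" "b \<in> insert s S" for r b
    using insert.prems(1) that by blast
  \<comment> \<open>The rows after elimination of column \<open>s\<close> with the pivot
    \<open>r0 s\<close>, by cross-multiplication because the pivot need not be invertible in
    \<open>A\<close>.\<close>
  define R' where "R' = (\<lambda>r b. r0 s * r b - r s * r0 b) ` R"
  have "\<exists>w\<in>A. \<epsilon> w \<noteq> 0 \<and>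
    (\<forall>\<beta>. (\<forall>r\<in>R'. (\<Sum>b\<in>S. \<beta> b * r b) = 0) \<longrightarrow> (\<forall>b\<in>S. w * \<beta> b = 0))"
  proof (rule insert.IH)
    show "r b \<in> A" if "r \<in> R'" "b \<in> S" for r b
      using that A r0(1) by (auto simp: R'_def intro!: A_intros)
  next
    fix c :: "'b \<Rightarrow> 'k" and b
    assume c: "\<And>r. r \<in> R' \<Longrightarrow> (\<Sum>b\<in>S. c b * \<epsilon> (r b)) = 0" and b: "b \<in> S"
    \<comment> \<open>The value at \<open>s\<close> is the one that solves row \<open>r0\<close> at
      the base point.\<close>
    define c' where "c' = c(s := - (\<Sum>b\<in>S. c b * \<epsilon> (r0 b)) / \<epsilon> (r0 s))"
    have "(\<Sum>b\<in>insert s S. c' b * \<epsilon> (r b)) = 0" if r: "r \<in> R" for r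
    proof -
      have "0 = (\<Sum>b\<in>S. c b * \<epsilon> (r0 s * r b - r s * r0 b))"
        using c[of "\<lambda>b. r0 s * r b - r s * r0 b"] r by (auto simp: R'_def)
      also have "\<dots> = (\<Sum>b\<in>S. \<epsilon> (r0 s) * (c b * \<epsilon> (r b)) - \<epsilon> (r s) * (c b * \<epsilon> (r0 b)))"
        using A r r0(1) by (intro sum.cong) (auto simp: \<epsilon>_diff \<epsilon>_mult A_mult algebra_simps)
      also have "\<dots> = \<epsilon> (r0 s) * (\<Sum>b\<in>S. c b * \<epsilon> (r b)) - \<epsilon> (r s) * (\<Sum>b\<in>S. c b * \<epsilon> (r0 b))"
        by (simp add: sum_subtractf sum_distrib_left)
      finally have 1: "\<epsilon> (r0 s) * (\<Sum>b\<in>S. c b * \<epsilon> (r b)) = \<epsilon> (r s) * (\<Sum>b\<in>S. c b * \<epsilon> (r0 b))"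
        by simp
      have "(\<Sum>b\<in>insert s S. c' b * \<epsilon> (r b)) = c' s * \<epsilon> (r s) + (\<Sum>b\<in>S. c b * \<epsilon> (r b))"
        using insert.hyps by (auto simp: c'_def intro!: sum.cong)
      also have "\<dots> = 0"
        using 1 r0(2) by (simp add: c'_def field_simps)
      finally show ?thesis .
    qed
    then have "c' b = 0"
      using insert.prems(2)[of c' b] b by blast
    then show "c b = 0"
      using b insert.hyps(2) by (auto simp: c'_def split: if_splits)
  qed
  then obtain w where w: "w \<in> A" "\<epsilon> w \<noteq> 0"
    "\<And>\<beta> b. \<lbrakk>\<forall>r\<in>R'. (\<Sum>b\<in>S. \<beta> b * r b) = 0; b \<in> S\<rbrakk> \<Longrightarrow> w * \<beta> b = 0"
    by blast
  \<comment> \<open>The extra factor \<open>r0 s\<close> reaches the eliminated column: by row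
    \<open>r0\<close>, \<open>\<beta> s * r0 s\<close> is a combination of the other coefficients,
    which \<open>w\<close> kills.\<close>
  show ?case
  proof (intro bexI[of _ "w * r0 s"] conjI allI impI)
    show "w * r0 s \<in> A" "\<epsilon> (w * r0 s) \<noteq> 0"
      using w r0 A by (auto simp: \<epsilon>_mult intro: A_mult)
  next
    fix \<beta> assume \<beta>: "\<forall>r\<in>R. (\<Sum>b\<in>insert s S. \<beta> b * r b) = 0"
    then have \<beta>': "(\<Sum>b\<in>S. \<beta> b * r b) = - (\<beta> s * r s)" if "r \<in> R" for r
      using that insert.hyps by (simp add: eq_neg_iff_add_eq_0 add.commute)
    have "(\<Sum>b\<in>S. \<beta> b * (r0 s * r b - r s * r0 b)) = 0" if "r \<in> R" for r
    proof -
      have "(\<Sum>b\<in>S. \<beta> b * (r0 s * r b - r s * r0 b)) =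
          r0 s * (\<Sum>b\<in>S. \<beta> b * r b) - r s * (\<Sum>b\<in>S. \<beta> b * r0 b)"
        by (simp add: sum_distrib_left sum_subtractf algebra_simps)
      then show ?thesis
        using that r0(1) by (simp add: \<beta>' algebra_simps)
    qed
    then have S: "w * \<beta> b = 0" if "b \<in> S" for b
      using w(3)[of \<beta> b] that by (auto simp: R'_def)
    have "w * r0 s * \<beta> s = w * (\<beta> s * r0 s)"
      by (simp add: ac_simps)
    also have "\<dots> = - (w * (\<Sum>b\<in>S. \<beta> b * r0 b))"
      using \<beta>'[OF r0(1)] by simp
    also have "\<dots> = - (\<Sum>b\<in>S. (w * \<beta> b) * r0 b)"
      by (simp add: sum_distrib_left mult.assoc)
    also have "\<dots> = 0"
      using S by simp
    finally have "w * r0 s * \<beta> s = 0" .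
    moreover have "w * r0 s * \<beta> b = 0" if "b \<in> S" for b
      using S[OF that] by (metis mult.assoc mult.commute mult_zero_left)
    ultimately show "\<forall>b\<in>insert s S. w * r0 s * \<beta> b = 0"
      by blast
  qed
qed

end

section \<open>Augmented algebras of prime characteristic\<close>

text \<open>
  The last assumption replaces homogeneity: for the coordinate algebra of a group, a point derivation
  at the identity extends to an invariant derivation.
\<close>

locale augmented_char_p = augmented_algebra A \<kappa> \<epsilon>
  for A :: "'a::comm_ring_1 set" and \<kappa> :: "'k::alg_closed_field \<Rightarrow> 'a" and \<epsilon> +
  fixes p :: nat and Y :: "'a set"
  assumes prime_p: "prime p" and CHAR_p: "CHAR('a) = p"
    and reduced: "\<lbrakk>x \<in> A; x ^ p = 0\<rbrakk> \<Longrightarrow> x = 0"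
    and finite_Y: "finite Y" and Y_I: "Y \<subseteq> I"
    and generated: "\<lbrakk>B \<subseteq> A; range \<kappa> \<subseteq> B; Y \<subseteq> B; \<And>x y. \<lbrakk>x \<in> B; y \<in> B\<rbrakk> \<Longrightarrow> x + y \<in> B;
        \<And>x y. \<lbrakk>x \<in> B; y \<in> B\<rbrakk> \<Longrightarrow> x * y \<in> B\<rbrakk> \<Longrightarrow> A \<subseteq> B"
    and derivation_extends: "\<lbrakk>\<And>x y. \<lbrakk>x \<in> A; y \<in> A\<rbrakk> \<Longrightarrow> d (x + y) = d x + d y;
        \<And>c x. x \<in> A \<Longrightarrow> d (\<kappa> c * x) = c * d x;
        \<And>x y. \<lbrakk>x \<in> A; y \<in> A\<rbrakk> \<Longrightarrow> d (x * y) = \<epsilon> x * d y + \<epsilon> y * d x\<rbrakk> \<Longrightarrow>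
        \<exists>D. (\<forall>x\<in>A. D x \<in> A \<and> \<epsilon> (D x) = d x) \<and>
            (\<forall>x\<in>A. \<forall>y\<in>A. D (x + y) = D x + D y \<and> D (x * y) = x * D y + y * D x)"
begin

lemma p_pos: "p > 0" and p_pow_pos: "p ^ e > 0"
  using prime_p by (auto simp: prime_gt_0_nat)

lemma dream: "((x::'a) + y) ^ (p ^ e) = x ^ (p ^ e) + y ^ (p ^ e)"
  using freshmans_dream'[of "p ^ e" e x y] prime_p by (simp add: CHAR_p)

lemma dream_diff: "((x::'a) - y) ^ (p ^ e) = x ^ (p ^ e) - y ^ (p ^ e)"
  using dream[of "x - y" y e] by (simp add: eq_diff_eq)

lemma dream_sum: "(\<Sum>i\<in>E. f i :: 'a) ^ (p ^ e) = (\<Sum>i\<in>E. f i ^ (p ^ e))"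
  using freshmans_dream_sum'[of "p ^ e" e f E] prime_p by (simp add: CHAR_p)

lemmas dream1 = dream[of _ _ 1, simplified] dream_diff[of _ _ 1, simplified]
  dream_sum[of _ _ 1, simplified]

lemma \<kappa>_power: "\<kappa> (c ^ n) = \<kappa> c ^ n"
  by (induction n) (simp_all add: \<kappa>_1 \<kappa>_mult)

lemma of_nat_p: "of_nat p = (0::'a)"
  using of_nat_CHAR[where 'a='a] by (simp add: CHAR_p)

lemma of_nat_nonzero:
  assumes "0 < n" "n < p" shows "of_nat n \<noteq> (0::'k)"
proof
  assume "of_nat n = (0::'k)"
  moreover have "\<kappa> (of_nat n) = of_nat n"
    by (induction n) (simp_all add: \<kappa>_0 \<kappa>_add \<kappa>_1)
  ultimately have "of_nat n = (0::'a)"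
    using \<kappa>_0 by metis
  then have "p dvd n"
    by (simp add: of_nat_eq_0_iff_char_dvd CHAR_p)
  then show False
    using assms by (auto dest: dvd_imp_le)
qed

text \<open>The Frobenius power of \<open>I\<close> when \<open>q\<close> is a power of
  \<open>p\<close>: the ideal of \<open>A\<close> generated by the \<open>q\<close>-th powers of
  \<open>I\<close>.\<close>

definition Fr :: "nat \<Rightarrow> 'a set" where
  "Fr q = combos ((\<lambda>f. f ^ q) ` I) A"

lemma Fr_0: "0 \<in> Fr q" and Fr_add: "\<lbrakk>x \<in> Fr q; y \<in> Fr q\<rbrakk> \<Longrightarrow> x + y \<in> Fr q"
  by (auto simp: Fr_def intro: combos_0 combos_add)

lemma Fr_gen: "\<lbrakk>f \<in> I; a \<in> A\<rbrakk> \<Longrightarrow> f ^ q * a \<in> Fr q"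
  by (auto simp: Fr_def intro: combos_gen)

lemma Fr_mult:
  assumes "a \<in> A" "x \<in> Fr q" shows "a * x \<in> Fr q"
  using assms(2) unfolding Fr_def
  by (rule combos_mult) (use assms(1) in \<open>auto simp: mult.left_commute[of a] intro!: combos_gen A_intros\<close>)

lemma Fr_A: "x \<in> Fr q \<Longrightarrow> x \<in> A"
  using A_combos[of "(\<lambda>f. f ^ q) ` I" A] by (auto simp: Fr_def intro: A_power I_A)

lemma Fr_1: "Fr (Suc 0) \<subseteq> I"
  unfolding Fr_def by (rule combos_subset) (auto intro: I_0 I_add I_mult_right)

text \<open>The elements that differ from a constant by a member of the ideal of \<open>Y\<close>
  form a subalgebra containing \<open>Y\<close>, hence are all of \<open>A\<close>. For an element
  of \<open>I\<close>, the value at the base point forces the constant to be zero.\<close>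

lemma I_generated: "I \<subseteq> combos A Y"
proof -
  let ?J = "combos A Y" and ?B = "{f \<in> A. \<exists>c. f - \<kappa> c \<in> combos A Y}"
  have J_mult: "a * x \<in> ?J" if "a \<in> A" "x \<in> ?J" for a x
    using that(2) by (rule combos_mult) (use that(1) in \<open>auto simp: mult.assoc[symmetric] intro!: combos_gen A_mult\<close>)
  have J_I: "?J \<subseteq> I"
    by (rule combos_subset) (use Y_I in \<open>auto intro: I_0 I_add I_mult\<close>)
  have "A \<subseteq> ?B"
  proof (rule generated)
    have "\<exists>c. \<kappa> b - \<kappa> c \<in> combos A Y" for b
      using combos_0 by (intro exI[of _ b]) simp
    then show "range \<kappa> \<subseteq> ?B"
      by (auto simp: \<kappa>_in)
    show "Y \<subseteq> ?B"
      using Y_I I_subset A_1 combos_gen[of 1 A _ Y] by (auto intro!: exI[of _ 0] simp: \<kappa>_0)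
  next
    fix x y assume "x \<in> ?B" "y \<in> ?B"
    then obtain c d where *: "x \<in> A" "y \<in> A" "x - \<kappa> c \<in> ?J" "y - \<kappa> d \<in> ?J"
      by blast
    have "x + y - \<kappa> (c + d) = (x - \<kappa> c) + (y - \<kappa> d)"
      by (simp add: \<kappa>_add)
    also have "\<dots> \<in> ?J"
      using * by (intro combos_add)
    finally show "x + y \<in> ?B"
      using * A_add by blast
    have "x * y - \<kappa> (c * d) = x * (y - \<kappa> d) + \<kappa> d * (x - \<kappa> c)"
      by (simp add: \<kappa>_mult algebra_simps)
    also have "\<dots> \<in> ?J"
      using * by (intro combos_add J_mult \<kappa>_in)
    finally show "x * y \<in> ?B"
      using * A_mult by blast
  qed auto
  show ?thesis
  proof
    fix f assume f: "f \<in> I"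
    then obtain c where c: "f - \<kappa> c \<in> ?J"
      using \<open>A \<subseteq> ?B\<close> I_A by blast
    then have "\<epsilon> f - c = 0"
      using J_I f by (metis I_A I_\<epsilon> \<epsilon>_\<kappa> \<epsilon>_diff \<kappa>_in subsetD)
    then show "f \<in> ?J"
      using c f by (simp add: I_\<epsilon> \<kappa>_0)
  qed
qed

lemma P_generated: "P k \<subseteq> combos A (prod_mset ` {M. set_mset M \<subseteq> Y \<and> size M = k})"
proof (induction k)
  case 0
  have "f \<in> combos A {1}" if "f \<in> A" for f
    using combos_gen[of f A 1 "{1}"] that by simp
  moreover have "prod_mset ` {M. set_mset M \<subseteq> Y \<and> size M = 0} = {1}"
    by auto
  ultimately show ?case by auto
next
  case (Suc k)
  let ?T = "combos A (prod_mset ` {M. set_mset M \<subseteq> Y \<and> size M = Suc k})"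
  have "x * y \<in> ?T" if "x \<in> P k" "y \<in> I" for x y
  proof (rule combos_mult2)
    show "x \<in> combos A (prod_mset ` {M. set_mset M \<subseteq> Y \<and> size M = k})" "y \<in> combos A Y"
      using that Suc I_generated by auto
  next
    fix c s c' s'
    assume *: "c \<in> A" "s \<in> prod_mset ` {M. set_mset M \<subseteq> Y \<and> size M = k}" "c' \<in> A" "s' \<in> Y"
    then obtain M where M: "s = prod_mset M" "set_mset M \<subseteq> Y" "size M = k" by auto
    then have "prod_mset (add_mset s' M) \<in> prod_mset ` {M. set_mset M \<subseteq> Y \<and> size M = Suc k}"
      using * by (intro imageI) auto
    then have "(c * c') * prod_mset (add_mset s' M) \<in> ?T"
      using * by (intro combos_gen A_mult)
    then show "c * s * (c' * s') \<in> ?T"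
      by (simp add: M(1) ac_simps)
  qed
  then show ?case
    by simp (rule combos_subset, auto intro: combos_0 combos_add)
qed

text \<open>Pigeonhole: a product of \<open>card Y * q + 1\<close> generators contains some
  \<open>y ^ q\<close>. This makes the descent through the powers of \<open>I\<close> modulo
  \<open>Fr q\<close> finite.\<close>

lemma P_subset_Fr:
  obtains m where "P m \<subseteq> Fr q"
proof -
  let ?m = "card Y * q + 1"
  have "combos A (prod_mset ` {M. set_mset M \<subseteq> Y \<and> size M = ?m}) \<subseteq> Fr q"
  proof (rule combos_subset)
    fix c s assume c: "c \<in> A" and "s \<in> prod_mset ` {M. set_mset M \<subseteq> Y \<and> size M = ?m}"
    then obtain M where M: "s = prod_mset M" "set_mset M \<subseteq> Y" "size M = ?m" by auto
    have "\<exists>y\<in>Y. q \<le> count M y"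
    proof (rule ccontr)
      assume *: "\<not> ?thesis"
      have "size M = (\<Sum>y\<in>set_mset M. count M y)"
        by (simp add: size_multiset_overloaded_eq)
      also have "\<dots> \<le> (\<Sum>y\<in>Y. count M y)"
        using M(2) finite_Y by (intro sum_mono2) auto
      also have "\<dots> \<le> (\<Sum>y\<in>Y. q)"
        using * by (intro sum_mono) (auto simp: not_le intro: less_imp_le)
      finally show False
        using M(3) by simp
    qed
    then obtain y where y: "y \<in> Y" "q \<le> count M y" by blast
    define N where "N = M - replicate_mset q y"
    have "M = replicate_mset q y + N"
      using y(2) by (simp add: N_def count_le_replicate_mset_subset_eq)
    then have "s = y ^ q * prod_mset N"
      by (simp add: M(1))
    moreover have "prod_mset N \<in> A"
      using M(2) Y_I I_subset by (intro A_prod_mset) (auto simp: N_def dest: in_diffD)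
    ultimately show "c * s \<in> Fr q"
      using c y Y_I Fr_gen[of y "c * prod_mset N" q]
      by (simp add: A_mult subset_iff ac_simps)
  qed (auto intro: Fr_0 Fr_add)
  then show ?thesis
    using that P_generated by blast
qed

section \<open>The cotangent space at the base point, and a Nakayama lemma\<close>

definition cotangent_generators :: "'a set \<Rightarrow> bool" where
  "cotangent_generators X \<longleftrightarrow> (\<forall>f\<in>I. \<exists>c. f - (\<Sum>x\<in>X. \<kappa> (c x) * x) \<in> P 2)"

lemma P_2: "\<lbrakk>x \<in> I; y \<in> I\<rbrakk> \<Longrightarrow> x * y \<in> P 2"
  using P_mult_P[of x 1 y 1] by (simp add: P_1 numeral_2_eq_2 del: P.simps(2))

lemma P_2_I: "x \<in> P 2 \<Longrightarrow> x \<in> I"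
  using P_antimono[of 1 2] P_1 by (auto simp del: P.simps(2))

lemma cotangent_generators_Y: "cotangent_generators Y"
  unfolding cotangent_generators_def
proof
  fix f assume "f \<in> I"
  then have "f \<in> combos A Y" using I_generated by blast
  then have "f \<in> combos A ((\<lambda>y. y) ` Y)" by simp
  then obtain a where a: "\<And>y. a y \<in> A" "f = (\<Sum>y\<in>Y. a y * y)"
    using finite_Y A_0 A_add by (rule combos_image) auto
  have "f - (\<Sum>y\<in>Y. \<kappa> (\<epsilon> (a y)) * y) = (\<Sum>y\<in>Y. (a y - \<kappa> (\<epsilon> (a y))) * y)"
    by (simp add: a(2) sum_subtractf left_diff_distrib)
  also have "\<dots> \<in> P 2"
    using Y_I a(1) by (intro P_sum P_2 I_minus_\<epsilon>) auto
  finally show "\<exists>c. f - (\<Sum>y\<in>Y. \<kappa> (c y) * y) \<in> P 2"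
    by (rule exI[of _ "\<lambda>y. \<epsilon> (a y)"])
qed

text \<open>A spanning subset of least cardinality is a basis of \<open>I\<close> modulo
  \<open>P 2\<close>, since a nontrivial relation would make one of its elements redundant.\<close>

lemma cotangent_basis_exists:
  obtains X where "X \<subseteq> Y" "cotangent_generators X"
    "\<And>c x. \<lbrakk>(\<Sum>x\<in>X. \<kappa> (c x) * x) \<in> P 2; x \<in> X\<rbrakk> \<Longrightarrow> c x = 0"
proof -
  obtain X where X: "X \<subseteq> Y" "cotangent_generators X"
    and least: "\<And>X'. \<lbrakk>X' \<subseteq> Y; cotangent_generators X'\<rbrakk> \<Longrightarrow> card X \<le> card X'"
    using ex_has_least_nat[of "\<lambda>X. X \<subseteq> Y \<and> cotangent_generators X" Y card] cotangent_generators_Y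
    by blast
  have fin: "finite X" using X(1) finite_Y by (rule finite_subset)
  have "c x0 = 0" if sum: "(\<Sum>x\<in>X. \<kappa> (c x) * x) \<in> P 2" and x0: "x0 \<in> X" for c x0
  proof (rule ccontr)
    assume c: "c x0 \<noteq> 0"
    have "cotangent_generators (X - {x0})"
      unfolding cotangent_generators_def
    proof
      fix f assume "f \<in> I"
      then obtain b where b: "f - (\<Sum>x\<in>X. \<kappa> (b x) * x) \<in> P 2"
        using X(2) by (auto simp: cotangent_generators_def)
      \<comment> \<open>Subtracting \<open>a\<close> times the relation makes the coefficient of
        \<open>x0\<close> vanish.\<close>
      define a where "a = b x0 / c x0"
      have "f - (\<Sum>x\<in>X - {x0}. \<kappa> (b x - a * c x) * x) = f - (\<Sum>x\<in>X. \<kappa> (b x - a * c x) * x)"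
        using c by (simp add: sum.remove[OF fin x0] a_def \<kappa>_0)
      also have "\<dots> = (f - (\<Sum>x\<in>X. \<kappa> (b x) * x)) + \<kappa> a * (\<Sum>x\<in>X. \<kappa> (c x) * x)"
        by (simp add: \<kappa>_diff \<kappa>_mult sum_subtractf left_diff_distrib sum_distrib_left mult.assoc)
      also have "\<dots> \<in> P 2"
        by (intro P_add P_mult b sum \<kappa>_in)
      finally show "\<exists>c. f - (\<Sum>x\<in>X - {x0}. \<kappa> (c x) * x) \<in> P 2"
        by (intro exI[of _ "\<lambda>x. b x - a * c x"])
    qed
    then have "card X \<le> card (X - {x0})"
      using least X(1) by blast
    then show False
      using card_Diff1_less[OF fin x0] by simp
  qed
  then show ?thesis using that X by blast
qed

text \<open>The generators are solved for one at a time. A relation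
  \<open>u ^ p * m = n + f ^ p * m + t'\<close> with \<open>f\<close> in \<open>I\<close> becomes
  \<open>(u - f) ^ p * m = n + t'\<close>, because the \<open>p\<close>-th power is additive, and
  \<open>u - f\<close> is still nonzero at the base point. The factor \<open>u\<close> in the
  assumption is there for the induction, where it does not stay equal to 1.\<close>

lemma nakayama:
  assumes "finite S" "S \<subseteq> A" "N \<subseteq> A" "0 \<in> N" "\<And>x y. \<lbrakk>x \<in> N; y \<in> N\<rbrakk> \<Longrightarrow> x + y \<in> N"
    and N_mult: "\<And>a x. \<lbrakk>a \<in> A; x \<in> N\<rbrakk> \<Longrightarrow> a ^ p * x \<in> N"
    and "\<And>s. s \<in> S \<Longrightarrow> \<exists>u\<in>A. \<exists>n\<in>N. \<exists>t\<in>combos ((\<lambda>f. f ^ p) ` I) S. \<epsilon> u \<noteq> 0 \<and> u ^ p * s = n + t"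
  shows "\<exists>h\<in>A. \<epsilon> h \<noteq> 0 \<and> (\<forall>s\<in>S. h ^ p * s \<in> N)"
  using assms(1,2,7)
proof (induction S rule: finite_induct)
  case empty
  then show ?case by (intro bexI[of _ 1]) (auto intro: A_1)
next
  case (insert m S)
  let ?J = "(\<lambda>f. f ^ p) ` I"
  have J_add: "x + y \<in> ?J" if "x \<in> ?J" "y \<in> ?J" for x y
    using that I_add by (auto simp flip: dream1)
  have J_0: "0 \<in> ?J"
    using I_0 p_pos by (intro image_eqI[of _ _ 0]) (auto simp: zero_power)
  have combos_mult_J: "a ^ p * t \<in> combos ?J S" if "a \<in> A" "t \<in> combos ?J S" for a t
  proof (rule combos_mult[OF that(2)])
    fix c s assume "c \<in> ?J" "s \<in> S"
    then obtain f where "f \<in> I" "c = f ^ p" by auto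
    then have "a ^ p * (c * s) = (a * f) ^ p * s" "a * f \<in> I"
      using that(1) by (auto simp: power_mult_distrib mult.assoc intro: I_mult)
    then show "a ^ p * (c * s) \<in> combos ?J S"
      using \<open>s \<in> S\<close> by (metis combos_gen imageI)
  qed
  have split: "\<exists>f\<in>I. \<exists>t'\<in>combos ?J S. t = f ^ p * m + t'" if "t \<in> combos ?J (insert m S)" for t
    using that
  proof induction
    case combos_0
    then show ?case
      using I_0 p_pos by (intro bexI[of _ 0]) (auto intro: combos.combos_0 simp: zero_power)
  next
    case (combos_step c s t)
    then obtain f t' where *: "f \<in> I" "t' \<in> combos ?J S" "t = f ^ p * m + t'" by blast
    from combos_step.hyps obtain g where g: "g \<in> I" "c = g ^ p" by auto
    show ?case
    proof (cases "s = m")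
      case True
      then have "c * s + t = (g + f) ^ p * m + t'"
        using * g by (simp add: dream1 algebra_simps)
      then show ?thesis using * g I_add by blast
    next
      case False
      then have "c * s + t' \<in> combos ?J S"
        using combos_step.hyps * by (auto intro: combos.combos_step)
      moreover have "c * s + t = f ^ p * m + (c * s + t')"
        by (simp add: *)
      ultimately show ?thesis using * by blast
    qed
  qed
  obtain u n t where u: "u \<in> A" "n \<in> N" "t \<in> combos ?J (insert m S)" "\<epsilon> u \<noteq> 0" "u ^ p * m = n + t"
    using insert.prems(2)[of m] by blast
  obtain f t' where f: "f \<in> I" "t' \<in> combos ?J S" "t = f ^ p * m + t'"
    using split[OF u(3)] by blast
  define v where "v = u - f"
  have v: "v \<in> A" "\<epsilon> v \<noteq> 0" "v ^ p * m = n + t'"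
    using u f by (auto simp: v_def dream1 algebra_simps \<epsilon>_diff I_A I_\<epsilon> intro: A_diff)
  have "\<exists>h\<in>A. \<epsilon> h \<noteq> 0 \<and> (\<forall>s\<in>S. h ^ p * s \<in> N)"
  proof (rule insert.IH)
    show "S \<subseteq> A" using insert.prems by auto
  next
    fix l assume "l \<in> S"
    then obtain u' n' s where u': "u' \<in> A" "n' \<in> N" "s \<in> combos ?J (insert m S)" "\<epsilon> u' \<noteq> 0"
      "u' ^ p * l = n' + s"
      using insert.prems(2)[of l] by blast
    obtain g s' where g: "g \<in> I" "s' \<in> combos ?J S" "s = g ^ p * m + s'"
      using split[OF u'(3)] by blast
    \<comment> \<open>Multiplying the relation for \<open>l\<close> by \<open>v ^ p\<close> allows
      the relation for \<open>m\<close> to be substituted, which removes \<open>m\<close> from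
      it.\<close>
    have "(v * u') ^ p * l = v ^ p * (u' ^ p * l)"
      by (simp add: power_mult_distrib mult.assoc)
    also have "\<dots> = v ^ p * (n' + (g ^ p * m + s'))"
      by (simp only: u'(5) g(3))
    also have "\<dots> = v ^ p * n' + g ^ p * (v ^ p * m) + v ^ p * s'"
      by (simp add: algebra_simps)
    also have "\<dots> = (v ^ p * n' + g ^ p * n) + (g ^ p * t' + v ^ p * s')"
      by (simp only: v(3)) (simp add: algebra_simps)
    finally have "(v * u') ^ p * l = (v ^ p * n' + g ^ p * n) + (g ^ p * t' + v ^ p * s')" .
    moreover have "v ^ p * n' + g ^ p * n \<in> N"
      using v(1) g(1) u'(2) u(2) by (intro assms(5) N_mult) (auto intro: I_A)
    moreover have "g ^ p * t' + v ^ p * s' \<in> combos ?J S"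
      using v(1) g(1,2) f(2) by (intro combos_add combos_mult_J) (auto intro: I_A)
    moreover have "v * u' \<in> A" "\<epsilon> (v * u') \<noteq> 0"
      using v u' by (auto simp: \<epsilon>_mult intro: A_mult)
    ultimately show "\<exists>u\<in>A. \<exists>n\<in>N. \<exists>t\<in>combos ?J S. \<epsilon> u \<noteq> 0 \<and> u ^ p * l = n + t"
      by blast
  qed
  then obtain h where h: "h \<in> A" "\<epsilon> h \<noteq> 0" "\<And>s. s \<in> S \<Longrightarrow> h ^ p * s \<in> N" by blast
  have "h ^ p * t \<in> N" if "t \<in> combos ?J S" for t
    using that
  proof induction
    case (combos_step c s t)
    then obtain f where "f \<in> I" "c = f ^ p" by auto
    then show ?case
      using combos_step h N_mult[of f "h ^ p * s"] assms(5)
      by (auto simp: distrib_left I_A mult.left_commute)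
  qed (use assms(4) in simp)
  then have "h ^ p * n + h ^ p * t' \<in> N"
    using assms(5)[OF N_mult[OF h(1) u(2)]] f(2) by blast
  moreover have "(h * v) ^ p * m = h ^ p * n + h ^ p * t'"
    using v(3) by (simp add: power_mult_distrib mult.assoc distrib_left)
  ultimately have "(h * v) ^ p * m \<in> N" by simp
  moreover have "(h * v) ^ p * s \<in> N" if "s \<in> S" for s
    using N_mult[OF v(1) h(3)[OF that]] by (simp add: power_mult_distrib ac_simps)
  ultimately show ?case
    using h v by (intro bexI[of _ "h * v"]) (auto simp: \<epsilon>_mult intro: A_mult)
qed

end

section \<open>Coordinates and differential operators at the base point\<close>

text \<open>A monomial is encoded by the multiset of its factors: \<open>count M\<close> is the
  exponent vector and \<open>prod_mset M\<close> the monomial. \<open>mset_mod\<close> and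
  \<open>mset_div\<close> divide every exponent with remainder.\<close>

definition mset_mod :: "nat \<Rightarrow> 'b multiset \<Rightarrow> 'b multiset" where
  "mset_mod n M = (\<Sum>x\<in>set_mset M. replicate_mset (count M x mod n) x)"

definition mset_div :: "nat \<Rightarrow> 'b multiset \<Rightarrow> 'b multiset" where
  "mset_div n M = (\<Sum>x\<in>set_mset M. replicate_mset (count M x div n) x)"

lemma count_sum_replicate_mset:
  "finite S \<Longrightarrow> count (\<Sum>x\<in>S. replicate_mset (f x) x) y = (if y \<in> S then f y else 0)"
  by (simp add: count_sum sum.delta)

lemma count_mset_mod [simp]: "count (mset_mod n M) x = count M x mod n"
  by (auto simp: mset_mod_def count_sum_replicate_mset not_in_iff)

lemma count_mset_div [simp]: "count (mset_div n M) x = count M x div n"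
  by (auto simp: mset_div_def count_sum_replicate_mset not_in_iff)

lemma mset_mod_div: "mset_mod n M + repeat_mset n (mset_div n M) = M"
  by (rule multiset_eqI) simp

lemma prod_mset_repeat: "prod_mset (repeat_mset n M) = prod_mset M ^ n"
  by (induction n) (auto simp: prod_mset_Un)

definition small_msets :: "'b set \<Rightarrow> nat \<Rightarrow> 'b multiset set" where
  "small_msets X q = {M. set_mset M \<subseteq> X \<and> (\<forall>x. count M x < q)}"

lemma small_msets_iff: "M \<in> small_msets X q \<longleftrightarrow> (\<forall>x. count M x < q \<and> (x \<notin> X \<longrightarrow> count M x = 0))"
  unfolding small_msets_def by (auto simp: subset_iff) (metis count_eq_zero_iff)+

lemma finite_small_msets:
  assumes "finite X"
  shows "finite (small_msets X q)"
proof (rule finite_imageD)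
  show "finite (count ` small_msets X q)"
    by (rule finite_subset[OF _ finite_set_of_finite_funs[OF assms, of "{..<q}" 0]])
      (auto simp: small_msets_iff)
  show "inj_on count (small_msets X q)"
    by (intro inj_onI) (simp add: multiset_eq_iff)
qed

lemma mset_mod_small: "\<lbrakk>set_mset M \<subseteq> X; n > 0\<rbrakk> \<Longrightarrow> mset_mod n M \<in> small_msets X n"
  unfolding small_msets_iff subset_iff count_mset_mod
  by (metis count_eq_zero_iff mod_0 mod_less_divisor)

text \<open>Uniqueness of division with remainder in each exponent. With \<open>m = p\<close> it
  splits off the lowest digit in base \<open>p\<close>, which drives the induction on the power of
  \<open>p\<close>.\<close>

lemma small_msets_split:
  assumes "m > 0"
  shows "bij_betw (\<lambda>(M, N). M + repeat_mset m N) (small_msets X m \<times> small_msets X n) (small_msets X (m * n))"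
proof (rule bij_betw_byWitness[where f' = "\<lambda>M. (mset_mod m M, mset_div m M)"])
  show "(\<lambda>(M, N). M + repeat_mset m N) ` (small_msets X m \<times> small_msets X n) \<subseteq> small_msets X (m * n)"
  proof clarify
    fix M N :: "'a multiset" assume *: "M \<in> small_msets X m" "N \<in> small_msets X n"
    have "count M x + m * count N x < m * n" for x
    proof -
      have "count M x < m" "count N x + 1 \<le> n"
        using * by (auto simp: small_msets_iff Suc_le_eq)
      then have "count M x + m * count N x < m * (count N x + 1)" "m * (count N x + 1) \<le> m * n"
        by (simp_all only: mult_le_mono2) simp
      then show ?thesis by linarith
    qed
    then show "M + repeat_mset m N \<in> small_msets X (m * n)"
      using * by (auto simp: small_msets_iff)
  qed
  show "(\<lambda>M. (mset_mod m M, mset_div m M)) ` small_msets X (m * n) \<subseteq> small_msets X m \<times> small_msets X n"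
    using assms by (auto simp: small_msets_iff less_mult_imp_div_less mult.commute)
  show "\<forall>a\<in>small_msets X m \<times> small_msets X n.
      (\<lambda>M. (mset_mod m M, mset_div m M)) ((\<lambda>(M, N). M + repeat_mset m N) a) = a"
    using assms by (auto simp: small_msets_iff multiset_eq_iff)
qed (auto simp: mset_mod_div)

text \<open>The assumptions only fix a basis \<open>X\<close> of the cotangent space, as provided by
  \<open>cotangent_basis_exists\<close>. What smoothness amounts to here is proved, in
  \<open>monomials_independent_mod_Fr\<close>.\<close>

locale smooth_point = augmented_char_p A \<kappa> \<epsilon> p Y
  for A :: "'a::comm_ring_1 set" and \<kappa> :: "'k::alg_closed_field \<Rightarrow> 'a" and \<epsilon> p Y +
  fixes X :: "'a set"
  assumes X_Y: "X \<subseteq> Y" and X_generates: "cotangent_generators X"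
    and X_independent: "\<lbrakk>(\<Sum>x\<in>X. \<kappa> (c x) * x) \<in> P 2; x \<in> X\<rbrakk> \<Longrightarrow> c x = 0"
begin

lemma X_I: "X \<subseteq> I" and finite_X: "finite X" and X_A: "X \<subseteq> A"
  using X_Y Y_I finite_Y I_subset by (auto intro: finite_subset)

lemmas finite_E = finite_small_msets[OF finite_X]

text \<open>For \<open>x\<close> in \<open>X\<close>, the functional
  \<open>\<lambda>f. coef f x\<close> is the tangent vector at the base point dual to
  \<open>x\<close>.\<close>

definition coef :: "'a \<Rightarrow> 'a \<Rightarrow> 'k" where
  "coef f = (SOME c. f - \<kappa> (\<epsilon> f) - (\<Sum>x\<in>X. \<kappa> (c x) * x) \<in> P 2)"

lemma coef:
  assumes "f \<in> A"
  shows "f - \<kappa> (\<epsilon> f) - (\<Sum>x\<in>X. \<kappa> (coef f x) * x) \<in> P 2"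
proof -
  have "\<exists>c. f - \<kappa> (\<epsilon> f) - (\<Sum>x\<in>X. \<kappa> (c x) * x) \<in> P 2"
    using X_generates I_minus_\<epsilon>[OF assms] unfolding cotangent_generators_def by blast
  then show ?thesis
    unfolding coef_def by (rule someI_ex)
qed

lemma I_sum: "(\<And>i. i \<in> E \<Longrightarrow> f i \<in> I) \<Longrightarrow> sum f E \<in> I"
  by (induction E rule: infinite_finite_induct) (auto intro: I_0 I_add)

text \<open>The constant \<open>e\<close> may be arbitrary because applying
  \<open>\<epsilon>\<close> to the membership already forces
  \<open>e = \<epsilon> f\<close>.\<close>

lemma coef_eqI:
  assumes f: "f \<in> A" and c: "f - \<kappa> e - (\<Sum>x\<in>X. \<kappa> (c x) * x) \<in> P 2" and x: "x \<in> X"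
  shows "coef f x = c x"
proof -
  have "\<epsilon> (f - \<kappa> e - (\<Sum>x\<in>X. \<kappa> (c x) * x)) = 0"
    using c by (rule I_\<epsilon>[OF P_2_I])
  moreover have "(\<Sum>x\<in>X. \<kappa> (c x) * x) \<in> I"
    using X_I by (intro I_sum I_mult \<kappa>_in) auto
  ultimately have e: "\<epsilon> f = e"
    using f by (simp add: \<epsilon>_diff A_intros I_A I_\<epsilon> \<epsilon>_\<kappa>)
  have "(\<Sum>x\<in>X. \<kappa> (c x - coef f x) * x) =
      (f - \<kappa> (\<epsilon> f) - (\<Sum>x\<in>X. \<kappa> (coef f x) * x)) - (f - \<kappa> e - (\<Sum>x\<in>X. \<kappa> (c x) * x))"
    by (simp add: e \<kappa>_diff left_diff_distrib sum_subtractf)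
  also have "\<dots> \<in> P 2"
    by (intro P_diff coef f c)
  finally show ?thesis
    using X_independent x by fastforce
qed

lemma coef_add:
  assumes "f \<in> A" "g \<in> A" "x \<in> X" shows "coef (f + g) x = coef f x + coef g x"
proof (rule coef_eqI[where e = "\<epsilon> f + \<epsilon> g"])
  have "f + g - \<kappa> (\<epsilon> f + \<epsilon> g) - (\<Sum>x\<in>X. \<kappa> (coef f x + coef g x) * x) =
      (f - \<kappa> (\<epsilon> f) - (\<Sum>x\<in>X. \<kappa> (coef f x) * x)) + (g - \<kappa> (\<epsilon> g) - (\<Sum>x\<in>X. \<kappa> (coef g x) * x))"
    by (simp add: \<kappa>_add distrib_right sum.distrib)
  also have "\<dots> \<in> P 2"
    using assms by (intro P_add coef)
  finally show "f + g - \<kappa> (\<epsilon> f + \<epsilon> g) - (\<Sum>x\<in>X. \<kappa> (coef f x + coef g x) * x) \<in> P 2" .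
qed (use assms A_add in auto)

lemma coef_scale:
  assumes "f \<in> A" "x \<in> X" shows "coef (\<kappa> c * f) x = c * coef f x"
proof (rule coef_eqI[where e = "c * \<epsilon> f"])
  have "\<kappa> c * f - \<kappa> (c * \<epsilon> f) - (\<Sum>x\<in>X. \<kappa> (c * coef f x) * x) =
      \<kappa> c * (f - \<kappa> (\<epsilon> f) - (\<Sum>x\<in>X. \<kappa> (coef f x) * x))"
    by (simp add: \<kappa>_mult right_diff_distrib sum_distrib_left mult.assoc)
  also have "\<dots> \<in> P 2"
    using assms by (intro P_mult coef \<kappa>_in)
  finally show "\<kappa> c * f - \<kappa> (c * \<epsilon> f) - (\<Sum>x\<in>X. \<kappa> (c * coef f x) * x) \<in> P 2" .
qed (use assms in \<open>auto intro: A_mult \<kappa>_in\<close>)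

text \<open>The Leibniz rule at the base point: the product of
  \<open>f - \<kappa> (\<epsilon> f)\<close> and \<open>g - \<kappa> (\<epsilon> g)\<close> lies in
  \<open>P 2\<close> and drops out.\<close>

lemma coef_mult:
  assumes "f \<in> A" "g \<in> A" "x \<in> X" shows "coef (f * g) x = \<epsilon> f * coef g x + \<epsilon> g * coef f x"
proof (rule coef_eqI[where e = "\<epsilon> f * \<epsilon> g"])
  let ?s = "\<lambda>f. \<Sum>x\<in>X. \<kappa> (coef f x) * x"
  have sum: "(\<Sum>x\<in>X. \<kappa> (\<epsilon> f * coef g x + \<epsilon> g * coef f x) * x) = \<kappa> (\<epsilon> f) * ?s g + \<kappa> (\<epsilon> g) * ?s f"
    by (simp add: \<kappa>_add \<kappa>_mult distrib_right sum.distrib sum_distrib_left mult.assoc)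
  have "f * g - \<kappa> (\<epsilon> f * \<epsilon> g) - (\<Sum>x\<in>X. \<kappa> (\<epsilon> f * coef g x + \<epsilon> g * coef f x) * x) =
      (f - \<kappa> (\<epsilon> f)) * (g - \<kappa> (\<epsilon> g)) +
      (\<kappa> (\<epsilon> f) * (g - \<kappa> (\<epsilon> g) - ?s g) + \<kappa> (\<epsilon> g) * (f - \<kappa> (\<epsilon> f) - ?s f))"
    unfolding sum by (simp add: \<kappa>_mult algebra_simps)
  also have "\<dots> \<in> P 2"
    using assms by (intro P_add P_mult P_2 I_minus_\<epsilon> coef \<kappa>_in)
  finally show "f * g - \<kappa> (\<epsilon> f * \<epsilon> g) - (\<Sum>x\<in>X. \<kappa> (\<epsilon> f * coef g x + \<epsilon> g * coef f x) * x) \<in> P 2" .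
qed (use assms A_mult in auto)

lemma coef_X:
  assumes "x \<in> X" "y \<in> X" shows "coef y x = (if x = y then 1 else 0)"
proof (rule coef_eqI[where e = 0])
  have "(\<Sum>x\<in>X. \<kappa> (if x = y then 1 else 0) * x) = (\<Sum>x\<in>X. if x = y then x else 0)"
    by (intro sum.cong) (auto simp: \<kappa>_0 \<kappa>_1)
  also have "\<dots> = y"
    using assms finite_X by (simp add: sum.delta)
  finally show "y - \<kappa> 0 - (\<Sum>x\<in>X. \<kappa> (if x = y then 1 else 0) * x) \<in> P 2"
    by (simp add: \<kappa>_0 P_0)
qed (use assms X_A in auto)

text \<open>A derivation of the whole algebra whose value at the base point is the tangent vector
  dual to \<open>x\<close>; for a group it is an invariant vector field.\<close>

definition D :: "'a \<Rightarrow> 'a \<Rightarrow> 'a" where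
  "D x = (SOME D. (\<forall>f\<in>A. D f \<in> A \<and> \<epsilon> (D f) = coef f x) \<and>
      (\<forall>f\<in>A. \<forall>g\<in>A. D (f + g) = D f + D g \<and> D (f * g) = f * D g + g * D f))"

lemma D:
  assumes "x \<in> X"
  shows "(\<forall>f\<in>A. D x f \<in> A \<and> \<epsilon> (D x f) = coef f x) \<and>
      (\<forall>f\<in>A. \<forall>g\<in>A. D x (f + g) = D x f + D x g \<and> D x (f * g) = f * D x g + g * D x f)"
proof -
  have "\<exists>D. (\<forall>f\<in>A. D f \<in> A \<and> \<epsilon> (D f) = coef f x) \<and>
      (\<forall>f\<in>A. \<forall>g\<in>A. D (f + g) = D f + D g \<and> D (f * g) = f * D g + g * D f)"
    by (rule derivation_extends) (use assms coef_add coef_scale coef_mult in auto)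
  then show ?thesis
    unfolding D_def by (rule someI_ex)
qed

lemma D_A: "\<lbrakk>x \<in> X; f \<in> A\<rbrakk> \<Longrightarrow> D x f \<in> A"
  and \<epsilon>_D: "\<lbrakk>x \<in> X; f \<in> A\<rbrakk> \<Longrightarrow> \<epsilon> (D x f) = coef f x"
  and D_add: "\<lbrakk>x \<in> X; f \<in> A; g \<in> A\<rbrakk> \<Longrightarrow> D x (f + g) = D x f + D x g"
  and D_mult: "\<lbrakk>x \<in> X; f \<in> A; g \<in> A\<rbrakk> \<Longrightarrow> D x (f * g) = f * D x g + g * D x f"
  using D by auto

lemma D_0: "x \<in> X \<Longrightarrow> D x 0 = 0"
  using D_add[of x 0 0] by (simp add: A_0)

lemma D_1: "x \<in> X \<Longrightarrow> D x 1 = 0"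
  using D_mult[of x 1 1] by (simp add: A_1)

lemma D_power: "\<lbrakk>x \<in> X; f \<in> A\<rbrakk> \<Longrightarrow> D x (f ^ Suc n) = of_nat (Suc n) * f ^ n * D x f"
proof (induction n)
  case (Suc n)
  have "D x (f ^ Suc (Suc n)) = f * D x (f ^ Suc n) + f ^ Suc n * D x f"
    using D_mult[of x f "f ^ Suc n"] Suc.prems A_power[of f "Suc n"] by simp
  then show ?case
    using Suc by (simp add: algebra_simps)
qed simp

lemma D_power_p:
  assumes "x \<in> X" "f \<in> A" shows "D x (f ^ p) = 0"
  using D_power[OF assms, of "p - 1"] p_pos of_nat_p by simp

lemma D_P: "x \<in> X \<Longrightarrow> f \<in> P (Suc k) \<Longrightarrow> D x f \<in> P k"
proof (induction k arbitrary: f)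
  case 0
  then show ?case using D_A P_A by fastforce
next
  case (Suc k)
  have "f \<in> combos (P (Suc k)) I" using Suc.prems(2) by simp
  then have "f \<in> A \<and> D x f \<in> P (Suc k)"
  proof induction
    case combos_0
    then show ?case using Suc.prems(1) by (metis A_0 D_0 P_0)
  next
    case (combos_step c s t)
    then have A: "c \<in> A" "s \<in> A" "t \<in> A"
      using P_A I_A by blast+
    have "D x (c * s + t) = c * D x s + s * D x c + D x t"
      using A Suc.prems(1) by (simp add: D_add D_mult A_mult)
    moreover have "D x c * s \<in> P (k + 1)"
      using combos_step Suc.IH[OF Suc.prems(1), of c] P_1 by (intro P_mult_P) auto
    ultimately show ?case
      using A Suc.prems(1) combos_step
      by (auto intro!: A_intros P_add P_mult_right D_A simp: mult.commute[of s] simp del: P.simps)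
  qed
  then show ?case ..
qed

lemma of_nat_A: "of_nat n \<in> A"
  by (induction n) (auto intro: A_intros)

text \<open>At the base point \<open>D x\<close> sends the coordinates to the Kronecker delta, so
  \<open>D x y\<close> is known up to \<open>I\<close>. Hence \<open>D x\<close> acts on monomials
  as the partial derivative in \<open>x\<close> up to terms of one order higher.\<close>

lemma D_monomial:
  assumes "x \<in> X" "set_mset M \<subseteq> X"
  shows "D x (prod_mset M) - of_nat (count M x) * prod_mset (M - {#x#}) \<in> P (size M)"
  using assms(2)
proof (induction M)
  case empty
  then show ?case using assms(1) by (simp add: D_1 A_0)
next
  case (add y M)
  let ?m = "prod_mset M" and ?d = "if x = y then 1 else 0 :: 'a"
  have A: "y \<in> A" "?m \<in> A" and y: "y \<in> I" "y \<in> X"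
    using add.prems X_I X_A by (auto intro!: A_prod_mset)
  have "D x y - ?d \<in> I"
    using assms(1) A y by (auto simp: I_def \<epsilon>_diff \<epsilon>_D coef_X D_A A_intros)
  then have 1: "?m * (D x y - ?d) \<in> P (size M + 1)"
    using add.prems X_I by (intro P_mult_P P_prod_mset) (auto simp: P_1 simp del: P.simps)
  have 2: "(D x ?m - of_nat (count M x) * prod_mset (M - {#x#})) * y \<in> P (size M + 1)"
    using add y by (intro P_mult_P) (auto simp: P_1 simp del: P.simps)
  have 3: "of_nat (count (add_mset y M) x) * prod_mset (add_mset y M - {#x#}) =
      ?m * ?d + of_nat (count M x) * prod_mset (M - {#x#}) * y"
  proof (cases "x \<in># M")
    case True
    then obtain N where "M = add_mset x N" by (metis multi_member_split)
    then show ?thesis by (auto simp: algebra_simps)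
  next
    case False
    then have "count M x = 0" by (simp add: not_in_iff)
    then show ?thesis by auto
  qed
  have "D x (prod_mset (add_mset y M)) -
      of_nat (count (add_mset y M) x) * prod_mset (add_mset y M - {#x#}) =
      ?m * (D x y - ?d) + (D x ?m - of_nat (count M x) * prod_mset (M - {#x#})) * y"
    unfolding 3 using D_mult[OF assms(1) A] by (simp add: algebra_simps)
  also have "\<dots> \<in> P (size (add_mset y M))"
    using P_add[OF 1 2] by (simp only: size_add_mset Suc_eq_plus1)
  finally show ?case .
qed

text \<open>Compositions of the derivations \<open>D x\<close>. Derivations kill \<open>p\<close>-th
  powers, so these operators are linear over the subring of \<open>p\<close>-th powers; this is
  \<open>diffop_power_p\<close>.\<close>

inductive diffop :: "('a \<Rightarrow> 'a) \<Rightarrow> bool" where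
  diffop_id: "diffop (\<lambda>f. f)"
| diffop_D: "\<lbrakk>diffop \<delta>; x \<in> X\<rbrakk> \<Longrightarrow> diffop (\<lambda>f. \<delta> (D x f))"

lemma diffop:
  assumes "diffop \<delta>"
  shows diffop_A: "f \<in> A \<Longrightarrow> \<delta> f \<in> A"
    and diffop_0: "\<delta> 0 = 0"
    and diffop_add: "\<lbrakk>f \<in> A; g \<in> A\<rbrakk> \<Longrightarrow> \<delta> (f + g) = \<delta> f + \<delta> g"
    and diffop_power_p: "\<lbrakk>f \<in> A; b \<in> A\<rbrakk> \<Longrightarrow> \<delta> (b ^ p * f) = b ^ p * \<delta> f"
  using assms
  by (induction arbitrary: f g) (auto simp: D_A D_0 D_add D_mult D_power_p A_power)

lemma diffop_sum:
  "\<lbrakk>diffop \<delta>; \<And>i. i \<in> S \<Longrightarrow> f i \<in> A\<rbrakk> \<Longrightarrow> \<delta> (sum f S) = (\<Sum>i\<in>S. \<delta> (f i))"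
  by (induction S rule: infinite_finite_induct) (auto simp: diffop_0 diffop_add A_sum)

lemma diffop_diff: "\<lbrakk>diffop \<delta>; f \<in> A; g \<in> A\<rbrakk> \<Longrightarrow> \<delta> (f - g) = \<delta> f - \<delta> g"
  using diffop_add[of \<delta> "f - g" g] by (simp add: A_diff)

lemma diffop_of_nat: "\<lbrakk>diffop \<delta>; f \<in> A\<rbrakk> \<Longrightarrow> \<delta> (of_nat n * f) = of_nat n * \<delta> f"
  by (induction n) (auto simp: diffop_0 diffop_add distrib_right of_nat_A A_mult)

lemma \<epsilon>_of_nat: "\<epsilon> (of_nat n) = of_nat n"
  by (induction n) (auto simp: \<epsilon>_add A_1 of_nat_A)

text \<open>Differentiate \<open>count M x\<close> times in each direction \<open>x\<close>. To
  leading order this is the iterated partial derivative, which kills the other monomials of the same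
  degree and sends the monomial of \<open>M\<close> to the product of the factorials of its
  exponents. That product is nonzero as the exponents are below \<open>p\<close>.\<close>

lemma separating_diffop:
  "M \<in> small_msets X p \<Longrightarrow> \<exists>\<delta>. diffop \<delta> \<and> (\<forall>f\<in>P (Suc (size M)). \<epsilon> (\<delta> f) = 0) \<and>
    (\<forall>N. set_mset N \<subseteq> X \<longrightarrow> size N = size M \<longrightarrow> (\<epsilon> (\<delta> (prod_mset N)) = 0 \<longleftrightarrow> N \<noteq> M))"
proof (induction "size M" arbitrary: M)
  case 0
  then show ?case
    by (intro exI[of _ "\<lambda>f. f"]) (auto simp: P_1 I_\<epsilon> simp del: P.simps intro: diffop_id)
next
  case (Suc k)
  then obtain x M' where M: "M = add_mset x M'" "size M' = k"
    by (metis size_eq_Suc_imp_eq_union size_add_mset diff_Suc_1' Suc_inject)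
  have M': "M' \<in> small_msets X p" "x \<in> X"
    using Suc.prems by (fastforce simp: M small_msets_def dest: Suc_lessD split: if_splits)+
  obtain \<delta> where \<delta>: "diffop \<delta>" "\<And>f. f \<in> P (Suc k) \<Longrightarrow> \<epsilon> (\<delta> f) = 0"
    "\<And>N. \<lbrakk>set_mset N \<subseteq> X; size N = k\<rbrakk> \<Longrightarrow> \<epsilon> (\<delta> (prod_mset N)) = 0 \<longleftrightarrow> N \<noteq> M'"
    using Suc.hyps(1)[of M'] M' M(2) by auto
  have "\<epsilon> (\<delta> (D x (prod_mset N))) = 0 \<longleftrightarrow> N \<noteq> M" if N: "set_mset N \<subseteq> X" "size N = Suc k" for N
  proof -
    let ?g = "of_nat (count N x) * prod_mset (N - {#x#})"
    have A: "D x (prod_mset N) \<in> A" "prod_mset (N - {#x#}) \<in> A"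
      using N M' X_A by (auto intro!: D_A A_prod_mset dest: in_diffD)
    \<comment> \<open>The error in \<open>D_monomial\<close> has order \<open>Suc k\<close>, which
      the shorter operator \<open>\<delta>\<close> does not see at the base point.\<close>
    have "\<epsilon> (\<delta> (D x (prod_mset N) - ?g)) = 0"
      using D_monomial[OF M'(2) N(1)] N(2) by (intro \<delta>(2)) simp
    then have "\<epsilon> (\<delta> (D x (prod_mset N))) = of_nat (count N x) * \<epsilon> (\<delta> (prod_mset (N - {#x#})))"
      using A \<delta>(1) by (simp add: diffop_diff diffop_of_nat \<epsilon>_diff \<epsilon>_mult of_nat_A diffop_A A_mult \<epsilon>_of_nat)
    moreover have "of_nat (count N x) * \<epsilon> (\<delta> (prod_mset (N - {#x#}))) = 0 \<longleftrightarrow> N \<noteq> M"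
    proof (cases "x \<in># N")
      case True
      then have "size (N - {#x#}) = k" using N by (simp add: size_Diff_singleton)
      moreover have "set_mset (N - {#x#}) \<subseteq> X" using N by (auto dest: in_diffD)
      moreover have "N - {#x#} = M' \<longleftrightarrow> N = M"
        using True by (auto simp: M(1))
      moreover have "of_nat (count M x) \<noteq> (0::'k)"
        using Suc.prems by (intro of_nat_nonzero) (auto simp: M(1) small_msets_def dest: spec[of _ x])
      ultimately show ?thesis
        using \<delta>(3)[of "N - {#x#}"] by auto
    next
      case False
      then show ?thesis by (auto simp: M(1) not_in_iff)
    qed
    ultimately show ?thesis by simp
  qed
  then show ?case
    using \<delta> M' Suc.hyps(2)
    by (intro exI[of _ "\<lambda>f. \<delta> (D x f)"]) (auto simp del: P.simps intro: diffop_D D_P)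
qed

text \<open>Coefficients that are \<open>p\<close>-th powers pass through all differential
  operators. So one relation yields a linear system for them, with matrix entries
  \<open>\<delta> (prod_mset M)\<close>, whose columns are independent at the base point by
  \<open>separating_diffop\<close>. Then \<open>independent_near\<close> applies.\<close>

lemma monomials_independent_near:
  obtains w where "w \<in> A" "\<epsilon> w \<noteq> 0"
    "\<And>\<beta> M. \<lbrakk>\<And>M. \<beta> M \<in> A; (\<Sum>M\<in>small_msets X p. \<beta> M ^ p * prod_mset M) = 0;
        M \<in> small_msets X p\<rbrakk> \<Longrightarrow> w * \<beta> M = 0"
proof -
  let ?E = "small_msets X p" and ?R = "{\<lambda>M. \<delta> (prod_mset M) | \<delta>. diffop \<delta>}"
  have mon_A: "prod_mset M \<in> A" if "M \<in> ?E" for M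
    using that X_A by (intro A_prod_mset) (auto simp: small_msets_def)
  have "\<exists>w\<in>A. \<epsilon> w \<noteq> 0 \<and>
    (\<forall>\<beta>. (\<forall>r\<in>?R. (\<Sum>M\<in>?E. \<beta> M * r M) = 0) \<longrightarrow> (\<forall>M\<in>?E. w * \<beta> M = 0))"
  proof (rule independent_near)
    show "r M \<in> A" if "r \<in> ?R" "M \<in> ?E" for r M
      using that mon_A diffop_A by auto
  next
    fix c :: "'a multiset \<Rightarrow> 'k" and M
    assume c: "\<And>r. r \<in> ?R \<Longrightarrow> (\<Sum>M\<in>?E. c M * \<epsilon> (r M)) = 0" and "M \<in> ?E"
    then show "c M = 0"
    \<comment> \<open>In the row of the operator that separates \<open>M\<close>, coefficients of
      lower degree are zero by induction, and monomials of higher degree or of the same degree are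
      killed, except \<open>M\<close> itself.\<close>
    proof (induction "size M" arbitrary: M rule: less_induct)
      case less
      obtain \<delta> where \<delta>: "diffop \<delta>" "\<And>f. f \<in> P (Suc (size M)) \<Longrightarrow> \<epsilon> (\<delta> f) = 0"
        "\<And>N. \<lbrakk>set_mset N \<subseteq> X; size N = size M\<rbrakk> \<Longrightarrow> \<epsilon> (\<delta> (prod_mset N)) = 0 \<longleftrightarrow> N \<noteq> M"
        using separating_diffop[OF less.prems(2)] by blast
      have "c N * \<epsilon> (\<delta> (prod_mset N)) = 0" if N: "N \<in> ?E" "N \<noteq> M" for N
      proof (cases "size N" "size M" rule: linorder_cases)
        case less
        then show ?thesis using less.hyps N c by simp
      next
        case equal
        then show ?thesis using \<delta>(3) N by (auto simp: small_msets_def)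
      next
        case greater
        have "prod_mset N \<in> P (size N)"
          using N X_I by (intro P_prod_mset) (auto simp: small_msets_def)
        then show ?thesis
          using greater P_antimono[of "Suc (size M)" "size N"] \<delta>(2) by auto
      qed
      then have "(\<Sum>N\<in>?E - {M}. c N * \<epsilon> (\<delta> (prod_mset N))) = 0"
        by (intro sum.neutral) blast
      then have "(\<Sum>N\<in>?E. c N * \<epsilon> (\<delta> (prod_mset N))) = c M * \<epsilon> (\<delta> (prod_mset M))"
        by (simp add: sum.remove[OF finite_E less.prems(2)])
      then have "c M * \<epsilon> (\<delta> (prod_mset M)) = 0"
        using c[of "\<lambda>M. \<delta> (prod_mset M)"] \<delta>(1) by auto
      moreover have "\<epsilon> (\<delta> (prod_mset M)) \<noteq> 0"
        using \<delta>(3)[of M] less.prems by (auto simp: small_msets_def)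
      ultimately show ?case by simp
    qed
  qed (rule finite_E)
  then obtain w where w: "w \<in> A" "\<epsilon> w \<noteq> 0"
    "\<And>\<beta> M. \<lbrakk>\<forall>r\<in>?R. (\<Sum>M\<in>?E. \<beta> M * r M) = 0; M \<in> ?E\<rbrakk> \<Longrightarrow> w * \<beta> M = 0"
    by blast
  have "w * \<beta> M = 0"
    if \<beta>: "\<And>M. \<beta> M \<in> A" "(\<Sum>M\<in>?E. \<beta> M ^ p * prod_mset M) = 0" and M: "M \<in> ?E" for \<beta> M
  proof (rule reduced)
    have "(\<Sum>M\<in>?E. \<beta> M ^ p * \<delta> (prod_mset M)) = 0" if \<delta>: "diffop \<delta>" for \<delta>
    proof -
      have "\<delta> (\<Sum>M\<in>?E. \<beta> M ^ p * prod_mset M) = (\<Sum>M\<in>?E. \<delta> (\<beta> M ^ p * prod_mset M))"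
        by (rule diffop_sum[OF \<delta>]) (intro A_mult A_power \<beta>(1) mon_A)
      also have "\<dots> = (\<Sum>M\<in>?E. \<beta> M ^ p * \<delta> (prod_mset M))"
        by (intro sum.cong refl diffop_power_p[OF \<delta>] \<beta>(1) mon_A)
      finally show ?thesis using \<beta>(2) \<delta> by (simp add: diffop_0)
    qed
    then have "w * \<beta> M ^ p = 0"
      using w(3)[of "\<lambda>M. \<beta> M ^ p" M] M by auto
    \<comment> \<open>One factor \<open>w\<close> already kills \<open>\<beta> M ^ p\<close>; the
      other \<open>p - 1\<close> complete a \<open>p\<close>-th power, so that
      \<open>reduced\<close> applies.\<close>
    then have "w ^ (p - 1) * (w * \<beta> M ^ p) = 0" by simp
    moreover have "(w * \<beta> M) ^ p = w ^ (p - 1) * (w * \<beta> M ^ p)"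
      by (simp only: power_mult_distrib mult.assoc[symmetric] power_minus_mult[OF p_pos])
    ultimately show "(w * \<beta> M) ^ p = 0" by simp
  qed (use w \<beta>(1) A_mult in auto)
  then show ?thesis using that w by blast
qed

end

section \<open>Monomials modulo Frobenius powers\<close>

context augmented_char_p
begin

text \<open>The subring of \<open>p\<close>-th powers. It contains the constants because every
  scalar has a \<open>p\<close>-th root.\<close>

definition Bp :: "'a set" where
  "Bp = (\<lambda>f. f ^ p) ` A"

lemma Bp_A: "Bp \<subseteq> A"
  by (auto simp: Bp_def A_power)

lemma \<kappa>_Bp: "\<kappa> c \<in> Bp"
proof -
  obtain d where "d ^ p = c" using nth_root_exists[of p c] p_pos by blast
  then show ?thesis by (auto simp: Bp_def \<kappa>_power \<kappa>_in)
qed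

lemma Bp_add: "\<lbrakk>x \<in> Bp; y \<in> Bp\<rbrakk> \<Longrightarrow> x + y \<in> Bp"
  unfolding Bp_def by (auto simp flip: dream1 intro: A_add)

lemma Bp_mult: "\<lbrakk>x \<in> Bp; y \<in> Bp\<rbrakk> \<Longrightarrow> x * y \<in> Bp"
  unfolding Bp_def by (auto simp flip: power_mult_distrib intro: A_mult)

lemma prod_mset_reduce:
  "prod_mset M = prod_mset (mset_div n M) ^ n * prod_mset (mset_mod n M)"
  by (metis mset_mod_div mult.commute prod_mset_Un prod_mset_repeat)

text \<open>Any monomial in \<open>Y\<close> is a \<open>p\<close>-th power times a monomial with
  exponents reduced modulo \<open>p\<close>. So the combinations are closed under products and form
  a subalgebra that contains the generators.\<close>

lemma A_finite_over_Bp: "A \<subseteq> combos Bp (prod_mset ` small_msets Y p)"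
proof (rule generated)
  let ?E = "small_msets Y p"
  let ?N = "combos Bp (prod_mset ` ?E)"
  have monomial: "prod_mset M \<in> ?N" if "set_mset M \<subseteq> Y" for M
  proof -
    have "set_mset (mset_div p M) \<subseteq> set_mset M"
      by (intro subsetI) (metis count_eq_zero_iff count_mset_div div_0)
    then have "prod_mset (mset_div p M) ^ p \<in> Bp"
      using that Y_I I_subset unfolding Bp_def by (intro imageI A_prod_mset) auto
    then show ?thesis
      using mset_mod_small[OF that p_pos] by (subst prod_mset_reduce[of M p]) (intro combos_gen imageI)
  qed
  have E_A: "prod_mset ` ?E \<subseteq> A"
    using Y_I I_subset by (auto simp: small_msets_def intro!: A_prod_mset)
  show "?N \<subseteq> A"
    using A_combos[OF Bp_A E_A] .
  show "range \<kappa> \<subseteq> ?N"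
  proof clarify
    fix c
    have "\<kappa> c * prod_mset {#} \<in> ?N"
      using p_pos by (intro combos_gen imageI \<kappa>_Bp) (simp add: small_msets_def)
    then show "\<kappa> c \<in> ?N" by simp
  qed
  show "Y \<subseteq> ?N"
    using monomial[of "{#y#}" for y] by auto
  show "x + y \<in> ?N" if "x \<in> ?N" "y \<in> ?N" for x y
    using that by (rule combos_add)
  show "x * y \<in> ?N" if "x \<in> ?N" "y \<in> ?N" for x y
    using that
  proof (rule combos_mult2)
    fix c s c' s' assume *: "c \<in> Bp" "s \<in> prod_mset ` ?E" "c' \<in> Bp" "s' \<in> prod_mset ` ?E"
    then obtain M M' where M: "s = prod_mset M" "s' = prod_mset M'" "set_mset (M + M') \<subseteq> Y"
      by (auto simp: small_msets_def)
    have "(c * c') * prod_mset (M + M') \<in> ?N"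
      using monomial[OF M(3)]
    proof (rule combos_mult)
      fix d t assume "d \<in> Bp" "t \<in> prod_mset ` ?E"
      then show "c * c' * (d * t) \<in> ?N"
        unfolding mult.assoc[symmetric] using * by (intro combos_gen Bp_mult)
    qed
    then show "c * s * (c' * s') \<in> ?N"
      by (simp add: M ac_simps)
  qed
qed

end

section \<open>Expansions in monomials modulo powers of \<open>I\<close> and modulo
  \<open>Fr q\<close>\<close>

context smooth_point
begin

definition monomials :: "(nat \<Rightarrow> bool) \<Rightarrow> 'a set" where
  "monomials Q = prod_mset ` {M. set_mset M \<subseteq> X \<and> Q (size M)}"

text \<open>Leading forms: if \<open>s\<close> and \<open>t\<close> approximate \<open>x\<close> and
  \<open>y\<close> to one order more, then so does \<open>s * t\<close> for \<open>x * y\<close>,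
  since the error is \<open>(x - s) * t + x * (y - t)\<close>.\<close>

lemma P_monomials:
  "f \<in> P k \<Longrightarrow> \<exists>s\<in>combos (range \<kappa>) (monomials (\<lambda>d. d = k)). f - s \<in> P (Suc k)"
proof (induction k arbitrary: f)
  case 0
  have "\<kappa> (\<epsilon> f) * prod_mset {#} \<in> combos (range \<kappa>) (monomials (\<lambda>d. d = 0))"
    unfolding monomials_def by (intro combos_gen imageI) auto
  then show ?case
    using I_minus_\<epsilon>[of f] 0 P_1 by auto
next
  case (Suc k)
  let ?S = "combos (range \<kappa>) (monomials (\<lambda>d. d = Suc k))"
  have "combos (P k) I \<subseteq> {f. \<exists>s\<in>?S. f - s \<in> P (Suc (Suc k))}"
  proof (rule combos_subset)
    show "0 \<in> {f. \<exists>s\<in>?S. f - s \<in> P (Suc (Suc k))}"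
      using combos_0 P_0[of "Suc (Suc k)"] by force
  next
    fix f g assume "f \<in> {f. \<exists>s\<in>?S. f - s \<in> P (Suc (Suc k))}" "g \<in> {f. \<exists>s\<in>?S. f - s \<in> P (Suc (Suc k))}"
    then obtain s t where st: "s \<in> ?S" "f - s \<in> P (Suc (Suc k))" "t \<in> ?S" "g - t \<in> P (Suc (Suc k))"
      by blast
    have "(f - s) + (g - t) = (f + g) - (s + t)" by simp
    then have "(f + g) - (s + t) \<in> P (Suc (Suc k))"
      using P_add[OF st(2,4)] by (simp only:)
    then show "f + g \<in> {f. \<exists>s\<in>?S. f - s \<in> P (Suc (Suc k))}"
      using combos_add[OF st(1,3)] by blast
  next
    fix x y assume x: "x \<in> P k" and y: "y \<in> I"
    obtain s where s: "s \<in> combos (range \<kappa>) (monomials (\<lambda>d. d = k))" "x - s \<in> P (Suc k)"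
      using Suc.IH[OF x] by blast
    obtain c where c: "y - (\<Sum>z\<in>X. \<kappa> (c z) * z) \<in> P 2"
      using X_generates y by (auto simp: cotangent_generators_def)
    define t where "t = (\<Sum>z\<in>X. \<kappa> (c z) * z)"
    have t: "t \<in> combos (range \<kappa>) X" "t \<in> I"
      unfolding t_def using X_I by (auto intro!: combos_sum combos_gen I_sum I_mult \<kappa>_in)
    have "s * t \<in> ?S"
      using s(1) t(1)
    proof (rule combos_mult2)
      fix c s c' x
      assume *: "c \<in> range \<kappa>" "s \<in> monomials (\<lambda>d. d = k)" "c' \<in> range \<kappa>" "x \<in> X"
      then obtain M where "s = prod_mset M" "set_mset M \<subseteq> X" "size M = k"
        by (auto simp: monomials_def)
      then have "s * x \<in> monomials (\<lambda>d. d = Suc k)"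
        using * unfolding monomials_def by (intro image_eqI[of _ _ "add_mset x M"]) (auto simp: mult.commute)
      moreover have "c * c' \<in> range \<kappa>"
        using * by (auto simp flip: \<kappa>_mult)
      ultimately show "c * s * (c' * x) \<in> ?S"
        using combos_gen[of "c * c'" "range \<kappa>" "s * x"] by (simp add: ac_simps)
    qed
    moreover have "x * y - s * t \<in> P (Suc (Suc k))"
    proof -
      have "(x - s) * t \<in> P (Suc k + 1)"
        using s t P_1 by (intro P_mult_P) auto
      moreover have "x * (y - t) \<in> P (k + 2)"
        using x c unfolding t_def by (intro P_mult_P)
      ultimately have "(x - s) * t + x * (y - t) \<in> P (Suc (Suc k))"
        by (intro P_add) simp_all
      then show ?thesis by (simp add: algebra_simps)
    qed
    ultimately show "x * y \<in> {f. \<exists>s\<in>?S. f - s \<in> P (Suc (Suc k))}"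
      by blast
  qed
  then show ?case using Suc.prems by auto
qed

text \<open>Taylor polynomials exist in any system of cotangent generators; their uniqueness is what
  needs smoothness.\<close>

lemma A_monomials:
  "f \<in> A \<Longrightarrow> \<exists>s\<in>combos (range \<kappa>) (monomials (\<lambda>d. d < k)). f - s \<in> P k"
proof (induction k)
  case 0
  then show ?case by (intro bexI[of _ 0]) (auto intro: combos_0)
next
  case (Suc k)
  then obtain s where s: "s \<in> combos (range \<kappa>) (monomials (\<lambda>d. d < k))" "f - s \<in> P k"
    by blast
  obtain t where t: "t \<in> combos (range \<kappa>) (monomials (\<lambda>d. d = k))" "(f - s) - t \<in> P (Suc k)"
    using P_monomials[OF s(2)] by blast
  have "s + t \<in> combos (range \<kappa>) (monomials (\<lambda>d. d < Suc k))"
  proof (rule combos_add)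
    show "s \<in> combos (range \<kappa>) (monomials (\<lambda>d. d < Suc k))"
      by (rule subsetD[OF combos_mono s(1)]) (auto simp: monomials_def)
    show "t \<in> combos (range \<kappa>) (monomials (\<lambda>d. d < Suc k))"
      by (rule subsetD[OF combos_mono t(1)]) (auto simp: monomials_def)
  qed
  moreover have "f - (s + t) \<in> P (Suc k)"
    using t(2) by (simp add: diff_diff_eq)
  ultimately show ?case by blast
qed

text \<open>The lower bound on the degree is recorded because the final comparison separates
  monomials of degree below \<open>Q\<close> from those of degree at least \<open>Q\<close>.\<close>

definition small_monomials :: "nat \<Rightarrow> nat \<Rightarrow> 'a set" where
  "small_monomials q k = prod_mset ` {M \<in> small_msets X q. k \<le> size M}"

lemma monomials_mod_Fr:
  assumes "s \<in> combos (range \<kappa>) (monomials (\<lambda>d. d = k))"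
  shows "\<exists>t\<in>combos (range \<kappa>) (small_monomials q k). s - t \<in> Fr q"
  using assms
proof induction
  case combos_0
  show ?case by (intro bexI[of _ 0]) (auto intro: Fr_0 combos.combos_0)
next
  case (combos_step c m s)
  then obtain t where t: "t \<in> combos (range \<kappa>) (small_monomials q k)" "s - t \<in> Fr q"
    by blast
  obtain M where M: "m = prod_mset M" "set_mset M \<subseteq> X" "size M = k"
    using combos_step.hyps by (auto simp: monomials_def)
  show ?case
  proof (cases "M \<in> small_msets X q")
    case True
    then have "c * m + t \<in> combos (range \<kappa>) (small_monomials q k)"
      using combos_step.hyps(1) t(1) M by (intro combos.combos_step) (auto simp: small_monomials_def)
    then show ?thesis
      using t(2) by (intro bexI[of _ "c * m + t"]) auto
  next
    case False
    then obtain x where x: "q \<le> count M x"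
      using M by (auto simp: small_msets_def not_less)
    show ?thesis
    proof (cases "q = 0")
      \<comment> \<open>The degenerate exponent: \<open>f ^ 0 = 1\<close>, so \<open>Fr 0\<close> is
        all of \<open>A\<close>.\<close>
      case True
      have A: "c * m + (s - t) \<in> A"
        using combos_step.hyps(1) M X_A Fr_A[OF t(2)] by (auto intro!: A_intros)
      have "0 ^ q * (c * m + (s - t)) \<in> Fr q"
        using A by (intro Fr_gen I_0)
      then show ?thesis
        using t(1) True by (intro bexI[of _ t]) (auto simp: algebra_simps)
    next
      case False
      then have "x \<in> X" using x M(2) by (metis count_eq_zero_iff le_zero_eq subsetD)
      define N where "N = M - replicate_mset q x"
      have "M = replicate_mset q x + N"
        using x by (simp add: N_def count_le_replicate_mset_subset_eq)
      then have "m = x ^ q * prod_mset N"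
        by (simp add: M(1))
      moreover have "prod_mset N \<in> A"
        using M(2) X_A by (intro A_prod_mset) (auto simp: N_def dest: in_diffD)
      moreover have "c \<in> A"
        using combos_step.hyps(1) \<kappa>_in by auto
      ultimately have "c * m \<in> Fr q"
        using Fr_gen[of x "prod_mset N" q] \<open>x \<in> X\<close> X_I by (auto intro: Fr_mult)
      then have "c * m + (s - t) \<in> Fr q"
        using t(2) by (rule Fr_add)
      then show ?thesis
        using t(1) by (intro bexI[of _ t]) (auto simp: algebra_simps)
    qed
  qed
qed

text \<open>Leading forms are split off and reduced modulo \<open>Fr q\<close> until the remainder
  lies in a power of \<open>I\<close> contained in \<open>Fr q\<close>. Every monomial that occurs
  on the way has degree at least \<open>k\<close>.\<close>

lemma P_mod_Fr:
  assumes "f \<in> P k"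
  shows "\<exists>s\<in>combos (range \<kappa>) (small_monomials q k). f - s \<in> Fr q"
proof -
  obtain m where m: "P m \<subseteq> Fr q" using P_subset_Fr by blast
  show ?thesis
    using assms
  proof (induction "m - k" arbitrary: k f)
    case 0
    then have "f \<in> Fr q" using m P_antimono[of m k] by auto
    then show ?case by (intro bexI[of _ 0]) (auto intro: combos_0)
  next
    case (Suc n)
    obtain s where s: "s \<in> combos (range \<kappa>) (monomials (\<lambda>d. d = k))" "f - s \<in> P (Suc k)"
      using P_monomials[OF Suc.prems] by blast
    obtain t where t: "t \<in> combos (range \<kappa>) (small_monomials q k)" "s - t \<in> Fr q"
      using monomials_mod_Fr[OF s(1)] by blast
    obtain u where u: "u \<in> combos (range \<kappa>) (small_monomials q (Suc k))" "(f - s) - u \<in> Fr q"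
    proof -
      have "n = m - Suc k" using Suc.hyps(2) by simp
      then show ?thesis using Suc.hyps(1)[OF _ s(2)] that by blast
    qed
    have "combos (range \<kappa>) (small_monomials q (Suc k)) \<subseteq> combos (range \<kappa>) (small_monomials q k)"
      by (intro combos_mono) (auto simp: small_monomials_def)
    then have "t + u \<in> combos (range \<kappa>) (small_monomials q k)"
      using t(1) u(1) by (auto intro: combos_add)
    moreover have "f - (t + u) = (s - t) + ((f - s) - u)"
      by simp
    then have "f - (t + u) \<in> Fr q"
      using Fr_add[OF t(2) u(2)] by (simp only:)
    ultimately show ?case by blast
  qed
qed

section \<open>Monomials as a basis near the base point over the \<open>p\<close>-th powers\<close>

lemma small_monomials_0: "small_monomials q 0 = prod_mset ` small_msets X q"
  by (simp add: small_monomials_def)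

text \<open>By \<open>P_mod_Fr\<close> the monomials in \<open>X\<close> span modulo
  \<open>Fr p\<close>. As \<open>A\<close> is a finite module over the \<open>p\<close>-th powers,
  \<open>nakayama\<close> removes the error \<open>Fr p\<close> at the price of the factor
  \<open>h ^ p\<close>.\<close>

lemma monomials_span_near:
  obtains h where "h \<in> A" "\<epsilon> h \<noteq> 0"
    "\<And>f. f \<in> A \<Longrightarrow> \<exists>\<rho>. (\<forall>M. \<rho> M \<in> A) \<and> h ^ p * f = (\<Sum>M\<in>small_msets X p. \<rho> M ^ p * prod_mset M)"
proof -
  let ?S = "prod_mset ` small_msets Y p" and ?N = "combos Bp (prod_mset ` small_msets X p)"
  have S_A: "?S \<subseteq> A"
    using Y_I I_subset by (auto simp: small_msets_def intro!: A_prod_mset)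
  have N_A: "?N \<subseteq> A"
    using X_A by (intro A_combos Bp_A) (auto simp: small_msets_def intro!: A_prod_mset)
  have N_mult: "a ^ p * x \<in> ?N" if "a \<in> A" "x \<in> ?N" for a x
  proof (rule combos_mult[OF that(2)])
    fix c s assume "c \<in> Bp" "s \<in> prod_mset ` small_msets X p"
    moreover have "a ^ p \<in> Bp" using that(1) by (auto simp: Bp_def)
    ultimately show "a ^ p * (c * s) \<in> ?N"
      unfolding mult.assoc[symmetric] by (intro combos_gen Bp_mult)
  qed
  \<comment> \<open>Expanding the cofactors in \<open>A\<close> over \<open>Bp\<close> absorbs their
    coefficients into the \<open>p\<close>-th powers of \<open>I\<close>, which gives
    \<open>Fr p\<close> the shape that \<open>nakayama\<close> expects.\<close>
  have Fr: "Fr p \<subseteq> combos ((\<lambda>f. f ^ p) ` I) ?S"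
    unfolding Fr_def
  proof (rule combos_subset)
    fix c a assume c: "c \<in> (\<lambda>f. f ^ p) ` I" and a: "a \<in> A"
    have "a \<in> combos Bp ?S" using a A_finite_over_Bp by auto
    then show "c * a \<in> combos ((\<lambda>f. f ^ p) ` I) ?S"
    proof (rule combos_mult)
      fix b s assume b: "b \<in> Bp" and s: "s \<in> ?S"
      have "c * b \<in> (\<lambda>f. f ^ p) ` I"
        using b c by (auto simp: Bp_def power_mult_distrib[symmetric] intro: I_mult_right)
      then show "c * (b * s) \<in> combos ((\<lambda>f. f ^ p) ` I) ?S"
        unfolding mult.assoc[symmetric] using s by (intro combos_gen)
    qed
  qed (auto intro: combos_0 combos_add)
  have "\<exists>h\<in>A. \<epsilon> h \<noteq> 0 \<and> (\<forall>s\<in>?S. h ^ p * s \<in> ?N)"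
  proof (rule nakayama[OF _ S_A N_A combos_0 combos_add N_mult])
    show "finite ?S" using finite_small_msets[OF finite_Y] by simp
    fix s assume "s \<in> ?S"
    then have "s \<in> P 0" using S_A by auto
    then obtain t where t: "t \<in> combos (range \<kappa>) (prod_mset ` small_msets X p)" "s - t \<in> Fr p"
      using P_mod_Fr[of s 0 p] by (auto simp: small_monomials_0)
    have "t \<in> ?N"
      using t(1) combos_mono[of "range \<kappa>" Bp] \<kappa>_Bp by blast
    then show "\<exists>u\<in>A. \<exists>n\<in>?N. \<exists>t\<in>combos ((\<lambda>f. f ^ p) ` I) ?S. \<epsilon> u \<noteq> 0 \<and> u ^ p * s = n + t"
      using t(2) Fr by (intro bexI[of _ 1] bexI[of _ t] bexI[of _ "s - t"]) (auto intro: A_1)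
  qed
  then obtain h where h: "h \<in> A" "\<epsilon> h \<noteq> 0" "\<And>s. s \<in> ?S \<Longrightarrow> h ^ p * s \<in> ?N" by blast
  show ?thesis
  proof (rule that[OF h(1,2)])
    fix f assume "f \<in> A"
    then have "f \<in> combos Bp ?S" using A_finite_over_Bp by auto
    then have "h ^ p * f \<in> ?N"
    proof (rule combos_mult)
      fix b s assume "b \<in> Bp" "s \<in> ?S"
      then show "h ^ p * (b * s) \<in> ?N"
        using N_mult[OF _ h(3)] by (auto simp: Bp_def mult.left_commute)
    qed
    then obtain b where b: "\<And>M. b M \<in> Bp" "h ^ p * f = (\<Sum>M\<in>small_msets X p. b M * prod_mset M)"
    proof (rule combos_image[OF _ finite_E])
      show "0 \<in> Bp" using \<kappa>_Bp[of 0] by (simp add: \<kappa>_0)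
    qed (use Bp_add in auto)
    have "\<forall>M. \<exists>a\<in>A. b M = a ^ p" using b(1) by (auto simp: Bp_def)
    then obtain \<rho> where "\<forall>M. \<rho> M \<in> A \<and> b M = \<rho> M ^ p" by metis
    then show "\<exists>\<rho>. (\<forall>M. \<rho> M \<in> A) \<and> h ^ p * f = (\<Sum>M\<in>small_msets X p. \<rho> M ^ p * prod_mset M)"
      using b(2) by (intro exI[of _ \<rho>]) auto
  qed
qed

text \<open>
  Over the \<open>p\<close>-th powers, monomials with exponents below \<open>p\<close> form a basis near the base point, so
  \<open>p\<close>-th roots of a relation between monomials can be taken coefficientwise.
\<close>

lemma monomials_independent_mod_Fr:
  assumes "u \<in> A" "\<epsilon> u \<noteq> 0" "u * (\<Sum>M\<in>small_msets X (p ^ e). \<kappa> (c M) * prod_mset M) \<in> Fr (p ^ e)"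
    and "M \<in> small_msets X (p ^ e)"
  shows "c M = 0"
  using assms
proof (induction e arbitrary: u c M)
  case 0
  have E: "small_msets X 1 = {{#}}"
    by (auto simp: small_msets_iff multiset_eq_iff)
  have "u * \<kappa> (c {#}) \<in> I"
    using 0 E Fr_1 by auto
  then have "\<epsilon> u * c {#} = 0"
    using 0 I_\<epsilon>[of "u * \<kappa> (c {#})"] by (simp add: \<epsilon>_mult \<epsilon>_\<kappa> \<kappa>_in)
  then show ?case using 0 E by auto
next
  case (Suc e)
  let ?E = "small_msets X p" and ?q = "p ^ e"
  let ?F = "small_msets X ?q"
  obtain h where h: "h \<in> A" "\<epsilon> h \<noteq> 0"
    "\<And>f. f \<in> A \<Longrightarrow> \<exists>\<rho>. (\<forall>M. \<rho> M \<in> A) \<and> h ^ p * f = (\<Sum>M\<in>?E. \<rho> M ^ p * prod_mset M)"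
    using monomials_span_near by blast
  obtain w where w: "w \<in> A" "\<epsilon> w \<noteq> 0"
    "\<And>\<beta> M. \<lbrakk>\<And>M. \<beta> M \<in> A; (\<Sum>M\<in>?E. \<beta> M ^ p * prod_mset M) = 0; M \<in> ?E\<rbrakk> \<Longrightarrow> w * \<beta> M = 0"
    using monomials_independent_near by blast
  \<comment> \<open>The ideals match the extraction of roots: an element of
    \<open>Fr (p ^ Suc e)\<close> has, after multiplication by \<open>h ^ p\<close>, coordinates
    that are \<open>p\<close>-th powers of elements of \<open>Fr (p ^ e)\<close>.\<close>
  have Fr: "\<exists>\<rho>. (\<forall>M. \<rho> M \<in> Fr ?q) \<and> h ^ p * t = (\<Sum>M\<in>?E. \<rho> M ^ p * prod_mset M)"
    if "t \<in> Fr (p ^ Suc e)" for t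
    using that unfolding Fr_def
  proof induction
    case combos_0
    then show ?case
      using p_pos by (intro exI[of _ "\<lambda>_. 0"]) (auto intro: combos.combos_0 simp: zero_power)
  next
    case (combos_step g a t)
    then obtain f where f: "f \<in> I" "g = f ^ (p ^ Suc e)" by blast
    obtain \<rho> where \<rho>: "\<And>M. \<rho> M \<in> Fr ?q" "h ^ p * t = (\<Sum>M\<in>?E. \<rho> M ^ p * prod_mset M)"
      using combos_step.IH unfolding Fr_def by blast
    obtain b where b: "\<And>M. b M \<in> A" "h ^ p * a = (\<Sum>M\<in>?E. b M ^ p * prod_mset M)"
      using h(3)[OF combos_step.hyps(2)] by blast
    have g: "g = (f ^ ?q) ^ p"
      by (simp add: f(2) power_mult[symmetric] mult.commute)
    have "h ^ p * (g * a + t) = g * (h ^ p * a) + h ^ p * t"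
      by (simp add: algebra_simps)
    also have "\<dots> = (\<Sum>M\<in>?E. (f ^ ?q * b M + \<rho> M) ^ p * prod_mset M)"
      unfolding b(2) \<rho>(2) g
      by (simp add: dream1 power_mult_distrib distrib_right sum.distrib sum_distrib_left mult.assoc)
    finally show ?case
      using \<rho>(1) b(1) f(1) unfolding Fr_def[symmetric]
      by (intro exI[of _ "\<lambda>M. f ^ ?q * b M + \<rho> M"]) (auto intro: Fr_add Fr_gen)
  qed
  have "\<forall>M. \<exists>d. d ^ p = c M" using nth_root_exists[OF p_pos] by blast
  then obtain \<gamma> where \<gamma>: "\<And>M. \<gamma> M ^ p = c M" by metis
  \<comment> \<open>\<open>g M\<close> is the \<open>p\<close>-th root of the part of the sum whose
    exponents are congruent to \<open>M\<close> modulo \<open>p\<close>, divided by the monomial of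
    \<open>M\<close>.\<close>
  define g where "g M = (\<Sum>N\<in>?F. \<kappa> (\<gamma> (M + repeat_mset p N)) * prod_mset N)" for M
  have F_A: "prod_mset N \<in> A" if "N \<in> small_msets X n" for N n
    using that X_A by (intro A_prod_mset) (auto simp: small_msets_def)
  have g_A: "g M \<in> A" for M
    unfolding g_def by (intro A_sum A_mult F_A \<kappa>_in)
  have "(\<Sum>M\<in>small_msets X (p ^ Suc e). \<kappa> (c M) * prod_mset M) =
      (\<Sum>(M, N)\<in>?E \<times> ?F. \<kappa> (c (M + repeat_mset p N)) * prod_mset (M + repeat_mset p N))"
    using sum.reindex_bij_betw[OF small_msets_split[OF p_pos, of X ?q],
        of "\<lambda>M. \<kappa> (c M) * prod_mset M"]
    by (simp add: case_prod_unfold)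
  also have "\<dots> = (\<Sum>M\<in>?E. \<Sum>N\<in>?F. prod_mset M * (\<kappa> (\<gamma> (M + repeat_mset p N)) * prod_mset N) ^ p)"
    unfolding sum.cartesian_product \<gamma>[symmetric]
    by (intro sum.cong refl)
      (auto simp: \<kappa>_power power_mult_distrib prod_mset_Un prod_mset_repeat ac_simps)
  also have "\<dots> = (\<Sum>M\<in>?E. g M ^ p * prod_mset M)"
    by (simp add: g_def dream1 sum_distrib_left mult.commute)
  finally have expand: "(\<Sum>M\<in>small_msets X (p ^ Suc e). \<kappa> (c M) * prod_mset M) =
      (\<Sum>M\<in>?E. g M ^ p * prod_mset M)" .
  \<comment> \<open>The factor \<open>u\<close> is completed to \<open>u ^ p\<close>, so that it can
    join the coefficients before the root is taken.\<close>
  have "u ^ (p - 1) * (u * (\<Sum>M\<in>?E. g M ^ p * prod_mset M)) \<in> Fr (p ^ Suc e)"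
    using Suc.prems(3) unfolding expand by (rule Fr_mult[OF A_power[OF Suc.prems(1)]])
  then obtain \<rho> where \<rho>: "\<And>M. \<rho> M \<in> Fr ?q"
    "h ^ p * (u ^ (p - 1) * (u * (\<Sum>M\<in>?E. g M ^ p * prod_mset M))) = (\<Sum>M\<in>?E. \<rho> M ^ p * prod_mset M)"
    using Fr by blast
  have "u ^ (p - 1) * (u * x) = u ^ p * x" for x
    by (simp only: mult.assoc[symmetric] power_minus_mult[OF p_pos])
  then have "(\<Sum>M\<in>?E. (h * u * g M) ^ p * prod_mset M) = (\<Sum>M\<in>?E. \<rho> M ^ p * prod_mset M)"
    using \<rho>(2) by (simp add: power_mult_distrib sum_distrib_left mult.assoc)
  then have "(\<Sum>M\<in>?E. (h * u * g M - \<rho> M) ^ p * prod_mset M) = 0"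
    by (simp add: dream1 left_diff_distrib sum_subtractf)
  then have zero: "w * (h * u * g M - \<rho> M) = 0" if "M \<in> ?E" for M
    using that h(1) Suc.prems(1) g_A \<rho>(1) Fr_A
    by (intro w(3)[of "\<lambda>M. h * u * g M - \<rho> M" M]) (auto intro!: A_diff A_mult)
  have "M \<in> (\<lambda>(M, N). M + repeat_mset p N) ` (?E \<times> ?F)"
    using small_msets_split[OF p_pos, of X ?q] Suc.prems(4) by (simp add: bij_betw_def)
  then obtain K N where KN: "K \<in> ?E" "N \<in> ?F" "M = K + repeat_mset p N" by auto
  \<comment> \<open>The coordinate belonging to \<open>K\<close> is a relation one level lower, with
    \<open>w * h * u\<close> in place of \<open>u\<close>; this is why the statement allows a factor
    that is nonzero at the base point.\<close>
  have "\<gamma> (K + repeat_mset p N) = 0"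
  proof (rule Suc.IH[where u = "w * h * u" and c = "\<lambda>N. \<gamma> (K + repeat_mset p N)"])
    show "w * h * u \<in> A" "\<epsilon> (w * h * u) \<noteq> 0"
      using w h Suc.prems by (auto simp: \<epsilon>_mult A_mult)
    have "w * h * u * g K = w * \<rho> K"
      using zero[OF KN(1)] by (simp add: right_diff_distrib mult.assoc)
    then show "w * h * u * (\<Sum>N\<in>?F. \<kappa> (\<gamma> (K + repeat_mset p N)) * prod_mset N) \<in> Fr ?q"
      using Fr_mult[OF w(1) \<rho>(1)] by (simp add: g_def)
  qed (rule KN)
  then show ?case
    using \<gamma>[of M] p_pos KN(3) by (simp add: zero_power)
qed

end

context augmented_char_p
begin

text \<open>
  Smoothness at the base point enters here: in suitable coordinates a function with nonzero Taylor
  polynomial of degree below \<open>p\<^sup>t\<close> has image with nonzero Taylor polynomial of degree below \<open>p\<^sup>t\<^sup>+\<^sup>s\<close>.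
\<close>

lemma frobenius_reflects_order:
  assumes add: "\<And>f g. \<lbrakk>f \<in> A; g \<in> A\<rbrakk> \<Longrightarrow> \<phi> (f + g) = \<phi> f + \<phi> g"
    and mult: "\<And>f g. \<lbrakk>f \<in> A; g \<in> A\<rbrakk> \<Longrightarrow> \<phi> (f * g) = \<phi> f * \<phi> g"
    and const: "\<And>c. \<phi> (\<kappa> c) = \<kappa> c"
    and P: "\<And>f k. f \<in> P k \<Longrightarrow> \<phi> f \<in> P (k * p ^ s)"
    and Y: "\<And>y. y \<in> Y \<Longrightarrow> \<phi> y = y ^ (p ^ s)"
    and f: "f \<in> A" "\<phi> f \<in> P (p ^ (t + s))"
  shows "f \<in> P (p ^ t)"
proof -
  obtain X where X: "X \<subseteq> Y" "cotangent_generators X"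
    "\<And>c x. \<lbrakk>(\<Sum>x\<in>X. \<kappa> (c x) * x) \<in> P 2; x \<in> X\<rbrakk> \<Longrightarrow> c x = 0"
    using cotangent_basis_exists by blast
  interpret smooth_point A \<kappa> \<epsilon> p Y X
    by unfold_locales (use X in auto)
  let ?q = "p ^ s" and ?m = "p ^ t" and ?Q = "p ^ (t + s)"
  have Q: "?Q = ?m * ?q" by (simp add: power_add)
  \<comment> \<open>The exponents of Taylor polynomials of order \<open>m\<close>. A total degree
    below \<open>m\<close> bounds every single exponent, so \<open>F\<close> lies in the finite set
    of small exponents.\<close>
  define F where "F = {M. set_mset M \<subseteq> X \<and> size M < ?m}"
  have F_E: "F \<subseteq> small_msets X ?m"
    unfolding F_def small_msets_def by (auto intro: le_less_trans[OF count_le_size])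
  then have fin: "finite F" using finite_E finite_subset by blast
  have F_A: "prod_mset M \<in> A" if "M \<in> F" for M
    using that X_A by (intro A_prod_mset) (auto simp: F_def)
  have \<phi>_0: "\<phi> 0 = 0" using const[of 0] by (simp add: \<kappa>_0)
  have \<phi>_prod: "\<phi> (prod_mset M) = prod_mset (repeat_mset ?q M)" if "set_mset M \<subseteq> X" for M
    using that
  proof (induction M)
    case empty
    then show ?case using const[of 1] by (simp add: \<kappa>_1)
  next
    case (add x M)
    have "x \<in> A" "prod_mset M \<in> A" using add.prems X_A by (auto intro!: A_prod_mset)
    then show ?case
      using add X_Y Y by (auto simp: mult prod_mset_repeat power_mult_distrib)
  qed
  have \<phi>_sum: "\<phi> (\<Sum>M\<in>E. \<kappa> (c M) * prod_mset M) = (\<Sum>M\<in>E. \<kappa> (c M) * prod_mset (repeat_mset ?q M))"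
    if "finite E" "E \<subseteq> F" for E c
    using that
  proof (induction E rule: finite_induct)
    case (insert M E)
    have "(\<Sum>M\<in>E. \<kappa> (c M) * prod_mset M) \<in> A"
      using insert.prems F_A by (intro A_sum A_mult \<kappa>_in) auto
    moreover have "\<kappa> (c M) * prod_mset M \<in> A"
      using insert.prems F_A by (intro A_mult \<kappa>_in) auto
    moreover have "\<phi> (\<kappa> (c M) * prod_mset M) = \<kappa> (c M) * prod_mset (repeat_mset ?q M)"
      using insert.prems F_A const by (subst mult) (auto simp: \<kappa>_in \<phi>_prod F_def)
    ultimately show ?case
      using insert add by simp
  qed (simp add: \<phi>_0)
  have inj: "repeat_mset ?q M = repeat_mset ?q N \<longleftrightarrow> M = N" for M N :: "'a multiset"
    using p_pow_pos[of s] by (auto simp: multiset_eq_iff)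
  have zero_\<kappa>: "0 \<in> range \<kappa>" using \<kappa>_0 by (metis rangeI)
  obtain r where r: "r \<in> combos (range \<kappa>) (prod_mset ` F)" "f - r \<in> P ?m"
    using A_monomials[OF f(1), of ?m] by (auto simp: monomials_def F_def)
  obtain c where c: "r = (\<Sum>M\<in>F. \<kappa> (c M) * prod_mset M)"
  proof (rule combos_image[OF r(1) fin])
    fix b assume b: "\<And>i. b i \<in> range \<kappa>" "r = (\<Sum>M\<in>F. b M * prod_mset M)"
    have "\<forall>i. \<exists>a. b i = \<kappa> a" using b(1) by blast
    then obtain a where "\<forall>i. b i = \<kappa> (a i)" by metis
    then show thesis using b(2) that by simp
  qed (auto simp flip: \<kappa>_add intro: zero_\<kappa>)
  have r_A: "r \<in> A"
    unfolding c by (intro A_sum A_mult \<kappa>_in F_A)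
  have "\<phi> f = \<phi> (f - r) + \<phi> r"
    using add[of "f - r" r] f(1) r_A by (simp add: A_diff)
  moreover have "\<phi> (f - r) \<in> P ?Q"
    unfolding Q by (intro P r(2))
  ultimately have "\<phi> r \<in> P ?Q"
    using P_diff[OF f(2), of "\<phi> (f - r)"] by simp
  \<comment> \<open>The Frobenius image of the Taylor polynomial \<open>r\<close> is compared with
    an expansion of itself whose monomials have degree at least \<open>Q\<close>; both have
    exponents below \<open>Q\<close>.\<close>
  then obtain r' where r': "r' \<in> combos (range \<kappa>) (small_monomials ?Q ?Q)" "\<phi> r - r' \<in> Fr ?Q"
    using P_mod_Fr by blast
  let ?G = "{M \<in> small_msets X ?Q. ?Q \<le> size M}"
  obtain c' where c': "r' = (\<Sum>M\<in>?G. \<kappa> (c' M) * prod_mset M)"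
  proof (rule combos_image[OF r'(1)[unfolded small_monomials_def]])
    show "finite ?G" using finite_E by simp
    fix b assume b: "\<And>i. b i \<in> range \<kappa>" "r' = (\<Sum>M\<in>?G. b M * prod_mset M)"
    have "\<forall>i. \<exists>a. b i = \<kappa> a" using b(1) by blast
    then obtain a where "\<forall>i. b i = \<kappa> (a i)" by metis
    then show thesis using b(2) that by simp
  qed (auto simp flip: \<kappa>_add intro: zero_\<kappa>)
  \<comment> \<open>The coefficient of the monomial of \<open>N\<close> in
    \<open>\<phi> r - r'\<close>. The first sum has at most one nonzero term, as \<open>N\<close>
    determines \<open>M\<close>.\<close>
  define d where "d N = (\<Sum>M\<in>F. if N = repeat_mset ?q M then c M else 0) -
      (if ?Q \<le> size N then c' N else 0)" for N
  have \<kappa>_sum: "\<kappa> (sum g S) = (\<Sum>i\<in>S. \<kappa> (g i))" for g :: "'a multiset \<Rightarrow> 'k" and S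
    by (induction S rule: infinite_finite_induct) (auto simp: \<kappa>_0 \<kappa>_add)
  have repeat_E: "repeat_mset ?q M \<in> small_msets X ?Q" if "M \<in> F" for M
    using that F_E p_pow_pos[of s] unfolding Q by (auto simp: small_msets_iff subset_iff mult.commute)
  have "(\<Sum>N\<in>small_msets X ?Q. \<kappa> (d N) * prod_mset N) =
      (\<Sum>N\<in>small_msets X ?Q. \<Sum>M\<in>F. if N = repeat_mset ?q M then \<kappa> (c M) * prod_mset N else 0) -
      (\<Sum>N\<in>small_msets X ?Q. if ?Q \<le> size N then \<kappa> (c' N) * prod_mset N else 0)"
    unfolding sum_subtractf[symmetric] d_def \<kappa>_diff \<kappa>_sum left_diff_distrib sum_distrib_right
    by (intro sum.cong arg_cong2[where f = minus] refl) (auto simp: \<kappa>_0)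
  also have "(\<Sum>N\<in>small_msets X ?Q. \<Sum>M\<in>F. if N = repeat_mset ?q M then \<kappa> (c M) * prod_mset N else 0) =
      (\<Sum>M\<in>F. \<Sum>N\<in>small_msets X ?Q. if N = repeat_mset ?q M then \<kappa> (c M) * prod_mset N else 0)"
    by (rule sum.swap)
  also have "\<dots> = (\<Sum>M\<in>F. \<kappa> (c M) * prod_mset (repeat_mset ?q M))"
    using finite_E repeat_E by (intro sum.cong refl) (simp add: sum.delta)
  also have "\<dots> = \<phi> r"
    unfolding c by (rule \<phi>_sum[symmetric, OF fin order_refl])
  also have "(\<Sum>N\<in>small_msets X ?Q. if ?Q \<le> size N then \<kappa> (c' N) * prod_mset N else 0) = r'"
    unfolding c' using finite_E by (intro sum.inter_filter[symmetric])
  finally have "1 * (\<Sum>N\<in>small_msets X ?Q. \<kappa> (d N) * prod_mset N) \<in> Fr ?Q"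
    using r'(2) by simp
  then have d: "d N = 0" if "N \<in> small_msets X ?Q" for N
    using that by (intro monomials_independent_mod_Fr[of 1]) (auto intro: A_1)
  have "c M = 0" if M: "M \<in> F" for M
  proof -
    \<comment> \<open>The degree is multiplied by \<open>q\<close>, so it stays below
      \<open>m * q = Q\<close> and \<open>r'\<close> contributes nothing to this
      coefficient.\<close>
    have "size (repeat_mset ?q M) < ?Q"
      using M p_pow_pos[of s] by (auto simp: Q F_def mult.commute)
    then have "d (repeat_mset ?q M) = c M"
      using M fin by (simp add: d_def inj sum.delta')
    then show ?thesis using d repeat_E M by simp
  qed
  then have "r = 0" by (simp add: c \<kappa>_0)
  then show ?thesis using r(2) by simp
qed

end

section \<open>The geometric Frobenius map of the coordinate algebra\<close>

definition scl :: "'k::field \<Rightarrow> ('x \<Rightarrow> 'k) \<Rightarrow> 'x \<Rightarrow> 'k" where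
  "scl c f = (\<lambda>x. c * f x)"

lemma scl_apply [simp]: "scl c f x = c * f x"
  by (simp add: scl_def)

lemma power_fun_apply [simp]: "(f ^ n) x = (f x :: 'k::comm_ring_1) ^ n"
  by (induction n) auto

lemma sum_fun_apply [simp]: "(sum f S) x = (\<Sum>i\<in>S. f i x :: 'k::comm_monoid_add)"
  by (induction S rule: infinite_finite_induct) auto

interpretation fun_vs: vector_space "scl :: 'k::field \<Rightarrow> ('x \<Rightarrow> 'k) \<Rightarrow> _"
  by unfold_locales (auto simp: fun_eq_iff algebra_simps)

interpretation fun_fun: vector_space_pair "scl :: 'k::field \<Rightarrow> ('x \<Rightarrow> 'k) \<Rightarrow> _" "scl :: 'k \<Rightarrow> ('x \<Rightarrow> 'k) \<Rightarrow> _"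
  ..

interpretation field_vs: vector_space "(*) :: 'k::field \<Rightarrow> 'k \<Rightarrow> 'k"
  by unfold_locales (auto simp: algebra_simps)

declare field_vs.scale_scale [simp del] \<comment> \<open>loops with associativity of multiplication\<close>

interpretation fun_field: vector_space_pair "scl :: 'k::field \<Rightarrow> ('x \<Rightarrow> 'k) \<Rightarrow> _" "(*) :: 'k \<Rightarrow> 'k \<Rightarrow> 'k"
  ..

lemma linear_on_iff:
  "linear_on S \<mu> \<longleftrightarrow> (\<forall>f\<in>S. \<forall>g\<in>S. \<mu> (f + g) = \<mu> f + \<mu> g) \<and> (\<forall>f\<in>S. \<forall>c. \<mu> (scl c f) = c * \<mu> f)"
  by (simp add: linear_on_def plus_fun_def scl_def)

lemma CHAR_fun: "CHAR('x \<Rightarrow> 'k::comm_ring_1) = CHAR('k)"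
proof (rule CHAR_eqI)
  show "of_nat CHAR('k) = (0 :: 'x \<Rightarrow> 'k)"
    by (simp add: fun_eq_iff)
next
  fix n assume "of_nat n = (0 :: 'x \<Rightarrow> 'k)"
  then have "of_nat n = (0 :: 'k)"
    by (metis of_nat_fun_apply zero_fun_apply)
  then show "CHAR('k) dvd n"
    by (simp add: of_nat_eq_0_iff_char_dvd)
qed

text \<open>Fermat's theorem: the power map is additive and fixes 1, hence fixes natural numbers,
  and differences follow by cancellation.\<close>

lemma prime_subfield_power:
  assumes "prime CHAR('k::comm_ring_1)" "m \<in> prime_subfield"
  shows "(m::'k) ^ (CHAR('k) ^ s) = m"
proof -
  have dream: "(x + y) ^ (CHAR('k) ^ s) = x ^ (CHAR('k) ^ s) + y ^ (CHAR('k) ^ s)" for x y :: 'k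
    using freshmans_dream'[OF assms(1) refl] .
  have pos: "CHAR('k) > 0" using assms(1) prime_gt_0_nat by blast
  have nat: "(of_nat n :: 'k) ^ (CHAR('k) ^ s) = of_nat n" for n
    by (induction n) (use pos in \<open>simp_all add: dream zero_power\<close>)
  obtain z where z: "m = of_int z" using assms(2) by (auto simp: prime_subfield_def)
  obtain a b where "z = int a - int b"
    using int_diff_cases by metis
  then have m: "m + of_nat b = of_nat a" by (simp add: z)
  then have "m ^ (CHAR('k) ^ s) + of_nat b = of_nat a"
    using dream[of m "of_nat b"] by (simp add: nat)
  then show ?thesis using m by (metis add_right_cancel)
qed

lemma function_ring: "cring (function_ring X :: ('g \<Rightarrow> 'k::field) ring)"
proof (rule cringI)
  show "abelian_group (function_ring X :: ('g \<Rightarrow> 'k) ring)"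
  proof (rule abelian_groupI)
    fix f :: "'g \<Rightarrow> 'k" assume "f \<in> carrier (function_ring X)"
    then show "\<exists>g\<in>carrier (function_ring X). g \<oplus>\<^bsub>function_ring X\<^esub> f = \<zero>\<^bsub>function_ring X\<^esub>"
      by (intro bexI[of _ "- f"]) (simp_all add: function_ring_def)
  qed (simp_all add: function_ring_def fun_eq_iff ac_simps)
  show "Group.comm_monoid (function_ring X :: ('g \<Rightarrow> 'k) ring)"
    by (rule comm_monoidI) (auto simp: function_ring_def ext0_def fun_eq_iff)
qed (auto simp: function_ring_def fun_eq_iff algebra_simps)

lemma function_ring_uminus:
  assumes "f \<in> carrier (function_ring X)"
  shows "\<ominus>\<^bsub>function_ring X\<^esub> f = (- f :: 'g \<Rightarrow> 'k::field)"
proof -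
  interpret cring "function_ring X :: ('g \<Rightarrow> 'k) ring" by (rule function_ring)
  have "- f \<in> carrier (function_ring X)" "- f \<oplus>\<^bsub>function_ring X\<^esub> f = \<zero>\<^bsub>function_ring X\<^esub>"
    using assms by (auto simp: function_ring_def)
  then show ?thesis
    using assms minus_equality by blast
qed

lemma function_subalgebra_iff:
  fixes B :: "('g \<Rightarrow> 'k::field) set"
  shows "function_subalgebra X B \<longleftrightarrow> (\<forall>f\<in>B. \<forall>x. x \<notin> X \<longrightarrow> f x = 0) \<and>
    (\<forall>c. ext0 X (\<lambda>_. c) \<in> B) \<and> (\<forall>f\<in>B. \<forall>g\<in>B. f + g \<in> B \<and> f * g \<in> B)" (is "_ \<longleftrightarrow> ?R")
proof
  assume "function_subalgebra X B"
  then have "subring B (function_ring X)" "\<forall>c. ext0 X (\<lambda>_. c) \<in> B"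
    by (auto simp: function_subalgebra_def)
  then show ?R
    using subringE(1,6,7)[of B "function_ring X"]
    by (simp add: function_ring_def plus_fun_def times_fun_def subset_iff)
next
  assume R: ?R
  interpret cring "function_ring X :: ('g \<Rightarrow> 'k) ring" by (rule function_ring)
  have vanish: "\<forall>x. x \<notin> X \<longrightarrow> f x = 0" if "f \<in> B" for f
    using R that by blast
  have closed: "f + g \<in> B" "f * g \<in> B" if "f \<in> B" "g \<in> B" for f g
    using R that by blast+
  have const: "ext0 X (\<lambda>_. c) \<in> B" for c
    using R by blast
  have sub: "B \<subseteq> carrier (function_ring X)"
    using vanish by (simp add: function_ring_def subset_iff)
  have "subring B (function_ring X)"
  proof (rule subringI[OF sub])
    show "\<one>\<^bsub>function_ring X\<^esub> \<in> B"
      using const by (simp add: function_ring_def)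
  next
    fix f assume f: "f \<in> B"
    have "ext0 X (\<lambda>_. - 1) * f = - f"
      using vanish[OF f] by (simp add: ext0_def fun_eq_iff)
    then show "\<ominus>\<^bsub>function_ring X\<^esub> f \<in> B"
      using closed(2)[OF const f, of "- 1"] function_ring_uminus[of f X] sub f by auto
  next
    fix f g assume "f \<in> B" "g \<in> B"
    then show "f \<otimes>\<^bsub>function_ring X\<^esub> g \<in> B" "f \<oplus>\<^bsub>function_ring X\<^esub> g \<in> B"
      using closed by (simp_all add: function_ring_def plus_fun_def times_fun_def)
  qed
  then show "function_subalgebra X B"
    using const by (simp add: function_subalgebra_def)
qed

section \<open>The prime field form and the linear extension of its power map\<close>

locale group_with_form = affine_algebraic_group G A + form: prime_field_form G A A\<^sub>0
  for G :: "('g, 'm) monoid_scheme" (structure) and A A\<^sub>0 :: "('g \<Rightarrow> 'k::alg_closed_field) set" +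
  assumes char_pos: "CHAR('k) > 0"
begin

text \<open>The unit of \<open>A\<close>. Outside \<open>carrier G\<close> it differs from the unit
  \<open>1\<close> of the function type.\<close>

definition e :: "'g \<Rightarrow> 'k" where
  "e = ext0 (carrier G) (\<lambda>_. 1)"

lemma e_apply: "e x = (if x \<in> carrier G then 1 else 0)"
  by (simp add: e_def ext0_def)

lemma A_vanish: "\<lbrakk>f \<in> A; x \<notin> carrier G\<rbrakk> \<Longrightarrow> f x = 0"
  and A_add: "\<lbrakk>f \<in> A; g \<in> A\<rbrakk> \<Longrightarrow> f + g \<in> A"
  and A_mult: "\<lbrakk>f \<in> A; g \<in> A\<rbrakk> \<Longrightarrow> f * g \<in> A"
  and A_const: "ext0 (carrier G) (\<lambda>_. c) \<in> A"
  using algebra unfolding function_subalgebra_iff by blast+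

lemma e_A: "e \<in> A"
  using A_const by (simp add: e_def)

lemma A_scl: "f \<in> A \<Longrightarrow> scl c f \<in> A"
proof -
  assume f: "f \<in> A"
  have "scl c f = ext0 (carrier G) (\<lambda>_. c) * f"
    using A_vanish[OF f] by (auto simp: fun_eq_iff ext0_def)
  then show ?thesis using A_mult[OF A_const f] by simp
qed

lemma subspace_A: "fun_vs.subspace A"
  unfolding fun_vs.subspace_def
  using A_add A_scl A_scl[OF e_A, of 0] by (auto simp: scl_def zero_fun_def)

lemmas A_0 = fun_vs.subspace_0[OF subspace_A] and A_sum = fun_vs.subspace_sum[OF subspace_A]
  and A_diff = fun_vs.subspace_diff[OF subspace_A]

lemma A0_A: "f \<in> A\<^sub>0 \<Longrightarrow> f \<in> A"
  using form.subset by blast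

lemma A0_add: "\<lbrakk>f \<in> A\<^sub>0; g \<in> A\<^sub>0\<rbrakk> \<Longrightarrow> f + g \<in> A\<^sub>0"
  and A0_mult: "\<lbrakk>f \<in> A\<^sub>0; g \<in> A\<^sub>0\<rbrakk> \<Longrightarrow> f * g \<in> A\<^sub>0"
  and A0_e: "e \<in> A\<^sub>0" and A0_0: "0 \<in> A\<^sub>0"
  using subringE(2,3,6,7)[OF form.subring]
  by (simp_all add: coordinate_ring_def function_ring_def e_def plus_fun_def times_fun_def zero_fun_def)

lemma A0_uminus:
  assumes f: "f \<in> A\<^sub>0" shows "- f \<in> A\<^sub>0"
proof -
  interpret F: cring "function_ring (carrier G) :: ('g \<Rightarrow> 'k) ring" by (rule function_ring)
  have "subring A (function_ring (carrier G))"
    using algebra by (simp add: function_subalgebra_def)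
  then interpret R: ring "coordinate_ring G A"
    unfolding coordinate_ring_def by (rule F.subring_is_ring)
  let ?g = "\<ominus>\<^bsub>coordinate_ring G A\<^esub> f"
  have g: "?g \<in> A\<^sub>0" using subringE(5)[OF form.subring f] .
  have "?g \<oplus>\<^bsub>coordinate_ring G A\<^esub> f = \<zero>\<^bsub>coordinate_ring G A\<^esub>"
    using A0_A[OF f] by (intro R.l_neg) (simp add: coordinate_ring_def)
  then have "?g + f = 0"
    by (simp add: coordinate_ring_def function_ring_def plus_fun_def zero_fun_def)
  then have "?g = - f"
    by (simp only: eq_neg_iff_add_eq_0)
  then show ?thesis using g by simp
qed

lemma A0_scl:
  assumes "m \<in> prime_subfield" "f \<in> A\<^sub>0" shows "scl m f \<in> A\<^sub>0"
proof -
  have nat: "scl (of_nat n) f \<in> A\<^sub>0" if "f \<in> A\<^sub>0" for n f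
  proof (induction n)
    case 0
    have "scl (of_nat 0) f = 0" by simp
    then show ?case using A0_0 by (simp only:)
  next
    case (Suc n)
    have "scl (of_nat (Suc n)) f = f + scl (of_nat n) f"
      by (simp add: fun_eq_iff algebra_simps)
    then show ?case using A0_add[OF that Suc] by (simp only:)
  qed
  obtain z where z: "m = of_int z" using assms(1) by (auto simp: prime_subfield_def)
  obtain a b where "z = int a - int b" using int_diff_cases by metis
  then have "m = of_nat a - of_nat b" by (simp add: z)
  then have "scl m f = scl (of_nat a) f + scl (of_nat b) (- f)"
    by (simp only:) (simp add: fun_eq_iff algebra_simps)
  then show ?thesis by (simp only: nat assms(2) A0_uminus A0_add)
qed

lemma span_A0: "fun_vs.span A\<^sub>0 = A"
proof
  show "fun_vs.span A\<^sub>0 \<subseteq> A"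
    using form.subset subspace_A by (rule fun_vs.span_minimal)
  show "A \<subseteq> fun_vs.span A\<^sub>0"
  proof
    fix f assume "f \<in> A"
    then obtain n c g where g: "\<forall>i<n::nat. g i \<in> A\<^sub>0" "f = (\<lambda>x. \<Sum>i<n. c i * g i x)"
      using form.spans by blast
    have "f = (\<Sum>i<n. scl (c i) (g i))"
      by (simp add: g(2) fun_eq_iff)
    moreover have "scl (c i) (g i) \<in> fun_vs.span A\<^sub>0" if "i < n" for i
      using g(1) that by (intro fun_vs.span_scale fun_vs.span_base) blast
    ultimately show "f \<in> fun_vs.span A\<^sub>0"
      using fun_vs.span_sum[of "{..<n}" "\<lambda>i. scl (c i) (g i)"] by blast
  qed
qed

lemma A_induct [consumes 1, case_names scl add]:
  assumes "f \<in> A" "\<And>c g. g \<in> A\<^sub>0 \<Longrightarrow> Q (scl c g)"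
    "\<And>f g. \<lbrakk>f \<in> A; g \<in> A; Q f; Q g\<rbrakk> \<Longrightarrow> Q (f + g)"
  shows "Q f"
proof -
  have "f \<in> fun_vs.span A\<^sub>0" using assms(1) span_A0 by simp
  then have "f \<in> A \<and> Q f"
  proof (induction rule: fun_vs.span_induct_alt)
    case base
    have "Q 0" using assms(2)[OF A0_0, of 0] by simp
    with A_0 show ?case ..
  next
    case (step c x y)
    then show ?case using assms(2,3) A_add A_scl A0_A by blast
  qed
  then show ?thesis ..
qed

lemma prime_CHAR: "prime CHAR('k)" and prime_CHAR_fun: "prime CHAR('g \<Rightarrow> 'k)"
  using prime_CHAR_semidom[OF char_pos] by (simp_all add: CHAR_fun)

lemma q_pos: "CHAR('k) ^ s > 0"
  using char_pos by simp

lemma dream_fun: "(f + g) ^ (CHAR('k) ^ s) = (f :: 'g \<Rightarrow> 'k) ^ (CHAR('k) ^ s) + g ^ (CHAR('k) ^ s)"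
  using freshmans_dream'[OF prime_CHAR_fun refl] by (simp add: CHAR_fun)

lemma dream_fun_sum: "(\<Sum>i\<in>S. f i) ^ (CHAR('k) ^ s) = (\<Sum>i\<in>S. (f i :: 'g \<Rightarrow> 'k) ^ (CHAR('k) ^ s))"
  using freshmans_dream_sum'[OF prime_CHAR_fun refl] by (simp add: CHAR_fun)

lemma scl_power: "scl c f ^ n = scl (c ^ n) (f ^ n)"
  by (simp add: fun_eq_iff power_mult_distrib)

text \<open>The contrapositive of \<open>form.independent\<close>, indexed by a finite set: a
  dependence over the field forces one over the prime field.\<close>

lemma form_independent:
  assumes "finite S" "S \<subseteq> A\<^sub>0" "(\<Sum>f\<in>S. scl (d f) f) = 0" "f \<in> S" "d f \<noteq> 0"
  obtains c where "\<And>f. f \<in> S \<Longrightarrow> c f \<in> prime_subfield" "(\<Sum>f\<in>S. scl (c f) f) = 0" "\<exists>f\<in>S. c f \<noteq> 0"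
proof (rule ccontr)
  assume no: "\<not> thesis"
  obtain g where g: "bij_betw g {..<card S} S"
    using ex_bij_betw_nat_finite[OF assms(1)] by (auto simp: atLeast0LessThan)
  have gS: "g i \<in> S" if "i < card S" for i
    using g that by (auto simp: bij_betw_def)
  let ?h = "the_inv_into {..<card S} g"
  have h: "?h (g i) = i" if "i < card S" for i
    using g that by (simp add: bij_betw_def the_inv_into_f_f)
  have sum: "(\<lambda>x. \<Sum>i<card S. c (g i) * g i x) = (\<Sum>f\<in>S. scl (c f) f)" for c
    using sum.reindex_bij_betw[OF g, of "\<lambda>f. c f * f x" for x] by (simp add: fun_eq_iff)
  have "\<forall>i<card S. d (g i) = 0"
  proof (rule form.independent)
    show "\<forall>i<card S. g i \<in> A\<^sub>0" using gS assms(2) by blast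
    show "(\<lambda>x. \<Sum>i<card S. d (g i) * g i x) = (\<lambda>_. 0)"
      unfolding sum assms(3) by (simp add: zero_fun_def)
    show "\<forall>c. (\<forall>i<card S. c i \<in> prime_subfield) \<and> (\<lambda>x. \<Sum>i<card S. c i * g i x) = (\<lambda>_. 0) \<longrightarrow>
        (\<forall>i<card S. c i = 0)"
    proof (intro allI impI, elim conjE)
      fix c i
      assume c: "\<forall>i<card S. c i \<in> prime_subfield" "(\<lambda>x. \<Sum>i<card S. c i * g i x) = (\<lambda>_. 0)"
        and i: "i < card S"
      define c' where "c' f = c (?h f)" for f
      have c': "c' (g i) = c i" if "i < card S" for i
        using h that by (simp add: c'_def)
      have "(\<lambda>x. \<Sum>i<card S. c' (g i) * g i x) = (\<lambda>x. \<Sum>i<card S. c i * g i x)"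
        using c' by simp
      then have "(\<Sum>f\<in>S. scl (c' f) f) = 0"
        unfolding sum c(2) by (simp add: zero_fun_def)
      moreover have "c' f \<in> prime_subfield" if "f \<in> S" for f
      proof -
        have "f \<in> g ` {..<card S}" using g that by (simp add: bij_betw_def)
        then obtain i where "i < card S" "f = g i" by blast
        then show ?thesis using c' c(1) by simp
      qed
      ultimately have "\<not> (\<exists>f\<in>S. c' f \<noteq> 0)" using no that by blast
      then show "c i = 0" using c'[OF i] gS[OF i] by auto
    qed
  qed
  moreover have "f \<in> g ` {..<card S}" using g assms(4) by (simp add: bij_betw_def)
  ultimately show False using assms(5) by auto
qed

text \<open>The map is prescribed on a basis \<open>B\<close> of \<open>A\<close> inside
  \<open>A\<^sub>0\<close> and extended linearly. Any other \<open>f\<close> in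
  \<open>A\<^sub>0\<close> satisfies a relation with elements of \<open>B\<close> over the prime
  field. Its coefficients are fixed by the power map, so \<open>f ^ q\<close> satisfies the relation
  that defines the image of \<open>f\<close>.\<close>

lemma frobenius_exists:
  "\<exists>\<phi>. (\<forall>f g. \<phi> (f + g) = \<phi> f + \<phi> g) \<and> (\<forall>c f. \<phi> (scl c f) = scl c (\<phi> f)) \<and>
    (\<forall>f\<in>A\<^sub>0. \<phi> f = f ^ (CHAR('k) ^ s))"
proof -
  let ?q = "CHAR('k) ^ s"
  obtain B where B: "B \<subseteq> A\<^sub>0" "fun_vs.independent B" "A\<^sub>0 \<subseteq> fun_vs.span B"
    using fun_vs.maximal_independent_subset by blast
  define \<phi> where "\<phi> = fun_fun.construct B (\<lambda>f. f ^ ?q)"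
  interpret \<phi>: Vector_Spaces.linear scl scl \<phi>
    unfolding \<phi>_def by (rule fun_fun.linear_construct[OF B(2)])
  have basis: "\<phi> b = b ^ ?q" if "b \<in> B" for b
    unfolding \<phi>_def using B(2) that by (rule fun_fun.construct_basis)
  have "\<phi> f = f ^ ?q" if f: "f \<in> A\<^sub>0" for f
  proof (cases "f \<in> B")
    case False
    have "f \<in> fun_vs.span B" using B(3) f by blast
    then obtain t u where t: "finite t" "t \<subseteq> B" "f = (\<Sum>a\<in>t. scl (u a) a)"
      unfolding fun_vs.span_explicit by blast
    have ft: "f \<notin> t" using False t(2) by blast
    have "(\<Sum>a\<in>t. scl ((u(f := - 1)) a) a) = (\<Sum>a\<in>t. scl (u a) a)"
      using ft by (intro sum.cong) auto
    then have dep: "(\<Sum>a\<in>insert f t. scl ((u(f := - 1)) a) a) = 0"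
      using t ft by simp
    obtain c where c: "\<And>a. a \<in> insert f t \<Longrightarrow> c a \<in> prime_subfield"
      "(\<Sum>a\<in>insert f t. scl (c a) a) = 0" "\<exists>a\<in>insert f t. c a \<noteq> 0"
    proof (rule form_independent[OF _ _ dep, of f])
      show "insert f t \<subseteq> A\<^sub>0" using t(2) B(1) f by blast
    qed (use t(1) that in auto)
    \<comment> \<open>The new relation must still involve \<open>f\<close>, since its other terms
      are independent.\<close>
    have cf: "c f \<noteq> 0"
    proof
      assume "c f = 0"
      then have "(\<Sum>a\<in>t. scl (c a) a) = 0" using c(2) t(1) ft by simp
      then have "\<forall>a\<in>t. c a = 0"
        using fun_vs.independentD[OF B(2) t(1,2)] by blast
      then show False using c(3) \<open>c f = 0\<close> by blast
    qed
    have rel: "scl (c f) f = - (\<Sum>a\<in>t. scl (c a) a)"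
      using c(2) t(1) ft by (simp add: eq_neg_iff_add_eq_0)
    have pow: "c a ^ ?q = c a" if "a \<in> insert f t" for a
      using prime_subfield_power[OF prime_CHAR] c(1) that by blast
    have "scl (c f) (f ^ ?q) + (\<Sum>a\<in>t. scl (c a) (a ^ ?q)) = (\<Sum>a\<in>insert f t. scl (c a) a) ^ ?q"
      using t(1) ft pow by (simp add: dream_fun dream_fun_sum scl_power del: CHAR_pos_iff)
    also have "\<dots> = 0"
      unfolding c(2) using q_pos by (simp add: zero_power)
    finally have 1: "scl (c f) (f ^ ?q) + (\<Sum>a\<in>t. scl (c a) (a ^ ?q)) = 0" .
    have "scl (c f) (\<phi> f) + (\<Sum>a\<in>t. scl (c a) (a ^ ?q)) = \<phi> (\<Sum>a\<in>insert f t. scl (c a) a)"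
      using t ft basis by (auto simp: \<phi>.add \<phi>.scale \<phi>.sum intro!: sum.cong)
    then have "scl (c f) (\<phi> f) + (\<Sum>a\<in>t. scl (c a) (a ^ ?q)) = 0"
      unfolding c(2) by (simp add: \<phi>.zero)
    then have "scl (c f) (\<phi> f) = scl (c f) (f ^ ?q)"
      using 1 by (metis add_right_cancel)
    then show ?thesis using cf by simp
  qed (rule basis)
  then show ?thesis
    by (intro exI[of _ \<phi>]) (auto simp: \<phi>.add \<phi>.scale)
qed

text \<open>On \<open>A\<close> this is the comorphism of the geometric Frobenius endomorphism. It
  is linear on all functions, so its linearity rules carry no membership conditions.\<close>

definition \<phi> :: "nat \<Rightarrow> ('g \<Rightarrow> 'k) \<Rightarrow> 'g \<Rightarrow> 'k" where
  "\<phi> s = (SOME \<phi>. (\<forall>f g. \<phi> (f + g) = \<phi> f + \<phi> g) \<and> (\<forall>c f. \<phi> (scl c f) = scl c (\<phi> f)) \<and>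
    (\<forall>f\<in>A\<^sub>0. \<phi> f = f ^ (CHAR('k) ^ s)))"

lemma \<phi>_add: "\<phi> s (f + g) = \<phi> s f + \<phi> s g"
  and \<phi>_scl: "\<phi> s (scl c f) = scl c (\<phi> s f)"
  and \<phi>_A0: "f \<in> A\<^sub>0 \<Longrightarrow> \<phi> s f = f ^ (CHAR('k) ^ s)"
  using someI_ex[OF frobenius_exists[of s], folded \<phi>_def] by blast+

text \<open>The exponent is positive because \<open>f ^ 0\<close> is the unit of the function type,
  which does not vanish outside the group.\<close>

lemma A_power: "f \<in> A \<Longrightarrow> n > 0 \<Longrightarrow> f ^ n \<in> A"
proof (induction n)
  case (Suc n)
  have "f ^ Suc n \<in> A"
  proof (cases "n = 0")
    case False
    then have "f ^ n \<in> A" using Suc.IH Suc.prems(1) by blast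
    then have "f * f ^ n \<in> A" using A_mult Suc.prems(1) by blast
    then show ?thesis by simp
  qed (use Suc in simp)
  then show ?case .
qed simp

lemma \<phi>_A: "f \<in> A \<Longrightarrow> \<phi> s f \<in> A"
proof (induction f rule: A_induct)
  case (scl c g)
  have "\<phi> s (scl c g) \<in> A"
    unfolding \<phi>_scl \<phi>_A0[OF scl] by (intro A_scl A_power A0_A scl q_pos)
  then show ?case .
next
  case (add f g)
  have "\<phi> s (f + g) \<in> A"
    unfolding \<phi>_add using add by (intro A_add)
  then show ?case .
qed

lemma \<phi>_mult:
  assumes "f \<in> A" "g \<in> A" shows "\<phi> s (f * g) = \<phi> s f * \<phi> s g"
proof -
  have 1: "\<phi> s (f * g) = \<phi> s f * \<phi> s g" if f: "f \<in> A\<^sub>0" and g: "g \<in> A" for f g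
    using g
  proof (induction g rule: A_induct)
    case (scl d g)
    have "f * scl d g = scl d (f * g)" by (simp add: fun_eq_iff)
    then have "\<phi> s (f * scl d g) = scl d ((f * g) ^ (CHAR('k) ^ s))"
      using f scl A0_mult by (simp only: \<phi>_scl \<phi>_A0)
    also have "\<dots> = \<phi> s f * \<phi> s (scl d g)"
      unfolding \<phi>_scl \<phi>_A0[OF f] \<phi>_A0[OF scl] by (simp add: power_mult_distrib fun_eq_iff)
    finally show ?case .
  next
    case (add g h)
    have "\<phi> s (f * (g + h)) = \<phi> s f * \<phi> s (g + h)"
      unfolding distrib_left \<phi>_add add(3,4) ..
    then show ?case .
  qed
  show ?thesis
    using assms(1)
  proof (induction f rule: A_induct)
    case (scl c f)
    have "scl c f * g = scl c (f * g)" by (simp add: fun_eq_iff)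
    then have "\<phi> s (scl c f * g) = scl c (\<phi> s f * \<phi> s g)"
      using 1[OF scl assms(2)] by (simp only: \<phi>_scl)
    also have "\<dots> = \<phi> s (scl c f) * \<phi> s g"
      unfolding \<phi>_scl by (simp add: fun_eq_iff)
    finally show ?case .
  next
    case (add f h)
    have "\<phi> s ((f + h) * g) = \<phi> s (f + h) * \<phi> s g"
      unfolding distrib_right \<phi>_add add(3,4) ..
    then show ?case .
  qed
qed

lemma \<phi>_e: "\<phi> s e = e"
  using \<phi>_A0[OF A0_e, of s] q_pos[of s] by (auto simp: fun_eq_iff e_apply zero_power)

end

section \<open>The order of vanishing at the identity\<close>

lemma image_combos:
  assumes "\<And>x y. h (x + y) = h x + h y" "\<And>x y. h (x * y) = h x * h y"
  shows "h ` combos C S = combos (h ` C) (h ` S)"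
proof
  have h0: "h 0 = 0" using assms(1)[of 0 0] by simp
  show "h ` combos C S \<subseteq> combos (h ` C) (h ` S)"
  proof clarify
    fix t assume "t \<in> combos C S"
    then show "h t \<in> combos (h ` C) (h ` S)"
      by induction (auto simp: h0 assms intro: combos_0 combos_step)
  qed
  show "combos (h ` C) (h ` S) \<subseteq> h ` combos C S"
  proof (rule combos_subset)
    show "0 \<in> h ` combos C S" using h0 combos_0 by (metis imageI)
    fix x y assume "x \<in> h ` combos C S" "y \<in> h ` combos C S"
    then show "x + y \<in> h ` combos C S"
      by (auto simp flip: assms(1) intro: combos_add)
  next
    fix c s assume "c \<in> h ` C" "s \<in> h ` S"
    then show "c * s \<in> h ` combos C S"
      by (auto simp flip: assms(2) intro: combos_gen)
  qed
qed

context group_with_form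
begin

definition \<rho> :: "'g \<Rightarrow> 'g" where
  "\<rho> x = (if x \<in> carrier G then x else \<one>)"

lemma \<rho>_carrier: "\<rho> x \<in> carrier G" and \<rho>_id: "x \<in> carrier G \<Longrightarrow> \<rho> x = x" and \<rho>_one: "\<rho> \<one> = \<one>"
  by (simp_all add: \<rho>_def)

text \<open>
  Composing with \<open>\<rho>\<close> replaces the coordinate algebra by an isomorphic algebra \<open>A1\<close> whose unit is the
  unit of the ring of all functions.
\<close>

definition R :: "('g \<Rightarrow> 'k) \<Rightarrow> 'g \<Rightarrow> 'k" where
  "R f = (\<lambda>x. f (\<rho> x))"

definition A1 :: "('g \<Rightarrow> 'k) set" where
  "A1 = R ` A"

lemma R_add: "R (f + g) = R f + R g" and R_mult: "R (f * g) = R f * R g"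
  and R_power: "R (f ^ n) = R f ^ n" and R_0: "R 0 = 0" and R_scl: "R (scl c f) = (\<lambda>_. c) * R f"
  and R_one: "R f \<one> = f \<one>"
  by (simp_all add: R_def fun_eq_iff \<rho>_one)

lemma R_const: "R (ext0 (carrier G) (\<lambda>_. c)) = (\<lambda>_. c)"
  by (simp add: R_def fun_eq_iff ext0_def \<rho>_carrier)

lemma ext0_R: "f \<in> A \<Longrightarrow> ext0 (carrier G) (R f) = f"
  using A_vanish[of f] by (auto simp: ext0_def R_def fun_eq_iff \<rho>_id)

lemma inj_R: "\<lbrakk>f \<in> A; g \<in> A; R f = R g\<rbrakk> \<Longrightarrow> f = g"
  by (metis ext0_R)

lemma R_A1: "f \<in> A \<Longrightarrow> R f \<in> A1"
  by (simp add: A1_def)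

end

sublocale group_with_form \<subseteq> aug: augmented_algebra A1 "\<lambda>c _. c" "\<lambda>F. F \<one>"
proof unfold_locales
  fix c :: 'k
  show "(\<lambda>_. c) \<in> A1"
    using R_A1[OF A_const] by (simp add: R_const)
next
  fix F F' assume "F \<in> A1" "F' \<in> A1"
  then obtain f f' where "f \<in> A" "f' \<in> A" "F = R f" "F' = R f'" by (auto simp: A1_def)
  then show "F + F' \<in> A1" "F * F' \<in> A1"
    using R_A1[OF A_add] R_A1[OF A_mult] by (auto simp: R_add R_mult)
qed (simp_all add: fun_eq_iff)

context group_with_form
begin

abbreviation J :: "('g \<Rightarrow> 'k) set" where
  "J \<equiv> augmentation_ideal G A"

definition Pw :: "nat \<Rightarrow> ('g \<Rightarrow> 'k) set" where
  "Pw k = J [^]\<^bsub>ideals_set (coordinate_ring G A)\<^esub> k"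

lemma coordinate_ring_simps:
  "carrier (coordinate_ring G A) = A" "\<one>\<^bsub>coordinate_ring G A\<^esub> = e"
  "f \<otimes>\<^bsub>coordinate_ring G A\<^esub> g = f * g" "f \<oplus>\<^bsub>coordinate_ring G A\<^esub> g = f + g"
  by (simp_all add: coordinate_ring_def function_ring_def e_def times_fun_def plus_fun_def)

text \<open>The inductive \<open>ideal_prod\<close> has no clause for the empty sum, so zero has to
  come from a product of members; hence the two assumptions.\<close>

lemma ideal_prod_combos:
  assumes "0 \<in> U" "0 \<in> V"
  shows "ideal_prod (coordinate_ring G A) U V = combos U V"
proof
  show "ideal_prod (coordinate_ring G A) U V \<subseteq> combos U V"
  proof
    fix f assume "f \<in> ideal_prod (coordinate_ring G A) U V"
    then show "f \<in> combos U V"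
    proof induction
      case (prod i j)
      then have "i * j \<in> combos U V" by (rule combos_gen)
      then show ?case by (simp only: coordinate_ring_simps)
    next
      case (sum s t)
      then have "s + t \<in> combos U V" by (intro combos_add)
      then show ?case by (simp only: coordinate_ring_simps)
    qed
  qed
  show "combos U V \<subseteq> ideal_prod (coordinate_ring G A) U V"
  proof (rule combos_subset)
    show "c * s \<in> ideal_prod (coordinate_ring G A) U V" if "c \<in> U" "s \<in> V" for c s
      using ideal_prod.prod[OF that, of "coordinate_ring G A"] by (simp only: coordinate_ring_simps)
    from this[OF assms] show "0 \<in> ideal_prod (coordinate_ring G A) U V"
      by (simp only: mult_zero_left)
    show "x + y \<in> ideal_prod (coordinate_ring G A) U V"
      if "x \<in> ideal_prod (coordinate_ring G A) U V" "y \<in> ideal_prod (coordinate_ring G A) U V" for x y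
      using ideal_prod.sum[OF that] by (simp only: coordinate_ring_simps)
  qed
qed

lemma J_0: "0 \<in> J"
  by (simp add: augmentation_ideal_def A_0)

lemma Pw_0: "Pw 0 = A"
  by (simp add: Pw_def ideals_set_def coordinate_ring_simps)

lemma Pw_Suc: "Pw (Suc k) = combos (Pw k) J"
proof -
  have prod: "Pw (Suc k) = ideal_prod (coordinate_ring G A) (Pw k) J" for k
    by (simp add: Pw_def ideals_set_def)
  have "0 \<in> Pw k"
  proof (induction k)
    case 0
    show ?case unfolding Pw_0 by (rule A_0)
  next
    case (Suc k)
    show ?case
      unfolding prod ideal_prod_combos[OF Suc.IH J_0] by (rule combos_0)
  qed
  then show ?thesis
    unfolding prod using J_0 by (rule ideal_prod_combos)
qed

lemma R_J: "R ` J = aug.I"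
proof
  show "R ` J \<subseteq> aug.I"
    unfolding aug.I_def augmentation_ideal_def using R_A1 by (auto simp: R_one)
  show "aug.I \<subseteq> R ` J"
  proof
    fix F assume "F \<in> aug.I"
    then obtain f where "f \<in> A" "F = R f" "F \<one> = 0"
      unfolding aug.I_def by (auto simp: A1_def)
    then show "F \<in> R ` J" by (auto simp: augmentation_ideal_def R_one)
  qed
qed

lemma R_Pw: "R ` Pw k = aug.P k"
  by (induction k) (simp_all add: Pw_0 A1_def[symmetric] Pw_Suc image_combos R_add R_mult R_J)

lemma Pw_A: "f \<in> Pw k \<Longrightarrow> f \<in> A"
proof -
  have "Pw k \<subseteq> A"
  proof (induction k)
    case (Suc k)
    have "J \<subseteq> A" by (auto simp: augmentation_ideal_def)
    then show ?case
      unfolding Pw_Suc using Suc by (intro combos_subset A_0 A_add A_mult) auto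
  qed (simp add: Pw_0)
  then show "f \<in> Pw k \<Longrightarrow> f \<in> A" by blast
qed

lemma Pw_iff: "f \<in> Pw k \<longleftrightarrow> f \<in> A \<and> R f \<in> aug.P k"
proof
  assume "f \<in> A \<and> R f \<in> aug.P k"
  moreover then obtain g where "g \<in> Pw k" "R f = R g"
    using R_Pw by blast
  ultimately show "f \<in> Pw k" using inj_R Pw_A by blast
qed (use Pw_A R_Pw in blast)

lemma Pw_add: "\<lbrakk>f \<in> Pw k; g \<in> Pw k\<rbrakk> \<Longrightarrow> f + g \<in> Pw k"
  unfolding Pw_iff using A_add aug.P_add by (simp add: R_add)

lemma Pw_scl: "f \<in> Pw k \<Longrightarrow> scl c f \<in> Pw k"
  unfolding Pw_iff R_scl using A_scl aug.P_mult[OF aug.\<kappa>_in] by blast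

lemma subspace_Pw: "fun_vs.subspace (Pw k)"
  unfolding fun_vs.subspace_def using Pw_add Pw_scl Pw_iff[of 0 k] A_0 aug.P_0 by (simp add: R_0)

lemma Pw_mult_Pw: "\<lbrakk>f \<in> Pw j; g \<in> Pw k\<rbrakk> \<Longrightarrow> f * g \<in> Pw (j + k)"
  unfolding Pw_iff R_mult using A_mult aug.P_mult_P by blast

lemma Pw_antimono: "j \<le> k \<Longrightarrow> f \<in> Pw k \<Longrightarrow> f \<in> Pw j"
  unfolding Pw_iff using aug.P_antimono by blast

lemma Pw_1: "Pw (Suc 0) = J"
proof -
  have "f \<in> Pw (Suc 0) \<longleftrightarrow> f \<in> J" for f
    unfolding Pw_iff aug.P_1 aug.I_def
    using R_A1 by (auto simp: R_one augmentation_ideal_def)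
  then show ?thesis by blast
qed

lemma Pw_power:
  assumes "f \<in> J" "n > 0" shows "f ^ n \<in> Pw n"
proof -
  have "f \<in> A" using assms(1) by (simp add: augmentation_ideal_def)
  have "prod_mset (replicate_mset n (R f)) \<in> aug.P (size (replicate_mset n (R f)))"
    using assms(1) R_J by (intro aug.P_prod_mset) auto
  then show ?thesis
    unfolding Pw_iff using A_power[OF \<open>f \<in> A\<close> assms(2)] by (simp add: R_power)
qed

lemma minus_const_J:
  assumes "f \<in> A" shows "f - scl (f \<one>) e \<in> J"
  using A_diff[OF assms A_scl[OF e_A]] by (simp add: augmentation_ideal_def e_apply)

text \<open>For \<open>g\<close> in the form, \<open>g \<one>\<close> lies in the prime field and
  equals its own \<open>q\<close>-th power. So the difference is the \<open>q\<close>-th power of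
  \<open>g\<close> minus its constant term, an element of \<open>J\<close>.\<close>

lemma frobenius_minus_const:
  "f \<in> A \<Longrightarrow> \<phi> s f - scl (f \<one>) e \<in> Pw (CHAR('k) ^ s)"
proof (induction f rule: A_induct)
  case (scl c g)
  let ?q = "CHAR('k) ^ s"
  have "(g - scl (g \<one>) e) + scl (g \<one>) e = g" by simp
  then have "g ^ ?q = (g - scl (g \<one>) e) ^ ?q + scl (g \<one>) e ^ ?q"
    by (metis dream_fun)
  moreover have "scl (g \<one>) e ^ ?q = scl (g \<one>) e"
    unfolding scl_power prime_subfield_power[OF prime_CHAR form.counit[OF scl]]
    using q_pos[of s] by (simp add: fun_eq_iff e_apply zero_power)
  ultimately have "\<phi> s (scl c g) - scl (scl c g \<one>) e = scl c ((g - scl (g \<one>) e) ^ ?q)"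
    unfolding \<phi>_scl \<phi>_A0[OF scl] by (simp add: fun_eq_iff algebra_simps)
  also have "\<dots> \<in> Pw ?q"
    by (intro Pw_scl Pw_power minus_const_J A0_A scl q_pos)
  finally show ?case .
next
  case (add f g)
  have "\<phi> s (f + g) - scl ((f + g) \<one>) e = (\<phi> s f - scl (f \<one>) e) + (\<phi> s g - scl (g \<one>) e)"
    unfolding \<phi>_add by (simp add: fun_eq_iff algebra_simps)
  also have "\<dots> \<in> Pw (CHAR('k) ^ s)"
    using add by (intro Pw_add)
  finally show ?case .
qed

lemma \<phi>_0: "\<phi> s 0 = 0"
  using \<phi>_add[of s 0 0] by simp

lemma \<phi>_Pw: "f \<in> Pw k \<Longrightarrow> \<phi> s f \<in> Pw (k * CHAR('k) ^ s)"
proof (induction k arbitrary: f)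
  case 0
  then show ?case using \<phi>_A by (simp add: Pw_0)
next
  case (Suc k)
  have J: "\<phi> s g \<in> Pw (CHAR('k) ^ s)" if "g \<in> J" for g
    using frobenius_minus_const[of g s] that
    by (simp add: augmentation_ideal_def fun_vs.scale_zero_left)
  have "combos (Pw k) J \<subseteq> {f \<in> A. \<phi> s f \<in> Pw (Suc k * CHAR('k) ^ s)}"
  proof (rule combos_subset)
    show "0 \<in> {f \<in> A. \<phi> s f \<in> Pw (Suc k * CHAR('k) ^ s)}"
      using A_0 fun_vs.subspace_0[OF subspace_Pw] \<phi>_0 by simp
  next
    fix f g assume "f \<in> {f \<in> A. \<phi> s f \<in> Pw (Suc k * CHAR('k) ^ s)}" "g \<in> {f \<in> A. \<phi> s f \<in> Pw (Suc k * CHAR('k) ^ s)}"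
    then show "f + g \<in> {f \<in> A. \<phi> s f \<in> Pw (Suc k * CHAR('k) ^ s)}"
      using A_add Pw_add unfolding mem_Collect_eq \<phi>_add by blast
  next
    fix f g assume *: "f \<in> Pw k" "g \<in> J"
    then have A: "f \<in> A" "g \<in> A" using Pw_A by (auto simp: augmentation_ideal_def)
    have "\<phi> s f * \<phi> s g \<in> Pw (k * CHAR('k) ^ s + CHAR('k) ^ s)"
      using Suc.IH[OF *(1)] J[OF *(2)] by (rule Pw_mult_Pw)
    then show "f * g \<in> {f \<in> A. \<phi> s f \<in> Pw (Suc k * CHAR('k) ^ s)}"
      using A_mult[OF A] \<phi>_mult[OF A, of s] by (simp add: add.commute)
  qed
  then show ?case using Suc.prems unfolding Pw_Suc by blast
qed

text \<open>The generators must lie in \<open>A\<^sub>0\<close>, where the Frobenius map is the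
  \<open>q\<close>-th power, and vanish at the identity. Finitely many elements of the form span
  given generators, and their constant terms can be subtracted inside the form by
  \<open>counit\<close>.\<close>

lemma generators_over_prime_field:
  obtains T where "finite T" "T \<subseteq> A\<^sub>0" "T \<subseteq> J"
    "\<And>B. \<lbrakk>function_subalgebra (carrier G) B; T \<subseteq> B\<rbrakk> \<Longrightarrow> A \<subseteq> B"
proof -
  obtain S where S: "S \<subseteq> A" "finite S" "\<And>B. function_subalgebra (carrier G) B \<Longrightarrow> S \<subseteq> B \<Longrightarrow> A \<subseteq> B"
    using finitely_generated by blast
  have "\<exists>T. finite T \<and> T \<subseteq> A\<^sub>0 \<and> S \<subseteq> fun_vs.span T"
    using S(2,1)
  proof (induction S rule: finite_induct)
    case (insert f S)
    then obtain T where T: "finite T" "T \<subseteq> A\<^sub>0" "S \<subseteq> fun_vs.span T" by blast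
    have "f \<in> fun_vs.span A\<^sub>0" using insert.prems span_A0 by blast
    then obtain t u where t: "finite t" "t \<subseteq> A\<^sub>0" "f = (\<Sum>a\<in>t. scl (u a) a)"
      unfolding fun_vs.span_explicit by blast
    have "f \<in> fun_vs.span t"
      unfolding t(3) by (intro fun_vs.span_sum fun_vs.span_scale fun_vs.span_base)
    then have "insert f S \<subseteq> fun_vs.span (T \<union> t)"
      using T(3) fun_vs.span_mono[of T "T \<union> t"] fun_vs.span_mono[of t "T \<union> t"] by blast
    moreover have "finite (T \<union> t)" "T \<union> t \<subseteq> A\<^sub>0" using T t by auto
    ultimately show ?case by blast
  qed auto
  then obtain T where T: "finite T" "T \<subseteq> A\<^sub>0" "S \<subseteq> fun_vs.span T" by blast
  let ?T = "(\<lambda>f. f - scl (f \<one>) e) ` T"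
  show ?thesis
  proof (rule that)
    show "finite ?T" using T(1) by simp
    show "?T \<subseteq> J" using T(2) A0_A minus_const_J by blast
    show "?T \<subseteq> A\<^sub>0"
    proof clarify
      fix f assume "f \<in> T"
      then have f: "f \<in> A\<^sub>0" using T(2) by blast
      have "f - scl (f \<one>) e = f + - scl (f \<one>) e" by simp
      also have "\<dots> \<in> A\<^sub>0"
        by (intro A0_add A0_uminus A0_scl f A0_e form.counit)
      finally show "f - scl (f \<one>) e \<in> A\<^sub>0" .
    qed
  next
    fix B assume B: "function_subalgebra (carrier G) B" "?T \<subseteq> B"
    have closed: "f + g \<in> B" "f * g \<in> B" "ext0 (carrier G) (\<lambda>_. c) \<in> B" if "f \<in> B" "g \<in> B" for f g c
      using B(1) that unfolding function_subalgebra_iff by blast+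
    have const: "ext0 (carrier G) (\<lambda>_. c) \<in> B" for c
      using B(1) unfolding function_subalgebra_iff by blast
    have scl_e: "scl c e = ext0 (carrier G) (\<lambda>_. c)" for c
      by (simp add: fun_eq_iff e_def ext0_def)
    have "0 \<in> B"
      using const[of 0] by (simp add: ext0_def zero_fun_def)
    moreover have "scl c f \<in> B" if "f \<in> B" for c f
    proof -
      have "\<forall>x. x \<notin> carrier G \<longrightarrow> f x = 0"
        using B(1) that unfolding function_subalgebra_iff by blast
      then have "scl c f = ext0 (carrier G) (\<lambda>_. c) * f"
        by (simp add: fun_eq_iff ext0_def)
      then show ?thesis using closed(2)[OF const that] by simp
    qed
    ultimately have "fun_vs.subspace B"
      unfolding fun_vs.subspace_def using closed(1) by blast
    moreover have "T \<subseteq> B"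
    proof
      fix f assume "f \<in> T"
      then have "(f - scl (f \<one>) e) + scl (f \<one>) e \<in> B"
        using B(2) const unfolding scl_e by (intro closed(1)) auto
      then show "f \<in> B" by simp
    qed
    ultimately have "S \<subseteq> B"
      using T(3) fun_vs.span_minimal by blast
    then show "A \<subseteq> B" using S(3) B(1) by blast
  qed
qed

section \<open>Invariant derivations, and the passage from abstract algebras to the group\<close>

lemma comult_A1:
  assumes "F \<in> A1"
  obtains n :: nat and g h where "\<And>i. i < n \<Longrightarrow> g i \<in> A1" "\<And>i. i < n \<Longrightarrow> h i \<in> A1"
    "\<And>x y. F (\<rho> x \<otimes> \<rho> y) = (\<Sum>i<n. g i x * h i y)"
proof -
  obtain f where f: "f \<in> A" "F = R f" using assms by (auto simp: A1_def)
  obtain n :: nat and g h where *: "\<forall>i<n. g i \<in> A \<and> h i \<in> A"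
    "\<forall>x\<in>carrier G. \<forall>y\<in>carrier G. f (x \<otimes> y) = (\<Sum>i<n. g i x * h i y)"
    using comult[OF f(1)] unfolding in_tensor_square_def by blast
  show ?thesis
  proof (rule that[of n "\<lambda>i. R (g i)" "\<lambda>i. R (h i)"])
    fix x y
    have "F (\<rho> x \<otimes> \<rho> y) = f (\<rho> x \<otimes> \<rho> y)"
      using \<rho>_carrier by (simp add: f(2) R_def \<rho>_id)
    then show "F (\<rho> x \<otimes> \<rho> y) = (\<Sum>i<n. R (g i) x * R (h i) y)"
      using *(2) \<rho>_carrier by (simp add: R_def)
  qed (use * R_A1 in auto)
qed

lemma A1_\<rho>: "F \<in> A1 \<Longrightarrow> F (\<rho> x) = F x"
  by (auto simp: A1_def R_def \<rho>_id \<rho>_carrier)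

lemma A1_const_mult: "F \<in> A1 \<Longrightarrow> (\<lambda>x. c * F x) \<in> A1"
  using aug.A_mult[OF aug.\<kappa>_in, of F c] by (simp add: times_fun_def)

lemma A1_sum: "(\<And>i. i \<in> E \<Longrightarrow> F i \<in> A1) \<Longrightarrow> (\<lambda>x. \<Sum>i\<in>E. F i x) \<in> A1"
proof -
  assume "\<And>i. i \<in> E \<Longrightarrow> F i \<in> A1"
  then have "sum F E \<in> A1" by (rule aug.A_sum)
  moreover have "sum F E = (\<lambda>x. \<Sum>i\<in>E. F i x)" by (simp add: fun_eq_iff)
  ultimately show ?thesis by simp
qed

text \<open>The left-invariant vector field of the tangent vector \<open>d\<close>: its value on
  \<open>F\<close> at \<open>x\<close> is \<open>d\<close> applied to the translate of
  \<open>F\<close> by \<open>x\<close>. The comultiplication shows that the result is regular, and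
  the Leibniz rule at the identity becomes the one at \<open>x\<close>.\<close>

lemma invariant_derivation:
  assumes add: "\<And>x y. \<lbrakk>x \<in> A1; y \<in> A1\<rbrakk> \<Longrightarrow> d (x + y) = d x + d y"
    and scale: "\<And>c x. x \<in> A1 \<Longrightarrow> d ((\<lambda>_. c) * x) = c * d x"
    and mult: "\<And>x y. \<lbrakk>x \<in> A1; y \<in> A1\<rbrakk> \<Longrightarrow> d (x * y) = x \<one> * d y + y \<one> * d x"
  shows "\<exists>D. (\<forall>x\<in>A1. D x \<in> A1 \<and> D x \<one> = (d x :: 'k)) \<and>
      (\<forall>x\<in>A1. \<forall>y\<in>A1. D (x + y) = D x + D y \<and> D (x * y) = x * D y + y * D x)"
proof -
  define L where "L F x = (\<lambda>y. F (\<rho> x \<otimes> \<rho> y))" for F :: "'g \<Rightarrow> 'k" and x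
  have d_sum: "d (\<lambda>y. \<Sum>i<n. c i * h i y) = (\<Sum>i<n. c i * d (h i))" if "\<And>i. i < n \<Longrightarrow> h i \<in> A1"
    for c h and n :: nat
    using that
  proof (induction n)
    case 0
    have "d 0 = 0" using scale[OF aug.A_0, of 0] by simp
    then show ?case by (simp add: zero_fun_def)
  next
    case (Suc n)
    have "(\<lambda>y. \<Sum>i<Suc n. c i * h i y) = (\<lambda>y. \<Sum>i<n. c i * h i y) + (\<lambda>y. c n * h n y)"
      by (simp add: fun_eq_iff)
    moreover have "(\<lambda>y. \<Sum>i<n. c i * h i y) \<in> A1" "(\<lambda>y. c n * h n y) \<in> A1"
      using Suc.prems by (intro A1_sum A1_const_mult; simp)+
    moreover have "d (\<lambda>y. c n * h n y) = c n * d (h n)"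
      using scale[of "h n" "c n"] Suc.prems by (simp add: times_fun_def)
    ultimately show ?case using Suc add by simp
  qed
  have L_A1: "L F x \<in> A1" if F: "F \<in> A1" for F x
  proof -
    obtain n :: nat and g h where *: "\<And>i. i < n \<Longrightarrow> g i \<in> A1" "\<And>i. i < n \<Longrightarrow> h i \<in> A1"
      "\<And>x y. F (\<rho> x \<otimes> \<rho> y) = (\<Sum>i<n. g i x * h i y)"
      using comult_A1[OF F] by blast
    then show ?thesis unfolding L_def *(3) by (intro A1_sum A1_const_mult) auto
  qed
  have L_one: "L F x \<one> = F x" if "F \<in> A1" for F x
    using A1_\<rho>[OF that] by (simp add: L_def \<rho>_one \<rho>_carrier)
  have one_L: "L F \<one> = F" if "F \<in> A1" for F
    using A1_\<rho>[OF that] by (simp add: L_def \<rho>_one \<rho>_carrier fun_eq_iff)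
  have L_add: "L (F + F') x = L F x + L F' x" and L_mult: "L (F * F') x = L F x * L F' x" for F F' x
    by (simp_all add: L_def fun_eq_iff)
  let ?D = "\<lambda>F x. d (L F x)"
  have "?D F \<in> A1" if F: "F \<in> A1" for F
  proof -
    obtain n :: nat and g h where *: "\<And>i. i < n \<Longrightarrow> g i \<in> A1" "\<And>i. i < n \<Longrightarrow> h i \<in> A1"
      "\<And>x y. F (\<rho> x \<otimes> \<rho> y) = (\<Sum>i<n. g i x * h i y)"
      using comult_A1[OF F] by blast
    have "?D F = (\<lambda>x. \<Sum>i<n. d (h i) * g i x)"
      unfolding L_def *(3) using d_sum[OF *(2)] by (simp add: mult.commute)
    then show ?thesis
      by (simp only:) (rule A1_sum, rule A1_const_mult, rule *(1), simp)
  qed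
  moreover have "?D (F + F') = ?D F + ?D F'" "?D (F * F') = F * ?D F' + F' * ?D F"
    if "F \<in> A1" "F' \<in> A1" for F F'
    using that by (simp_all add: fun_eq_iff L_add L_mult add mult L_A1 L_one)
  moreover have "?D F \<one> = d F" if "F \<in> A1" for F
    by (simp only: one_L[OF that])
  ultimately show ?thesis
    by (intro exI[of _ ?D] conjI ballI) blast+
qed

lemma frobenius_reflects_Pw:
  assumes f: "f \<in> A" "\<phi> s f \<in> Pw (CHAR('k) ^ (t + s))"
  shows "f \<in> Pw (CHAR('k) ^ t)"
proof -
  obtain T where T: "finite T" "T \<subseteq> A\<^sub>0" "T \<subseteq> J"
    "\<And>B. \<lbrakk>function_subalgebra (carrier G) B; T \<subseteq> B\<rbrakk> \<Longrightarrow> A \<subseteq> B"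
    using generators_over_prime_field by blast
  \<comment> \<open>Reducedness holds because the elements are functions with values in a field;
    derivations extend by \<open>invariant_derivation\<close>.\<close>
  interpret augmented_char_p A1 "\<lambda>c _. c" "\<lambda>F. F \<one>" "CHAR('k)" "R ` T"
  proof unfold_locales
    show "prime CHAR('k)" by (rule prime_CHAR)
    show "CHAR('g \<Rightarrow> 'k) = CHAR('k)" by (rule CHAR_fun)
    show "finite (R ` T)" "R ` T \<subseteq> aug.I"
      using T(1,3) R_J by auto
    fix F :: "'g \<Rightarrow> 'k" assume "F ^ CHAR('k) = 0"
    then have "\<forall>x. F x ^ CHAR('k) = 0" by (metis power_fun_apply zero_fun_apply)
    then show "F = 0" by (simp add: fun_eq_iff)
  next
    fix B assume B: "B \<subseteq> A1" "range (\<lambda>c _. c) \<subseteq> B" "R ` T \<subseteq> B"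
      "\<And>x y. \<lbrakk>x \<in> B; y \<in> B\<rbrakk> \<Longrightarrow> x + y \<in> B" "\<And>x y. \<lbrakk>x \<in> B; y \<in> B\<rbrakk> \<Longrightarrow> x * y \<in> B"
    have "A \<subseteq> {f \<in> A. R f \<in> B}"
    proof (rule T(4))
      show "function_subalgebra (carrier G) {f \<in> A. R f \<in> B}"
        unfolding function_subalgebra_iff
      proof (intro conjI ballI allI impI)
        fix c :: 'k show "ext0 (carrier G) (\<lambda>_. c) \<in> {f \<in> A. R f \<in> B}"
          using A_const B(2) R_const by auto
      next
        fix f x assume "f \<in> {f \<in> A. R f \<in> B}" "x \<notin> carrier G"
        then show "f x = 0" using A_vanish by blast
      next
        fix f g assume "f \<in> {f \<in> A. R f \<in> B}" "g \<in> {f \<in> A. R f \<in> B}"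
        then show "f + g \<in> {f \<in> A. R f \<in> B}" "f * g \<in> {f \<in> A. R f \<in> B}"
          using A_add A_mult B(4,5) unfolding mem_Collect_eq R_add R_mult by blast+
      qed
      show "T \<subseteq> {f \<in> A. R f \<in> B}"
        using T(2) A0_A B(3) by blast
    qed
    then show "A1 \<subseteq> B" unfolding A1_def by blast
  next
    fix d :: "('g \<Rightarrow> 'k) \<Rightarrow> 'k"
    assume "\<And>x y. \<lbrakk>x \<in> A1; y \<in> A1\<rbrakk> \<Longrightarrow> d (x + y) = d x + d y"
      "\<And>c x. x \<in> A1 \<Longrightarrow> d ((\<lambda>_. c) * x) = c * d x"
      "\<And>x y. \<lbrakk>x \<in> A1; y \<in> A1\<rbrakk> \<Longrightarrow> d (x * y) = x \<one> * d y + y \<one> * d x"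
    then show "\<exists>D. (\<forall>x\<in>A1. D x \<in> A1 \<and> D x \<one> = d x) \<and>
        (\<forall>x\<in>A1. \<forall>y\<in>A1. D (x + y) = D x + D y \<and> D (x * y) = x * D y + y * D x)"
      by (rule invariant_derivation)
  qed
  let ?E = "ext0 (carrier G)"
  have E_A: "?E F \<in> A" and R_E: "R (?E F) = F" if "F \<in> A1" for F
    using that by (auto simp: A1_def ext0_R)
  have E_add: "?E (F + F') = ?E F + ?E F'" and E_mult: "?E (F * F') = ?E F * ?E F'" for F F' :: "'g \<Rightarrow> 'k"
    by (simp_all add: ext0_def fun_eq_iff)
  have "R f \<in> aug.P (CHAR('k) ^ t)"
  \<comment> \<open>The Frobenius map is conjugated with the isomorphism \<open>R\<close>, whose
    inverse on \<open>A1\<close> is truncation outside the group.\<close>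
  proof (rule frobenius_reflects_order[where \<phi> = "\<lambda>F. R (\<phi> s (?E F))"])
    fix F F' assume "F \<in> A1" "F' \<in> A1"
    then show "R (\<phi> s (?E (F + F'))) = R (\<phi> s (?E F)) + R (\<phi> s (?E F'))"
      "R (\<phi> s (?E (F * F'))) = R (\<phi> s (?E F)) * R (\<phi> s (?E F'))"
      using E_A by (simp_all only: E_add E_mult \<phi>_add R_add \<phi>_mult R_mult)
  next
    fix c
    have "?E (\<lambda>_. c) = scl c e" by (simp add: fun_eq_iff e_def ext0_def)
    then show "R (\<phi> s (?E (\<lambda>_. c))) = (\<lambda>_. c)"
      by (simp only: \<phi>_scl \<phi>_e) (simp add: R_def fun_eq_iff e_apply \<rho>_carrier)
  next
    fix F k assume F: "F \<in> aug.P k"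
    then have "?E F \<in> Pw k"
      unfolding Pw_iff using aug.P_A E_A R_E by simp
    then show "R (\<phi> s (?E F)) \<in> aug.P (k * CHAR('k) ^ s)"
      using \<phi>_Pw Pw_iff by blast
  next
    fix y assume "y \<in> R ` T"
    then obtain g where g: "g \<in> A\<^sub>0" "y = R g" using T(2) by blast
    show "R (\<phi> s (?E y)) = y ^ (CHAR('k) ^ s)"
      unfolding g(2) ext0_R[OF A0_A[OF g(1)]] \<phi>_A0[OF g(1)] R_power ..
  next
    show "R f \<in> A1" using f(1) by (rule R_A1)
    show "R (\<phi> s (?E (R f))) \<in> aug.P (CHAR('k) ^ (t + s))"
      unfolding ext0_R[OF f(1)] using f(2) Pw_iff by blast
  qed
  then show ?thesis
    unfolding Pw_iff using f(1) by blast
qed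

end

section \<open>Distributions\<close>

context group_with_form
begin

lemma dual_space_iff:
  "\<mu> \<in> dual_space A \<longleftrightarrow> (\<forall>f\<in>A. \<forall>g\<in>A. \<mu> (f + g) = \<mu> f + \<mu> g) \<and>
    (\<forall>f\<in>A. \<forall>c. \<mu> (scl c f) = c * \<mu> f) \<and> (\<forall>f. f \<notin> A \<longrightarrow> \<mu> f = 0)"
  by (simp add: dual_space_def linear_on_iff)

lemma dual_add: "\<lbrakk>\<mu> \<in> dual_space A; f \<in> A; g \<in> A\<rbrakk> \<Longrightarrow> \<mu> (f + g) = \<mu> f + \<mu> g"
  and dual_scl: "\<lbrakk>\<mu> \<in> dual_space A; f \<in> A\<rbrakk> \<Longrightarrow> \<mu> (scl c f) = c * \<mu> f"
  and dual_outside: "\<lbrakk>\<mu> \<in> dual_space A; f \<notin> A\<rbrakk> \<Longrightarrow> \<mu> f = 0"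
  unfolding dual_space_iff by blast+

lemma dual_0: "\<mu> \<in> dual_space A \<Longrightarrow> \<mu> 0 = 0"
  using dual_scl[of \<mu> 0 0] A_0 by simp

lemma dual_sum:
  "\<mu> \<in> dual_space A \<Longrightarrow> (\<And>i. i \<in> E \<Longrightarrow> f i \<in> A) \<Longrightarrow> \<mu> (sum f E) = (\<Sum>i\<in>E. \<mu> (f i))"
  by (induction E rule: infinite_finite_induct) (simp_all add: dual_0 dual_add A_sum)

lemma dual_diff: "\<lbrakk>\<mu> \<in> dual_space A; f \<in> A; g \<in> A\<rbrakk> \<Longrightarrow> \<mu> (f - g) = \<mu> f - \<mu> g"
  using dual_add[of \<mu> "f - g" g] A_diff by simp

lemma dual_eqI:
  assumes "\<mu> \<in> dual_space A" "\<nu> \<in> dual_space A" "\<And>f. f \<in> A\<^sub>0 \<Longrightarrow> \<mu> f = \<nu> f"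
  shows "\<mu> = \<nu>"
proof
  fix f
  show "\<mu> f = \<nu> f"
  proof (cases "f \<in> A")
    case True
    then show ?thesis
    proof (induction f rule: A_induct)
      case (scl c g)
      have "\<mu> (scl c g) = \<nu> (scl c g)"
        using assms scl A0_A by (simp only: dual_scl)
      then show ?case .
    next
      case (add f g)
      have "\<mu> (f + g) = \<nu> (f + g)"
        using assms(1,2) add by (simp only: dual_add)
      then show ?case .
    qed
  qed (simp add: dual_outside[OF assms(1)] dual_outside[OF assms(2)])
qed

lemma Dist_iff: "\<mu> \<in> Dist G A k \<longleftrightarrow> \<mu> \<in> dual_space A \<and> (\<forall>f\<in>Pw (Suc k). \<mu> f = 0)"
  by (simp add: Dist_def Pw_def)

lemma Dist_plus_iff:
  "\<mu> \<in> Dist_plus G A k \<longleftrightarrow> \<mu> \<in> dual_space A \<and> (\<forall>f\<in>Pw (Suc k). \<mu> f = 0) \<and> \<mu> e = 0"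
  by (simp add: Dist_plus_def Dist_iff coordinate_ring_simps)

lemma hue_space_iff:
  "\<mu> \<in> hue_space G A r \<longleftrightarrow> \<mu> \<in> dual_space A \<and> (\<forall>f\<in>Pw (CHAR('k) ^ (r + 1)). \<mu> f = 0) \<and> \<mu> e = 0"
  using q_pos[of "r + 1"] by (simp add: Dist_plus_iff)

text \<open>The transpose of \<open>\<phi> s\<close>, which serves as witness for the description
  \<open>frobenius_dist\<close>.\<close>

definition \<Xi> :: "nat \<Rightarrow> ('g, 'k) functional \<Rightarrow> ('g, 'k) functional" where
  "\<Xi> s \<delta> = ext0 A (\<lambda>f. \<delta> (\<phi> s f))"

lemma \<Xi>_apply: "f \<in> A \<Longrightarrow> \<Xi> s \<delta> f = \<delta> (\<phi> s f)"
  by (simp add: \<Xi>_def ext0_def)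

lemma \<Xi>_dual: "\<delta> \<in> dual_space A \<Longrightarrow> \<Xi> s \<delta> \<in> dual_space A"
  unfolding dual_space_iff[of "\<Xi> s \<delta>"]
  by (simp add: \<Xi>_apply A_add A_scl \<phi>_add \<phi>_scl \<phi>_A dual_add dual_scl) (simp add: \<Xi>_def ext0_def)

lemma frobenius_dist_eq:
  assumes "\<delta> \<in> dual_space A"
  shows "frobenius_dist A A\<^sub>0 s \<delta> = \<Xi> s \<delta>"
proof -
  have eq: "\<Xi> s \<delta> (scl a f) = \<delta> (scl a (f ^ (CHAR('k) ^ s)))" if "f \<in> A\<^sub>0" for f a
    using that A0_A A_scl by (simp add: \<Xi>_apply \<phi>_scl \<phi>_A0)
  have lam: "(\<lambda>x. a * f x) = scl a f" for a :: 'k and f :: "'g \<Rightarrow> 'k"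
    by (simp add: fun_eq_iff)
  have pow: "(\<lambda>x. f x ^ n) = f ^ n" for f :: "'g \<Rightarrow> 'k" and n
    by (simp add: fun_eq_iff)
  show ?thesis
    unfolding frobenius_dist_def lam pow
  proof (rule the_equality)
    show "\<Xi> s \<delta> \<in> dual_space A \<and>
        (\<forall>f\<in>A\<^sub>0. \<forall>a. \<Xi> s \<delta> (scl a f) = \<delta> (scl a (f ^ (CHAR('k) ^ s))))"
      using \<Xi>_dual[OF assms] eq by blast
  next
    fix \<eta> assume \<eta>: "\<eta> \<in> dual_space A \<and> (\<forall>f\<in>A\<^sub>0. \<forall>a. \<eta> (scl a f) = \<delta> (scl a (f ^ (CHAR('k) ^ s))))"
    show "\<eta> = \<Xi> s \<delta>"
    proof (rule dual_eqI)
      fix f assume f: "f \<in> A\<^sub>0"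
      then have "\<eta> (scl 1 f) = \<Xi> s \<delta> (scl 1 f)" using \<eta> eq by metis
      then show "\<eta> f = \<Xi> s \<delta> f" by (simp only: fun_vs.scale_one)
    qed (use \<eta> \<Xi>_dual[OF assms] in auto)
  qed
qed

text \<open>The Frobenius map multiplies orders of vanishing by \<open>p^s\<close>, so its transpose
  divides degrees. For the defining relations the bound is used with
  \<open>j = i div p^s\<close>.\<close>

lemma \<Xi>_Dist_plus:
  assumes "\<delta> \<in> Dist_plus G A i" "Suc i \<le> Suc j * CHAR('k) ^ s"
  shows "\<Xi> s \<delta> \<in> Dist_plus G A j"
  unfolding Dist_plus_iff
proof (intro conjI ballI)
  have \<delta>: "\<delta> \<in> dual_space A" "\<And>f. f \<in> Pw (Suc i) \<Longrightarrow> \<delta> f = 0" "\<delta> e = 0"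
    using assms(1) by (auto simp: Dist_plus_iff)
  show "\<Xi> s \<delta> \<in> dual_space A" by (rule \<Xi>_dual[OF \<delta>(1)])
  show "\<Xi> s \<delta> e = 0" using \<delta>(3) by (simp add: \<Xi>_apply e_A \<phi>_e)
  fix f assume f: "f \<in> Pw (Suc j)"
  then have "\<phi> s f \<in> Pw (Suc i)"
    using Pw_antimono[OF assms(2) \<phi>_Pw] by blast
  then show "\<Xi> s \<delta> f = 0" using \<delta>(2) Pw_A[OF f] by (simp add: \<Xi>_apply)
qed

lemma \<Xi>_hue_space:
  assumes "\<delta> \<in> hue_space G A r" "s \<le> r"
  shows "\<Xi> s \<delta> \<in> hue_space G A (r - s)"
proof (rule \<Xi>_Dist_plus[OF assms(1)])
  have "CHAR('k) ^ (r - s + 1) * CHAR('k) ^ s = CHAR('k) ^ (r + 1)"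
    unfolding power_add[symmetric] using assms(2) by simp
  then show "Suc (CHAR('k) ^ (r + 1) - 1) \<le> Suc (CHAR('k) ^ (r - s + 1) - 1) * CHAR('k) ^ s"
    by (simp only: Suc_diff_1[OF q_pos] order_refl)
qed

lemma functional_extension:
  fixes \<psi> :: "('g \<Rightarrow> 'k) \<Rightarrow> 'g \<Rightarrow> 'k"
  assumes W: "fun_vs.subspace W"
    and \<psi>: "\<And>f g. \<psi> (f + g) = \<psi> f + \<psi> g" "\<And>c f. \<psi> (scl c f) = scl c (\<psi> f)"
    and \<mu>: "\<mu> \<in> dual_space A" "\<And>f. \<lbrakk>f \<in> A; \<psi> f \<in> W\<rbrakk> \<Longrightarrow> \<mu> f = 0"
  shows "\<exists>\<delta>. (\<forall>f g. \<delta> (f + g) = \<delta> f + \<delta> g) \<and> (\<forall>c f. \<delta> (scl c f) = c * \<delta> f) \<and>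
    (\<forall>w\<in>W. \<delta> w = 0) \<and> (\<forall>f\<in>A. \<delta> (\<psi> f) = \<mu> f)"
proof -
  obtain C where C: "C \<subseteq> W" "fun_vs.independent C" "W \<subseteq> fun_vs.span C"
    using fun_vs.maximal_independent_subset by blast
  have "C \<subseteq> W \<union> \<psi> ` A" using C(1) by blast
  then obtain B where B: "C \<subseteq> B" "B \<subseteq> W \<union> \<psi> ` A" "fun_vs.independent B" "W \<union> \<psi> ` A \<subseteq> fun_vs.span B"
    using fun_vs.maximal_independent_subset_extend[OF _ C(2)] by metis
  define h where "h b = (SOME f. f \<in> A \<and> \<psi> f = b)" for b
  have h: "h b \<in> A" "\<psi> (h b) = b" if "b \<in> B" "b \<notin> W" for b
  proof -
    have "\<exists>f. f \<in> A \<and> \<psi> f = b" using that B(2) by blast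
    from someI_ex[OF this] show "h b \<in> A" "\<psi> (h b) = b" by (auto simp: h_def)
  qed
  define \<nu> where "\<nu> b = (if b \<in> W then 0 else \<mu> (h b))" for b
  define \<delta> where "\<delta> = fun_field.construct B \<nu>"
  interpret \<delta>: Vector_Spaces.linear scl "(*)" \<delta>
    unfolding \<delta>_def by (rule fun_field.linear_construct[OF B(3)])
  have basis: "\<delta> b = \<nu> b" if "b \<in> B" for b
    unfolding \<delta>_def using B(3) that by (rule fun_field.construct_basis)
  have \<delta>W: "\<delta> w = 0" if "w \<in> W" for w
  proof -
    have "w \<in> fun_vs.span C" using that C(3) by blast
    then show ?thesis
    proof (rule \<delta>.eq_0_on_span[rotated])
      fix b assume "b \<in> C"
      then have "b \<in> B" "b \<in> W" using B(1) C(1) by blast+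
      then show "\<delta> b = 0" by (simp add: basis \<nu>_def)
    qed
  qed
  have \<psi>_0: "\<psi> 0 = 0" using \<psi>(1)[of 0 0] by simp
  have \<psi>_sum: "\<psi> (\<Sum>b\<in>t. scl (u b) (h b)) = (\<Sum>b\<in>t. scl (u b) b)" if "finite t" "t \<subseteq> B - W" for t u
    using that
  proof (induction t rule: finite_induct)
    case (insert b t)
    then have b: "\<psi> (h b) = b" using h by blast
    have "\<psi> (\<Sum>b\<in>insert b t. scl (u b) (h b)) = scl (u b) (\<psi> (h b)) + \<psi> (\<Sum>b\<in>t. scl (u b) (h b))"
      using insert.hyps \<psi> by simp
    also have "\<psi> (\<Sum>b\<in>t. scl (u b) (h b)) = (\<Sum>b\<in>t. scl (u b) b)"
      using insert.IH insert.prems by blast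
    also have "scl (u b) (\<psi> (h b)) + (\<Sum>b\<in>t. scl (u b) b) = (\<Sum>b\<in>insert b t. scl (u b) b)"
      using insert.hyps by (simp add: b)
    finally show ?case .
  qed (simp add: \<psi>_0)
  have \<delta>\<psi>: "\<delta> (\<psi> f) = \<mu> f" if f: "f \<in> A" for f
  proof -
    have "\<psi> f \<in> fun_vs.span B" using B(4) f by blast
    then obtain t u where t: "finite t" "t \<subseteq> B" "\<psi> f = (\<Sum>b\<in>t. scl (u b) b)"
      unfolding fun_vs.span_explicit by blast
    \<comment> \<open>A preimage of the part of \<open>\<psi> f\<close> outside \<open>W\<close>.
      Then \<open>\<psi> (f - g)\<close> lies in \<open>W\<close>, and \<open>\<mu>\<close> does not
      distinguish \<open>f\<close> from \<open>g\<close>.\<close>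
    define g where "g = (\<Sum>b\<in>t - W. scl (u b) (h b))"
    have hA: "h b \<in> A" if "b \<in> t - W" for b using h t(2) that by blast
    have g_A: "g \<in> A" unfolding g_def by (intro A_sum A_scl hA)
    have split: "\<psi> f = (\<Sum>b\<in>t \<inter> W. scl (u b) b) + \<psi> g"
    proof -
      have "\<psi> g = (\<Sum>b\<in>t - W. scl (u b) b)"
        unfolding g_def using t by (intro \<psi>_sum) auto
      moreover have "\<psi> f = (\<Sum>b\<in>t \<inter> W. scl (u b) b) + (\<Sum>b\<in>t - W. scl (u b) b)"
        unfolding t(3) using t(1) by (rule sum.Int_Diff)
      ultimately show ?thesis by simp
    qed
    have W_sum: "(\<Sum>b\<in>t \<inter> W. scl (u b) b) \<in> W"
      using W by (intro fun_vs.subspace_sum fun_vs.subspace_scale) auto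
    have "f = (f - g) + g" by simp
    then have "\<psi> f = \<psi> (f - g) + \<psi> g" using \<psi>(1) by metis
    then have "\<psi> (f - g) \<in> W" using split W_sum by simp
    then have "\<mu> (f - g) = 0" using \<mu>(2) A_diff f g_A by blast
    then have "\<mu> f = \<mu> g" using dual_diff[OF \<mu>(1) f g_A] by simp
    also have "\<dots> = (\<Sum>b\<in>t - W. u b * \<mu> (h b))"
      unfolding g_def using hA by (subst dual_sum[OF \<mu>(1)]) (auto simp: dual_scl[OF \<mu>(1)] A_scl)
    also have "\<dots> = \<delta> (\<psi> g)"
    proof -
      have "\<psi> g = (\<Sum>b\<in>t - W. scl (u b) b)"
        unfolding g_def using t by (intro \<psi>_sum) auto
      then show ?thesis
        using basis t(2) by (auto simp: \<delta>.sum \<delta>.scale \<nu>_def intro!: sum.cong)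
    qed
    also have "\<dots> = \<delta> (\<psi> f)"
      unfolding split \<delta>.add by (simp add: \<delta>W[OF W_sum])
    finally show ?thesis ..
  qed
  show ?thesis
    using \<delta>W \<delta>\<psi> by (intro exI[of _ \<delta>]) (auto simp: \<delta>.add \<delta>.scale)
qed

text \<open>A functional must be extended from the image of \<open>\<phi> s\<close> to one that
  kills \<open>J\<close> to the power \<open>p^(r+1)\<close>. The compatibility condition for this
  is \<open>frobenius_reflects_Pw\<close> with \<open>t = r - s + 1\<close>.\<close>

lemma \<Xi>_surj:
  assumes \<mu>: "\<mu> \<in> hue_space G A (r - s)" and "s \<le> r"
  shows "\<exists>\<delta>\<in>hue_space G A r. \<Xi> s \<delta> = \<mu>"
proof -
  let ?W = "Pw (CHAR('k) ^ (r + 1))"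
  have *: "\<mu> \<in> dual_space A" "\<And>f. f \<in> Pw (CHAR('k) ^ (r - s + 1)) \<Longrightarrow> \<mu> f = 0" "\<mu> e = 0"
    using \<mu> unfolding hue_space_iff by blast+
  have "\<mu> f = 0" if "f \<in> A" "\<phi> s f \<in> ?W" for f
    using frobenius_reflects_Pw[of f s "r - s + 1"] that *(2) assms(2) by simp
  then obtain \<delta> where \<delta>: "\<And>f g. \<delta> (f + g) = \<delta> f + \<delta> g" "\<And>c f. \<delta> (scl c f) = c * \<delta> f"
    "\<And>w. w \<in> ?W \<Longrightarrow> \<delta> w = 0" "\<And>f. f \<in> A \<Longrightarrow> \<delta> (\<phi> s f) = \<mu> f"
    using functional_extension[where W = ?W and \<psi> = "\<phi> s", OF subspace_Pw \<phi>_add \<phi>_scl *(1)] by metis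
  let ?\<delta> = "ext0 A \<delta>"
  have apply_\<delta>: "?\<delta> f = \<delta> f" if "f \<in> A" for f
    using that by (simp add: ext0_def)
  have "\<delta> e = 0" using \<delta>(4)[OF e_A] *(3) by (simp add: \<phi>_e)
  moreover have "?\<delta> \<in> dual_space A"
    unfolding dual_space_iff by (simp add: apply_\<delta> A_add A_scl \<delta>(1,2)) (simp add: ext0_def)
  ultimately have "?\<delta> \<in> hue_space G A r"
    unfolding hue_space_iff using \<delta>(3) apply_\<delta> Pw_A e_A by simp
  moreover have "\<Xi> s ?\<delta> = \<mu>"
  proof (rule ext)
    fix f show "\<Xi> s ?\<delta> f = \<mu> f"
      by (cases "f \<in> A") (simp_all add: \<Xi>_apply \<phi>_A apply_\<delta> \<delta>(4) dual_outside[OF *(1)], simp add: \<Xi>_def ext0_def)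
  qed
  ultimately show ?thesis by blast
qed

section \<open>The comultiplication and the filtration on functions of two variables\<close>

definition ten :: "('g \<Rightarrow> 'k) \<Rightarrow> ('g \<Rightarrow> 'k) \<Rightarrow> 'g \<times> 'g \<Rightarrow> 'k" where
  "ten f g = (\<lambda>(x, y). f x * g y)"

text \<open>\<open>TF k\<close> is the sum of the \<open>J\<^sup>a \<otimes> J\<^sup>b\<close> with \<open>a + b \<ge> k\<close>, as a space of functions of two variables.\<close>

definition TF :: "nat \<Rightarrow> ('g \<times> 'g \<Rightarrow> 'k) set" where
  "TF k = combos {1} {ten f g | f g a b. f \<in> Pw a \<and> g \<in> Pw b \<and> k \<le> a + b}"

lemma TF_induct [consumes 1, case_names zero step]:
  assumes "F \<in> TF k" "Q 0"
    "\<And>f g a b F. \<lbrakk>f \<in> Pw a; g \<in> Pw b; k \<le> a + b; F \<in> TF k; Q F\<rbrakk> \<Longrightarrow> Q (ten f g + F)"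
  shows "Q F"
proof -
  have "F \<in> combos {1} {ten f g | f g a b. f \<in> Pw a \<and> g \<in> Pw b \<and> k \<le> a + b}"
    using assms(1) by (simp add: TF_def)
  then have "F \<in> TF k \<and> Q F"
  proof induction
    case combos_0
    have "0 \<in> TF k \<and> Q 0" using assms(2) unfolding TF_def by (blast intro: combos.combos_0)
    then show ?case .
  next
    case (combos_step c s F)
    then obtain f g a b where *: "c = 1" "s = ten f g" "f \<in> Pw a" "g \<in> Pw b" "k \<le> a + b" by blast
    have "ten f g + F \<in> TF k"
      using combos_step combos.combos_step[of c "{1}" s _ F] unfolding TF_def * by auto
    moreover have "Q (ten f g + F)"
      using assms(3) * combos_step.IH by blast
    ultimately show ?case by (simp only: * mult_1_left)
  qed
  then show ?thesis ..
qed

lemma TF_0: "0 \<in> TF k" and TF_add: "\<lbrakk>F \<in> TF k; F' \<in> TF k\<rbrakk> \<Longrightarrow> F + F' \<in> TF k"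
  by (simp_all add: TF_def combos_0 combos_add)

lemma TF_sum: "(\<And>i. i \<in> E \<Longrightarrow> F i \<in> TF k) \<Longrightarrow> sum F E \<in> TF k"
  unfolding TF_def by (rule combos_sum)

lemma TF_ten:
  assumes "f \<in> Pw a" "g \<in> Pw b" "k \<le> a + b" shows "ten f g \<in> TF k"
proof -
  have "ten f g \<in> {ten f g | f g a b. f \<in> Pw a \<and> g \<in> Pw b \<and> k \<le> a + b}"
    using assms by blast
  then have "1 * ten f g \<in> TF k"
    unfolding TF_def by (rule combos_gen[OF singletonI])
  then show ?thesis by (simp only: mult_1_left)
qed

lemma TF_antimono: "j \<le> k \<Longrightarrow> TF k \<subseteq> TF j"
  unfolding TF_def by (rule combos_mono) (blast intro: le_trans)+

lemma TF_mult:
  assumes "F \<in> TF j" "F' \<in> TF k" shows "F * F' \<in> TF (j + k)"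
  unfolding TF_def
proof (rule combos_mult2[OF assms[unfolded TF_def]])
  fix c s c' s'
  assume c: "c \<in> {1 :: 'g \<times> 'g \<Rightarrow> 'k}" "c' \<in> {1 :: 'g \<times> 'g \<Rightarrow> 'k}"
    and "s \<in> {ten f g | f g a b. f \<in> Pw a \<and> g \<in> Pw b \<and> j \<le> a + b}"
    "s' \<in> {ten f g | f g a b. f \<in> Pw a \<and> g \<in> Pw b \<and> k \<le> a + b}"
  then obtain f g a b f' g' a' b' where
    *: "s = ten f g" "f \<in> Pw a" "g \<in> Pw b" "j \<le> a + b" "s' = ten f' g'" "f' \<in> Pw a'" "g' \<in> Pw b'" "k \<le> a' + b'"
    by blast
  have "ten f g * ten f' g' = ten (f * f') (g * g')"
    by (simp add: ten_def fun_eq_iff)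
  moreover have "ten (f * f') (g * g') \<in> TF (j + k)"
    using * by (intro TF_ten[OF Pw_mult_Pw Pw_mult_Pw]) auto
  moreover have "c * s * (c' * s') = ten f g * ten f' g'"
    using c by (simp add: *)
  ultimately show "c * s * (c' * s') \<in> combos {1} {ten f g |f g a b. f \<in> Pw a \<and> g \<in> Pw b \<and> j + k \<le> a + b}"
    unfolding TF_def by (simp only:)
qed

definition flip :: "('g \<times> 'g \<Rightarrow> 'k) \<Rightarrow> 'g \<times> 'g \<Rightarrow> 'k" where
  "flip F = (\<lambda>(x, y). F (y, x))"

lemma flip_add: "flip (F + F') = flip F + flip F'" and flip_mult: "flip (F * F') = flip F * flip F'"
  and flip_ten: "flip (ten f g) = ten g f" and flip_0: "flip 0 = 0" and flip_diff: "flip (F - F') = flip F - flip F'"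
  by (auto simp: flip_def ten_def fun_eq_iff)

lemma flip_TF: "F \<in> TF k \<Longrightarrow> flip F \<in> TF k"
proof (induction rule: TF_induct)
  case zero
  show ?case unfolding flip_0 by (rule TF_0)
next
  case (step f g a b F)
  have "ten g f + flip F \<in> TF k"
    using step(3) by (intro TF_add TF_ten[OF step(2,1)] step.IH) simp
  then show ?case by (simp only: flip_add flip_ten)
qed

lemma TF_uminus: "F \<in> TF k \<Longrightarrow> - F \<in> TF k"
proof (induction rule: TF_induct)
  case zero
  show ?case unfolding minus_zero by (rule TF_0)
next
  case (step f g a b F)
  have "ten (scl (- 1) f) g + - F \<in> TF k"
    using step by (intro TF_add TF_ten Pw_scl)
  moreover have "ten (scl (- 1) f) g + - F = - (ten f g + F)"
    by (simp add: fun_eq_iff ten_def)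
  ultimately show ?case by (simp only:)
qed

lemma TF_diff: "\<lbrakk>F \<in> TF k; F' \<in> TF k\<rbrakk> \<Longrightarrow> F - F' \<in> TF k"
  using TF_add[OF _ TF_uminus, of F k F'] by simp

definition \<Delta> :: "('g \<Rightarrow> 'k) \<Rightarrow> 'g \<times> 'g \<Rightarrow> 'k" where
  "\<Delta> f = (\<lambda>(x, y). if x \<in> carrier G \<and> y \<in> carrier G then f (x \<otimes> y) else 0)"

lemma \<Delta>_add: "\<Delta> (f + g) = \<Delta> f + \<Delta> g" and \<Delta>_mult: "\<Delta> (f * g) = \<Delta> f * \<Delta> g"
  and \<Delta>_scl: "\<Delta> (scl c f) = scl c (\<Delta> f)" and \<Delta>_0: "\<Delta> 0 = 0"
  and \<Delta>_power: "n > 0 \<Longrightarrow> \<Delta> (f ^ n) = \<Delta> f ^ n"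
  by (auto simp: \<Delta>_def fun_eq_iff zero_power)

lemma \<Delta>_e: "\<Delta> e = ten e e"
  by (auto simp: \<Delta>_def ten_def fun_eq_iff e_apply)

lemma \<Delta>_expand:
  assumes "in_tensor_square (carrier G) B (\<lambda>x y. f (x \<otimes> y))" "B \<subseteq> A"
  obtains n :: nat and g h where "\<And>i. i < n \<Longrightarrow> g i \<in> B" "\<And>i. i < n \<Longrightarrow> h i \<in> B"
    "\<Delta> f = (\<Sum>i<n. ten (g i) (h i))"
proof -
  obtain n :: nat and g h where *: "\<forall>i<n. g i \<in> B \<and> h i \<in> B"
    "\<forall>x\<in>carrier G. \<forall>y\<in>carrier G. f (x \<otimes> y) = (\<Sum>i<n. g i x * h i y)"
    using assms(1) unfolding in_tensor_square_def by blast
  have "\<Delta> f (x, y) = (\<Sum>i<n. ten (g i) (h i)) (x, y)" for x y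
  proof (cases "x \<in> carrier G \<and> y \<in> carrier G")
    case True
    then show ?thesis using *(2) by (simp add: \<Delta>_def ten_def)
  next
    case False
    have "g i x * h i y = 0" if "i < n" for i
      using *(1) that assms(2) False A_vanish[of "g i" x] A_vanish[of "h i" y] by auto
    then have "(\<Sum>i<n. g i x * h i y) = 0" by (intro sum.neutral) blast
    then show ?thesis using False by (auto simp: \<Delta>_def ten_def)
  qed
  then have "\<Delta> f = (\<Sum>i<n. ten (g i) (h i))" by (intro ext) (simp only: split_paired_all)
  with *(1) show ?thesis by (intro that[of n g h]) blast+
qed

lemma ten_sum_left: "ten (sum f E) g = (\<Sum>i\<in>E. ten (f i) g)" and ten_sum_right: "ten g (sum f E) = (\<Sum>i\<in>E. ten g (f i))"
  by (auto simp: ten_def fun_eq_iff sum_distrib_right sum_distrib_left)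

text \<open>Write the comultiplication of \<open>f\<close> as a sum of tensors and subtract from
  each factor its value at the identity. By the counit laws the corrections add up to
  \<open>ten f e\<close> and \<open>ten e f\<close>, and the remaining constant is
  \<open>f \<one> = 0\<close>.\<close>

lemma \<Delta>_primitive:
  assumes f: "f \<in> J" shows "\<Delta> f - ten f e - ten e f \<in> TF 2"
proof -
  have f_A: "f \<in> A" and f_one: "f \<one> = 0" using f by (auto simp: augmentation_ideal_def)
  obtain n :: nat and g h where *: "\<And>i. i < n \<Longrightarrow> g i \<in> A" "\<And>i. i < n \<Longrightarrow> h i \<in> A"
    "\<Delta> f = (\<Sum>i<n. ten (g i) (h i))"
    using \<Delta>_expand[OF comult[OF f_A] order_refl] by blast
  have left: "(\<Sum>i<n. scl (g i \<one>) (h i)) = f"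
  proof
    fix y
    have "(\<Sum>i<n. scl (g i \<one>) (h i)) y = \<Delta> f (\<one>, y)"
      by (simp add: *(3) ten_def)
    also have "\<dots> = f y" using A_vanish[OF f_A, of y] by (auto simp: \<Delta>_def)
    finally show "(\<Sum>i<n. scl (g i \<one>) (h i)) y = f y" .
  qed
  have right: "(\<Sum>i<n. scl (h i \<one>) (g i)) = f"
  proof
    fix x
    have "(\<Sum>i<n. scl (h i \<one>) (g i)) x = \<Delta> f (x, \<one>)"
      by (simp add: *(3) ten_def mult.commute)
    also have "\<dots> = f x" using A_vanish[OF f_A, of x] by (auto simp: \<Delta>_def)
    finally show "(\<Sum>i<n. scl (h i \<one>) (g i)) x = f x" .
  qed
  let ?g = "\<lambda>i. g i - scl (g i \<one>) e" and ?h = "\<lambda>i. h i - scl (h i \<one>) e"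
  have "(\<Sum>i<n. g i \<one> * h i \<one>) = 0"
    using fun_cong[OF left, of \<one>] f_one by simp
  then have zero: "(\<Sum>i<n. scl (g i \<one> * h i \<one>) (ten e e)) = 0"
    by (simp only: fun_vs.scale_sum_left[symmetric] fun_vs.scale_zero_left)
  have expand: "ten (f - scl a e) (h - scl b e) =
      ten f h - ten (scl b f) e - ten e (scl a h) + scl (a * b) (ten e e)" for f h a b
    by (simp only: fun_eq_iff split_paired_all ten_def prod.case minus_apply plus_fun_apply scl_apply)
      (simp add: algebra_simps)
  have "(\<Sum>i<n. ten (?g i) (?h i)) =
      (\<Sum>i<n. ten (g i) (h i)) - ten (\<Sum>i<n. scl (h i \<one>) (g i)) e - ten e (\<Sum>i<n. scl (g i \<one>) (h i)) +
      (\<Sum>i<n. scl (g i \<one> * h i \<one>) (ten e e))"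
    unfolding ten_sum_left ten_sum_right expand sum_subtractf sum.distrib ..
  also have "\<dots> = \<Delta> f - ten f e - ten e f"
    unfolding left right zero *(3) by simp
  finally have "\<Delta> f - ten f e - ten e f = (\<Sum>i<n. ten (?g i) (?h i))" ..
  also have "\<dots> \<in> TF 2"
  proof (rule TF_sum)
    fix i assume "i \<in> {..<n}"
    then have "?g i \<in> Pw (Suc 0)" "?h i \<in> Pw (Suc 0)"
      using * minus_const_J by (simp_all add: Pw_1)
    then show "ten (?g i) (?h i) \<in> TF 2" by (rule TF_ten) simp
  qed
  finally show ?thesis .
qed

lemma \<Delta>_TF_1: "f \<in> J \<Longrightarrow> \<Delta> f \<in> TF 1"
proof -
  assume f: "f \<in> J"
  have e: "e \<in> Pw 0" by (simp add: Pw_0 e_A)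
  have f1: "f \<in> Pw (Suc 0)" using f by (simp add: Pw_1)
  have "\<Delta> f - ten f e - ten e f \<in> TF 1"
    using \<Delta>_primitive[OF f] TF_antimono[of 1 2] by auto
  moreover have "ten f e \<in> TF 1" "ten e f \<in> TF 1"
    by (rule TF_ten[OF f1 e] TF_ten[OF e f1], simp)+
  ultimately have "(\<Delta> f - ten f e - ten e f) + ten f e + ten e f \<in> TF 1"
    by (intro TF_add)
  then show ?thesis by simp
qed

lemma \<Delta>_flip_TF_2: "f \<in> J \<Longrightarrow> \<Delta> f - flip (\<Delta> f) \<in> TF 2"
proof -
  assume f: "f \<in> J"
  let ?d = "\<Delta> f - ten f e - ten e f"
  have "?d - flip ?d \<in> TF 2"
    by (rule TF_diff[OF \<Delta>_primitive[OF f] flip_TF[OF \<Delta>_primitive[OF f]]])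
  moreover have "?d - flip ?d = \<Delta> f - flip (\<Delta> f)"
    by (simp add: flip_diff flip_ten)
  ultimately show ?thesis by simp
qed

text \<open>To leading order the comultiplication is symmetric, so its antisymmetric part gains one
  order. The gain is propagated by the product rule for
  \<open>\<Delta> (f * g) - flip (\<Delta> (f * g))\<close>, and it is the source of the degree drop
  of commutators.\<close>

lemma \<Delta>_TF:
  "f \<in> Pw k \<Longrightarrow> \<Delta> f \<in> TF k \<and> \<Delta> f - flip (\<Delta> f) \<in> TF (if k = 0 then 0 else Suc k)"
proof (induction k arbitrary: f)
  case 0
  then have "f \<in> A" by (simp add: Pw_0)
  then obtain n :: nat and g h where *: "\<And>i. i < n \<Longrightarrow> g i \<in> A" "\<And>i. i < n \<Longrightarrow> h i \<in> A"
    "\<Delta> f = (\<Sum>i<n. ten (g i) (h i))"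
    using \<Delta>_expand[OF comult[OF \<open>f \<in> A\<close>] order_refl] by blast
  have "\<Delta> f \<in> TF 0"
    unfolding *(3)
  proof (rule TF_sum)
    fix i assume "i \<in> {..<n}"
    then have "g i \<in> Pw 0" "h i \<in> Pw 0" using * by (auto simp: Pw_0)
    then show "ten (g i) (h i) \<in> TF 0" by (rule TF_ten) simp
  qed
  then have "\<Delta> f \<in> TF 0 \<and> \<Delta> f - flip (\<Delta> f) \<in> TF 0"
    using TF_diff flip_TF by blast
  then have "\<Delta> f \<in> TF 0 \<and> \<Delta> f - flip (\<Delta> f) \<in> TF (if (0::nat) = 0 then 0 else Suc 0)"
    by (simp only: if_True refl)
  then show ?case .
next
  case (Suc k)
  let ?S = "{f. \<Delta> f \<in> TF (Suc k) \<and> \<Delta> f - flip (\<Delta> f) \<in> TF (Suc (Suc k))}"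
  have "combos (Pw k) J \<subseteq> ?S"
  proof (rule combos_subset)
    show "0 \<in> ?S" by (simp add: \<Delta>_0 flip_0 TF_0)
  next
    fix f g assume "f \<in> ?S" "g \<in> ?S"
    then have "\<Delta> f + \<Delta> g \<in> TF (Suc k)"
      "(\<Delta> f - flip (\<Delta> f)) + (\<Delta> g - flip (\<Delta> g)) \<in> TF (Suc (Suc k))"
      by (auto intro: TF_add)
    moreover have "(\<Delta> f - flip (\<Delta> f)) + (\<Delta> g - flip (\<Delta> g)) = \<Delta> (f + g) - flip (\<Delta> (f + g))"
      by (simp add: \<Delta>_add flip_add)
    ultimately show "f + g \<in> ?S" by (simp add: \<Delta>_add)
  next
    fix f g assume f: "f \<in> Pw k" and g: "g \<in> J"
    have 1: "\<Delta> f * \<Delta> g \<in> TF (k + 1)"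
      using Suc.IH[OF f] \<Delta>_TF_1[OF g] by (intro TF_mult) auto
    have "\<Delta> f * (\<Delta> g - flip (\<Delta> g)) \<in> TF (k + 2)"
      using Suc.IH[OF f] \<Delta>_flip_TF_2[OF g] by (intro TF_mult) auto
    moreover have "(\<Delta> f - flip (\<Delta> f)) * flip (\<Delta> g) \<in> TF (Suc (Suc k))"
    proof (cases "k = 0")
      case False
      have "\<Delta> f - flip (\<Delta> f) \<in> TF (if k = 0 then 0 else Suc k)"
        using Suc.IH[OF f] by blast
      then have "\<Delta> f - flip (\<Delta> f) \<in> TF (Suc k)"
        using False by (simp only: if_False)
      then have "(\<Delta> f - flip (\<Delta> f)) * flip (\<Delta> g) \<in> TF (Suc k + 1)"
        using flip_TF[OF \<Delta>_TF_1[OF g]] by (rule TF_mult)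
      then show ?thesis by simp
    next
      \<comment> \<open>The induction hypothesis gives no gain for \<open>k = 0\<close>. But the
        antisymmetric part does not see constants, so \<open>f\<close> can be replaced by an element
        of \<open>J\<close>.\<close>
      case True
      then have "f \<in> A" using f by (simp add: Pw_0)
      let ?f = "f - scl (f \<one>) e"
      have "?f \<in> J" using \<open>f \<in> A\<close> by (rule minus_const_J)
      then have "(\<Delta> ?f - flip (\<Delta> ?f)) * flip (\<Delta> g) \<in> TF (2 + 1)"
        using \<Delta>_flip_TF_2 flip_TF[OF \<Delta>_TF_1[OF g]] by (intro TF_mult)
      moreover have "\<Delta> f - flip (\<Delta> f) = \<Delta> ?f - flip (\<Delta> ?f)"
      proof -
        have "f = ?f + scl (f \<one>) e" by simp
        then have "\<Delta> f = \<Delta> ?f + scl (f \<one>) (ten e e)" by (metis \<Delta>_add \<Delta>_scl \<Delta>_e)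
        moreover have "flip (scl c (ten e e)) = scl c (ten e e)" for c
          by (auto simp: flip_def ten_def fun_eq_iff)
        ultimately show ?thesis by (simp add: flip_add)
      qed
      ultimately have "(\<Delta> f - flip (\<Delta> f)) * flip (\<Delta> g) \<in> TF 3" by simp
      then have "(\<Delta> f - flip (\<Delta> f)) * flip (\<Delta> g) \<in> TF 2"
        using TF_antimono[of 2 3] by auto
      then show ?thesis using True by (simp only: numeral_2_eq_2)
    qed
    ultimately have "\<Delta> f * (\<Delta> g - flip (\<Delta> g)) + (\<Delta> f - flip (\<Delta> f)) * flip (\<Delta> g) \<in> TF (Suc (Suc k))"
      by (intro TF_add) simp_all
    moreover have "\<Delta> f * (\<Delta> g - flip (\<Delta> g)) + (\<Delta> f - flip (\<Delta> f)) * flip (\<Delta> g) =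
        \<Delta> (f * g) - flip (\<Delta> (f * g))"
      by (simp add: \<Delta>_mult flip_mult algebra_simps)
    ultimately show "f * g \<in> ?S"
      using 1 by (simp add: \<Delta>_mult)
  qed
  then have "f \<in> ?S" using Suc.prems unfolding Pw_Suc by blast
  then have "\<Delta> f \<in> TF (Suc k) \<and> \<Delta> f - flip (\<Delta> f) \<in> TF (if Suc k = 0 then 0 else Suc (Suc k))"
    by (simp only: mem_Collect_eq nat.distinct if_False)
  then show ?case .
qed

section \<open>Products and commutators of distributions\<close>

definition T2 :: "('g, 'k) functional \<Rightarrow> ('g, 'k) functional \<Rightarrow> ('g \<times> 'g \<Rightarrow> 'k) \<Rightarrow> 'k" where
  "T2 \<mu> \<nu> F = \<mu> (\<lambda>x. \<nu> (\<lambda>y. F (x, y)))"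

lemma T2_ten:
  assumes "\<mu> \<in> dual_space A" "\<nu> \<in> dual_space A" "f \<in> A" "g \<in> A"
  shows "T2 \<mu> \<nu> (ten f g) = \<mu> f * \<nu> g"
proof -
  have "(\<lambda>x. \<nu> (\<lambda>y. ten f g (x, y))) = (\<lambda>x. \<nu> (scl (f x) g))"
    by (simp add: ten_def scl_def)
  also have "\<dots> = scl (\<nu> g) f"
    using assms by (simp add: dual_scl fun_eq_iff mult.commute)
  finally show ?thesis
    using assms by (simp add: T2_def dual_scl mult.commute)
qed

lemma TF_section:
  assumes "\<nu> \<in> dual_space A" "F \<in> TF 0"
  shows "(\<forall>x. (\<lambda>y. F (x, y)) \<in> A) \<and> (\<forall>x. x \<notin> carrier G \<longrightarrow> (\<lambda>y. F (x, y)) = 0) \<and> (\<lambda>x. \<nu> (\<lambda>y. F (x, y))) \<in> A"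
  using assms(2)
proof (induction rule: TF_induct)
  case zero
  then show ?case
    using A_0 dual_0[OF assms(1)] by (simp add: zero_fun_def)
next
  case (step f g a b F)
  have fg: "f \<in> A" "g \<in> A" using step Pw_A by auto
  have sec: "(\<lambda>y. (ten f g + F) (x, y)) = scl (f x) g + (\<lambda>y. F (x, y))" for x
    by (simp add: fun_eq_iff ten_def)
  have "(\<lambda>x. \<nu> (scl (f x) g + (\<lambda>y. F (x, y)))) = scl (\<nu> g) f + (\<lambda>x. \<nu> (\<lambda>y. F (x, y)))"
    using step.IH fg A_scl
    by (simp add: dual_add[OF assms(1)] dual_scl[OF assms(1)] fun_eq_iff mult.commute)
  also have "\<dots> \<in> A"
    using step.IH fg by (intro A_add A_scl) auto
  finally have "(\<lambda>x. \<nu> (scl (f x) g + (\<lambda>y. F (x, y)))) \<in> A" .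
  moreover have "scl (f x) g + (\<lambda>y. F (x, y)) \<in> A" for x
    using step.IH fg by (intro A_add A_scl) auto
  moreover have "scl (f x) g + (\<lambda>y. F (x, y)) = 0" if "x \<notin> carrier G" for x
  proof -
    have "F (x, y) = 0" for y using step.IH that by (metis zero_fun_apply)
    then show ?thesis using A_vanish[OF fg(1) that] by (simp add: fun_eq_iff)
  qed
  ultimately show ?case unfolding sec by blast
qed

lemma T2_add:
  assumes "\<mu> \<in> dual_space A" "\<nu> \<in> dual_space A" "F \<in> TF 0" "F' \<in> TF 0"
  shows "T2 \<mu> \<nu> (F + F') = T2 \<mu> \<nu> F + T2 \<mu> \<nu> F'"
proof -
  have "(\<lambda>x. \<nu> (\<lambda>y. (F + F') (x, y))) = (\<lambda>x. \<nu> ((\<lambda>y. F (x, y)) + (\<lambda>y. F' (x, y))))"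
    by (simp add: plus_fun_def)
  also have "\<dots> = (\<lambda>x. \<nu> (\<lambda>y. F (x, y))) + (\<lambda>x. \<nu> (\<lambda>y. F' (x, y)))"
    using TF_section[OF assms(2,3)] TF_section[OF assms(2,4)]
    by (simp add: dual_add[OF assms(2)] fun_eq_iff)
  finally show ?thesis
    using TF_section[OF assms(2,3)] TF_section[OF assms(2,4)] assms(1)
    by (simp add: T2_def dual_add)
qed

lemma T2_0: "\<lbrakk>\<mu> \<in> dual_space A; \<nu> \<in> dual_space A\<rbrakk> \<Longrightarrow> T2 \<mu> \<nu> 0 = 0"
  using T2_add[OF _ _ TF_0 TF_0, of \<mu> \<nu>] unfolding add_0_left by (metis add_cancel_right_right)

lemma TF_TF_0: "F \<in> TF k \<Longrightarrow> F \<in> TF 0"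
  using TF_antimono[of 0 k] by blast

text \<open>If \<open>a + b > i + j\<close> then \<open>a > i\<close> or \<open>b > j\<close>, so
  one factor of \<open>\<mu> f * \<nu> g\<close> vanishes on each generator of
  \<open>TF k\<close>.\<close>

lemma T2_vanish:
  assumes "\<mu> \<in> Dist G A i" "\<nu> \<in> Dist G A j" "F \<in> TF k" "i + j < k"
  shows "T2 \<mu> \<nu> F = 0"
  using assms(3)
proof (induction rule: TF_induct)
  case zero
  have "T2 \<mu> \<nu> 0 = 0" using assms(1,2) T2_0 by (simp add: Dist_iff)
  then show ?case .
next
  case (step f g a b F)
  have d: "\<mu> \<in> dual_space A" "\<nu> \<in> dual_space A"
    and v: "\<And>f. f \<in> Pw (Suc i) \<Longrightarrow> \<mu> f = 0" "\<And>f. f \<in> Pw (Suc j) \<Longrightarrow> \<nu> f = 0"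
    using assms(1,2) by (auto simp: Dist_iff)
  have "Suc i \<le> a \<or> Suc j \<le> b" using step(3) assms(4) by auto
  then have "\<mu> f * \<nu> g = 0"
    using v Pw_antimono step(1,2) by (metis mult_eq_0_iff)
  moreover have "ten f g \<in> TF 0" using TF_ten[OF step(1,2)] by simp
  ultimately have "T2 \<mu> \<nu> (ten f g + F) = 0"
    using T2_add[OF d _ TF_TF_0[OF step(4)]] T2_ten[OF d] Pw_A step by simp
  then show ?case .
qed

lemma T2_flip:
  assumes d: "\<mu> \<in> dual_space A" "\<nu> \<in> dual_space A" and "F \<in> TF 0"
  shows "T2 \<mu> \<nu> (flip F) = T2 \<nu> \<mu> F"
  using assms(3)
proof (induction rule: TF_induct)
  case zero
  have "T2 \<mu> \<nu> (flip 0) = T2 \<nu> \<mu> 0" unfolding flip_0 using d by (simp add: T2_0)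
  then show ?case .
next
  case (step f g a b F)
  have fg: "f \<in> A" "g \<in> A" using step Pw_A by auto
  have t: "ten f g \<in> TF 0" "ten g f \<in> TF 0"
    using TF_ten[OF step(1,2)] TF_ten[OF step(2,1)] by simp_all
  have "T2 \<mu> \<nu> (flip (ten f g + F)) = T2 \<mu> \<nu> (ten g f) + T2 \<mu> \<nu> (flip F)"
    unfolding flip_add flip_ten using d t flip_TF[OF step(4)] by (intro T2_add)
  also have "\<dots> = T2 \<nu> \<mu> (ten f g) + T2 \<nu> \<mu> F"
    using d fg step.IH by (simp add: T2_ten mult.commute)
  also have "\<dots> = T2 \<nu> \<mu> (ten f g + F)"
    using d t step(4) by (intro T2_add[symmetric])
  finally show ?case .
qed

lemma T2_scl:
  assumes "\<mu> \<in> dual_space A" "\<nu> \<in> dual_space A" "F \<in> TF 0"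
  shows "T2 \<mu> \<nu> (scl c F) = c * T2 \<mu> \<nu> F"
proof -
  have "(\<lambda>x. \<nu> (\<lambda>y. scl c F (x, y))) = (\<lambda>x. \<nu> (scl c (\<lambda>y. F (x, y))))"
    by (simp add: scl_def)
  also have "\<dots> = scl c (\<lambda>x. \<nu> (\<lambda>y. F (x, y)))"
    using TF_section[OF assms(2,3)] by (simp add: dual_scl[OF assms(2)] fun_eq_iff)
  finally show ?thesis
    using TF_section[OF assms(2,3)] assms(1) by (simp add: T2_def dual_scl)
qed

lemma \<Delta>_TF_0: "f \<in> A \<Longrightarrow> \<Delta> f \<in> TF 0"
  using \<Delta>_TF[of f 0] by (simp add: Pw_0)

text \<open>The truncations in \<open>functional_tensor\<close> are already built into
  \<open>\<Delta> f\<close>, which is zero unless both arguments lie in the group.\<close>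

lemma dist_mult_apply:
  assumes "\<nu> \<in> dual_space A" "f \<in> A"
  shows "dist_mult G A \<mu> \<nu> f = T2 \<mu> \<nu> (\<Delta> f)"
proof -
  have "ext0 (carrier G) (\<lambda>x. \<nu> (ext0 (carrier G) (\<lambda>y. f (x \<otimes> y)))) = (\<lambda>x. \<nu> (\<lambda>y. \<Delta> f (x, y)))"
  proof
    fix x
    show "ext0 (carrier G) (\<lambda>x. \<nu> (ext0 (carrier G) (\<lambda>y. f (x \<otimes> y)))) x = \<nu> (\<lambda>y. \<Delta> f (x, y))"
    proof (cases "x \<in> carrier G")
      case True
      then have "(\<lambda>y. \<Delta> f (x, y)) = ext0 (carrier G) (\<lambda>y. f (x \<otimes> y))"
        by (auto simp: \<Delta>_def ext0_def fun_eq_iff)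
      then show ?thesis using True by (simp add: ext0_def)
    next
      case False
      then have "(\<lambda>y. \<Delta> f (x, y)) = 0" by (simp add: \<Delta>_def fun_eq_iff)
      then show ?thesis using False dual_0[OF assms(1)] by (simp add: ext0_def)
    qed
  qed
  then show ?thesis
    using assms(2) by (simp add: dist_mult_def functional_tensor_def T2_def ext0_def[of A])
qed

lemma dist_mult_dual:
  assumes "\<mu> \<in> dual_space A" "\<nu> \<in> dual_space A"
  shows "dist_mult G A \<mu> \<nu> \<in> dual_space A"
  unfolding dual_space_iff
proof (intro conjI ballI allI impI)
  fix f g assume "f \<in> A" "g \<in> A"
  then show "dist_mult G A \<mu> \<nu> (f + g) = dist_mult G A \<mu> \<nu> f + dist_mult G A \<mu> \<nu> g"
    using assms by (simp only: dist_mult_apply A_add \<Delta>_add T2_add \<Delta>_TF_0)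
next
  fix f c assume "f \<in> A"
  then show "dist_mult G A \<mu> \<nu> (scl c f) = c * dist_mult G A \<mu> \<nu> f"
    using assms by (simp only: dist_mult_apply A_scl \<Delta>_scl T2_scl \<Delta>_TF_0)
qed (simp add: dist_mult_def ext0_def)

lemma dist_mult_e:
  assumes "\<mu> \<in> dual_space A" "\<nu> \<in> dual_space A"
  shows "dist_mult G A \<mu> \<nu> e = \<mu> e * \<nu> e"
  using assms by (simp add: dist_mult_apply e_A \<Delta>_e T2_ten)

lemma Dist_plus_Dist: "\<mu> \<in> Dist_plus G A i \<Longrightarrow> \<mu> \<in> Dist G A i"
  by (simp add: Dist_plus_def)

lemma dist_mult_Dist_plus:
  assumes "\<mu> \<in> Dist_plus G A i" "\<nu> \<in> Dist_plus G A j"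
  shows "dist_mult G A \<mu> \<nu> \<in> Dist_plus G A (i + j)"
  unfolding Dist_plus_iff
proof (intro conjI ballI)
  have d: "\<mu> \<in> dual_space A" "\<nu> \<in> dual_space A" "\<mu> e = 0"
    using assms by (auto simp: Dist_plus_iff)
  show "dist_mult G A \<mu> \<nu> \<in> dual_space A" using d by (intro dist_mult_dual)
  show "dist_mult G A \<mu> \<nu> e = 0" using d by (simp add: dist_mult_e)
  fix f assume f: "f \<in> Pw (Suc (i + j))"
  then have "\<Delta> f \<in> TF (Suc (i + j))" using \<Delta>_TF by blast
  then have "T2 \<mu> \<nu> (\<Delta> f) = 0"
    using assms by (intro T2_vanish[where k = "Suc (i + j)"] Dist_plus_Dist) auto
  then show "dist_mult G A \<mu> \<nu> f = 0" using d Pw_A[OF f] by (simp add: dist_mult_apply)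
qed

lemma dist_commutator_dual:
  assumes "\<mu> \<in> dual_space A" "\<nu> \<in> dual_space A"
  shows "dist_commutator G A \<mu> \<nu> \<in> dual_space A"
  using dist_mult_dual[OF assms] dist_mult_dual[OF assms(2,1)]
  unfolding dual_space_iff dist_commutator_def by (simp add: algebra_simps)

text \<open>By \<open>T2_flip\<close> the commutator is \<open>T2 \<mu> \<nu>\<close> applied to the
  antisymmetric part of \<open>\<Delta> f\<close>. That part has order \<open>k + 1\<close>, so
  \<open>i + j \<le> k\<close> suffices; for products \<open>i + j < k\<close> is needed. This
  admits the equality case in the second family of relations.\<close>

lemma dist_commutator_vanish:
  assumes \<mu>: "\<mu> \<in> Dist_plus G A i" and \<nu>: "\<nu> \<in> Dist_plus G A j" and f: "f \<in> Pw k" "i + j \<le> k" "k > 0"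
  shows "dist_commutator G A \<mu> \<nu> f = 0"
proof -
  have d: "\<mu> \<in> dual_space A" "\<nu> \<in> dual_space A"
    using assms by (auto simp: Dist_plus_iff)
  have f_A: "f \<in> A" using f(1) by (rule Pw_A)
  have TF: "\<Delta> f \<in> TF 0" "flip (\<Delta> f) \<in> TF 0" using f_A by (auto intro: \<Delta>_TF_0 flip_TF)
  have "\<Delta> f - flip (\<Delta> f) \<in> TF (Suc k)"
    using \<Delta>_TF[OF f(1)] f(3) by simp
  then have "T2 \<mu> \<nu> (\<Delta> f - flip (\<Delta> f)) = 0"
    using \<mu> \<nu> f(2) by (intro T2_vanish[where k = "Suc k"] Dist_plus_Dist) auto
  moreover have "T2 \<mu> \<nu> ((\<Delta> f - flip (\<Delta> f)) + flip (\<Delta> f)) =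
      T2 \<mu> \<nu> (\<Delta> f - flip (\<Delta> f)) + T2 \<mu> \<nu> (flip (\<Delta> f))"
    using d TF by (intro T2_add TF_diff)
  ultimately have "T2 \<mu> \<nu> (\<Delta> f) = T2 \<nu> \<mu> (\<Delta> f)"
    using T2_flip[OF d TF(1)] by simp
  then show ?thesis
    using d f_A by (simp add: dist_commutator_def dist_mult_apply)
qed

lemma dist_mult_hue_space:
  assumes "\<mu> \<in> Dist_plus G A i" "\<nu> \<in> Dist_plus G A j" "i + j < CHAR('k) ^ (r + 1)"
  shows "dist_mult G A \<mu> \<nu> \<in> hue_space G A r"
proof -
  have "f \<in> Pw (Suc (i + j))" if "f \<in> Pw (CHAR('k) ^ (r + 1))" for f
    using that assms(3) by (intro Pw_antimono[of "Suc (i + j)"]) auto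
  then show ?thesis
    unfolding hue_space_iff using dist_mult_Dist_plus[OF assms(1,2)] Dist_plus_iff by blast
qed

lemma dist_commutator_hue_space:
  assumes "\<mu> \<in> Dist_plus G A i" "\<nu> \<in> Dist_plus G A j" "i + j \<le> CHAR('k) ^ (r + 1)"
  shows "dist_commutator G A \<mu> \<nu> \<in> hue_space G A r"
proof -
  have d: "\<mu> \<in> dual_space A" "\<nu> \<in> dual_space A" "\<mu> e = 0" "\<nu> e = 0"
    using assms by (auto simp: Dist_plus_iff)
  show ?thesis
    unfolding hue_space_iff
    using dist_commutator_dual[OF d(1,2)] dist_commutator_vanish[OF assms(1,2) _ assms(3) q_pos] d
    by (simp add: dist_commutator_def dist_mult_e)
qed

lemma Dist_plus_hue_space:
  assumes "\<mu> \<in> Dist_plus G A i" "i < CHAR('k) ^ (r + 1)"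
  shows "\<mu> \<in> hue_space G A r"
proof -
  have "f \<in> Pw (Suc i)" if "f \<in> Pw (CHAR('k) ^ (r + 1))" for f
    using that assms(2) by (intro Pw_antimono[of "Suc i"]) auto
  then show ?thesis
    unfolding hue_space_iff using assms(1) Dist_plus_iff by blast
qed

text \<open>It suffices to test on the form, where \<open>\<Delta> f\<close> is a sum of tensors of
  elements of the form. Raising it to the \<open>q\<close>-th power raises each tensor factor, so
  the Frobenius map commutes with the comultiplication.\<close>

lemma \<Xi>_dist_mult:
  assumes d: "\<mu> \<in> dual_space A" "\<nu> \<in> dual_space A"
  shows "\<Xi> s (dist_mult G A \<mu> \<nu>) = dist_mult G A (\<Xi> s \<mu>) (\<Xi> s \<nu>)"
proof (rule dual_eqI)
  show "\<Xi> s (dist_mult G A \<mu> \<nu>) \<in> dual_space A" "dist_mult G A (\<Xi> s \<mu>) (\<Xi> s \<nu>) \<in> dual_space A"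
    using d by (auto intro: \<Xi>_dual dist_mult_dual)
  fix f assume f: "f \<in> A\<^sub>0"
  let ?q = "CHAR('k) ^ s"
  obtain n :: nat and g h where *: "\<And>i. i < n \<Longrightarrow> g i \<in> A\<^sub>0" "\<And>i. i < n \<Longrightarrow> h i \<in> A\<^sub>0"
    "\<Delta> f = (\<Sum>i<n. ten (g i) (h i))"
    using \<Delta>_expand[OF form.comult[OF f] form.subset] by blast
  have T2_sum: "T2 \<alpha> \<beta> (\<Sum>i<m. ten (u i) (v i)) = (\<Sum>i<m. \<alpha> (u i) * \<beta> (v i))"
    if "\<alpha> \<in> dual_space A" "\<beta> \<in> dual_space A" "\<And>i. i < m \<Longrightarrow> u i \<in> A" "\<And>i. i < m \<Longrightarrow> v i \<in> A"
    for \<alpha> \<beta> u v and m :: nat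
    using that(3,4)
  proof (induction m)
    case 0
    have "T2 \<alpha> \<beta> (\<Sum>i<0. ten (u i) (v i)) = (\<Sum>i<0. \<alpha> (u i) * \<beta> (v i))"
      by (simp only: lessThan_0 sum.empty T2_0[OF that(1,2)])
    then show ?case .
  next
    case (Suc m)
    have TF: "ten (u i) (v i) \<in> TF 0" if "i < Suc m" for i
    proof (rule TF_ten)
      show "u i \<in> Pw 0" "v i \<in> Pw 0" using that Suc.prems by (auto simp: Pw_0)
    qed simp
    have "T2 \<alpha> \<beta> ((\<Sum>i<m. ten (u i) (v i)) + ten (u m) (v m)) =
        T2 \<alpha> \<beta> (\<Sum>i<m. ten (u i) (v i)) + T2 \<alpha> \<beta> (ten (u m) (v m))"
      using that(1,2) TF by (intro T2_add TF_sum) auto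
    also have "T2 \<alpha> \<beta> (\<Sum>i<m. ten (u i) (v i)) = (\<Sum>i<m. \<alpha> (u i) * \<beta> (v i))"
      using Suc.prems by (intro Suc.IH) auto
    also have "T2 \<alpha> \<beta> (ten (u m) (v m)) = \<alpha> (u m) * \<beta> (v m)"
      using that(1,2) Suc.prems by (intro T2_ten) auto
    finally have "T2 \<alpha> \<beta> (\<Sum>i<Suc m. ten (u i) (v i)) = (\<Sum>i<Suc m. \<alpha> (u i) * \<beta> (v i))"
      by (simp only: sum.lessThan_Suc)
    then show ?case .
  qed
  have pA: "g ^ ?q \<in> A" if "g \<in> A\<^sub>0" for g
    using that A_power[OF A0_A] q_pos by blast
  have "prime CHAR('g \<times> 'g \<Rightarrow> 'k)"
    using prime_CHAR by (simp add: CHAR_fun)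
  then have "\<Delta> (f ^ ?q) = (\<Sum>i<n. ten (g i) (h i) ^ ?q)"
    unfolding \<Delta>_power[OF q_pos] *(3)
    by (rule freshmans_dream_sum') (simp add: CHAR_fun)
  also have "\<dots> = (\<Sum>i<n. ten (g i ^ ?q) (h i ^ ?q))"
    by (intro sum.cong refl) (auto simp: ten_def fun_eq_iff power_mult_distrib)
  finally have "\<Delta> (f ^ ?q) = (\<Sum>i<n. ten (g i ^ ?q) (h i ^ ?q))" .
  then have "\<Xi> s (dist_mult G A \<mu> \<nu>) f = (\<Sum>i<n. \<mu> (g i ^ ?q) * \<nu> (h i ^ ?q))"
    using f d * pA by (simp add: \<Xi>_apply A0_A \<phi>_A0 dist_mult_apply T2_sum)
  also have "\<dots> = (\<Sum>i<n. \<Xi> s \<mu> (g i) * \<Xi> s \<nu> (h i))"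
    using * by (intro sum.cong refl) (simp add: \<Xi>_apply A0_A \<phi>_A0)
  also have "\<dots> = dist_mult G A (\<Xi> s \<mu>) (\<Xi> s \<nu>) f"
    using f d * A0_A by (simp add: \<Xi>_dual dist_mult_apply T2_sum)
  finally show "\<Xi> s (dist_mult G A \<mu> \<nu>) f = dist_mult G A (\<Xi> s \<mu>) (\<Xi> s \<nu>) f" .
qed

lemma \<Xi>_dist_commutator:
  assumes d: "\<mu> \<in> dual_space A" "\<nu> \<in> dual_space A"
  shows "\<Xi> s (dist_commutator G A \<mu> \<nu>) = dist_commutator G A (\<Xi> s \<mu>) (\<Xi> s \<nu>)"
proof -
  have "\<Xi> s (dist_commutator G A \<mu> \<nu>) f = \<Xi> s (dist_mult G A \<mu> \<nu>) f - \<Xi> s (dist_mult G A \<nu> \<mu>) f" for f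
    by (simp add: \<Xi>_def ext0_def dist_commutator_def)
  then show ?thesis
    using d by (simp add: \<Xi>_dist_mult dist_commutator_def fun_eq_iff)
qed

end

section \<open>Free algebras and their quotients\<close>

lemma FactRing_carrier: "carrier (R Quot I) = (\<lambda>x. I +>\<^bsub>R\<^esub> x) ` carrier R"
  by (auto simp: FactRing_simps)

lemma quotient_hom:
  assumes "ring R" "ring R'" "ideal I R" "ideal I' R'" "f \<in> ring_hom R R'" "f ` I \<subseteq> I'"
  obtains h where "h \<in> ring_hom (R Quot I) (R' Quot I')"
    "\<And>x. x \<in> carrier R \<Longrightarrow> h (I +>\<^bsub>R\<^esub> x) = I' +>\<^bsub>R'\<^esub> f x"
proof -
  interpret R: ring R by fact
  interpret R': ring R' by fact
  interpret I: ideal I R by fact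
  interpret I': ideal I' R' by fact
  let ?p = "\<lambda>x. I +>\<^bsub>R\<^esub> x" and ?p' = "\<lambda>x. I' +>\<^bsub>R'\<^esub> x"
  note f = ring_hom_memE[OF assms(5)]
  note p = ring_hom_memE[OF I.rcos_ring_hom]
  note p' = ring_hom_memE[OF I'.rcos_ring_hom]
  define h where "h C = the_elem ((\<lambda>x. ?p' (f x)) ` C)" for C
  have h: "h (?p x) = ?p' (f x)" if x: "x \<in> carrier R" for x
  proof -
    have "?p' (f y) = ?p' (f x)" if y: "y \<in> ?p x" for y
    proof -
      obtain i where i: "i \<in> I" "y = i \<oplus>\<^bsub>R\<^esub> x"
        using y by (auto simp: a_r_coset_def r_coset_def)
      have iR: "i \<in> carrier R" using i(1) by (rule I.a_Hcarr)
      have "f y = f i \<oplus>\<^bsub>R'\<^esub> f x"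
        using f(3)[OF iR x] i(2) by simp
      moreover have "f i \<in> I'" using assms(6) i(1) by blast
      ultimately have "f y \<in> ?p' (f x)"
        by (auto simp: a_r_coset_def r_coset_def)
      then show ?thesis
        using I'.a_repr_independence'[of "f y" "f x"] f(1)[OF x] by simp
    qed
    moreover have "x \<in> ?p x" using x by (rule I.a_rcos_self)
    ultimately have "(\<lambda>x. ?p' (f x)) ` ?p x = {?p' (f x)}" by blast
    then show ?thesis by (simp add: h_def)
  qed
  have carrier: "\<exists>x\<in>carrier R. C = ?p x" if "C \<in> carrier (R Quot I)" for C
    using that by (auto simp: FactRing_simps)
  have "h \<in> ring_hom (R Quot I) (R' Quot I')"
  proof (rule ring_hom_memI)
    fix C assume "C \<in> carrier (R Quot I)"
    then obtain x where "x \<in> carrier R" "C = ?p x" using carrier by blast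
    then show "h C \<in> carrier (R' Quot I')" using h p'(1) f(1) by simp
  next
    fix C D assume "C \<in> carrier (R Quot I)" "D \<in> carrier (R Quot I)"
    then obtain x y where xy: "x \<in> carrier R" "C = ?p x" "y \<in> carrier R" "D = ?p y" using carrier by blast
    show "h (C \<otimes>\<^bsub>R Quot I\<^esub> D) = h C \<otimes>\<^bsub>R' Quot I'\<^esub> h D"
      using xy p(2)[symmetric] p'(2) f by (simp add: h)
    show "h (C \<oplus>\<^bsub>R Quot I\<^esub> D) = h C \<oplus>\<^bsub>R' Quot I'\<^esub> h D"
      using xy p(3)[symmetric] p'(3) f by (simp add: h)
  next
    show "h \<one>\<^bsub>R Quot I\<^esub> = \<one>\<^bsub>R' Quot I'\<^esub>"
      using p(4)[symmetric] p'(4) f(4) by (simp add: h)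
  qed
  then show ?thesis using that h by blast
qed

lemma ring_hom_genideal:
  assumes "ring R" "ring R'" "ideal I' R'" "f \<in> ring_hom R R'" "S \<subseteq> carrier R" "f ` S \<subseteq> I'"
  shows "f ` (Idl\<^bsub>R\<^esub> S) \<subseteq> I'"
proof -
  interpret R: ring R by fact
  interpret ring_hom_ring R R' f
    by (rule ring_hom_ringI2) fact+
  have "Idl\<^bsub>R\<^esub> S \<subseteq> {r \<in> carrier R. f r \<in> I'}"
    by (rule R.genideal_minimal[OF ideal_vimage[OF assms(3)]]) (use assms(5,6) in auto)
  then show ?thesis by blast
qed

lemma poly_mapping_sum_single:
  "t = (\<Sum>w\<in>Poly_Mapping.keys t. Poly_Mapping.single w (Poly_Mapping.lookup t w))"
  by (rule poly_mapping_eqI)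
    (simp add: lookup_sum lookup_single when_def sum.delta in_keys_iff)

definition map_word :: "('v \<Rightarrow> 'w) \<Rightarrow> 'v free_monoid \<Rightarrow> 'w free_monoid" where
  "map_word m w = Word (map m (letters w))"

lemma map_word_add: "map_word m (v + w) = map_word m v + map_word m w"
  and map_word_0: "map_word m 0 = 0"
  by (simp_all add: map_word_def plus_free_monoid_def zero_free_monoid_def)

text \<open>The algebra homomorphism of free algebras induced by a map of letters. Linearity of
  \<open>m\<close> enters only on passing to tensor algebras.\<close>

definition push :: "('v \<Rightarrow> 'w) \<Rightarrow> ('v, 'k::field) free_algebra \<Rightarrow> ('w, 'k) free_algebra" where
  "push m t = (\<Sum>w\<in>Poly_Mapping.keys t. Poly_Mapping.single (map_word m w) (Poly_Mapping.lookup t w))"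

lemma push_superset:
  assumes "finite S" "Poly_Mapping.keys t \<subseteq> S"
  shows "push m t = (\<Sum>w\<in>S. Poly_Mapping.single (map_word m w) (Poly_Mapping.lookup t w))"
  unfolding push_def using assms by (intro sum.mono_neutral_left) (auto simp: in_keys_iff)

lemma push_add: "push m (t + u) = push m t + push m u"
proof -
  let ?S = "Poly_Mapping.keys t \<union> Poly_Mapping.keys u"
  have "push m (t + u) = (\<Sum>w\<in>?S. Poly_Mapping.single (map_word m w) (Poly_Mapping.lookup (t + u) w))"
    using keys_add[of t u] by (intro push_superset) auto
  also have "\<dots> = push m t + push m u"
    by (simp add: push_superset[of ?S] lookup_add single_add sum.distrib)
  finally show ?thesis .
qed

lemma push_0: "push m 0 = 0"
  by (simp add: push_def)

lemma push_sum: "push m (sum f S) = (\<Sum>i\<in>S. push m (f i))"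
  by (induction S rule: infinite_finite_induct) (simp_all add: push_0 push_add)

lemma push_uminus: "push m (- t) = - push m t"
  using push_add[of m t "- t"] by (simp add: push_0 eq_neg_iff_add_eq_0 add.commute)

lemma push_diff: "push m (t - u) = push m t - push m u"
  using push_add[of m t "- u"] by (simp add: push_uminus)

lemma push_single: "push m (Poly_Mapping.single w c) = Poly_Mapping.single (map_word m w) c"
  by (cases "c = 0") (simp_all add: push_def)

lemma push_mult: "push m (t * u) = push m t * push m u"
proof -
  let ?s = "\<lambda>t w. Poly_Mapping.single w (Poly_Mapping.lookup t w)"
  have "t * u = (\<Sum>w\<in>Poly_Mapping.keys t. \<Sum>v\<in>Poly_Mapping.keys u. ?s t w * ?s u v)"
    by (subst (1) poly_mapping_sum_single[of t], subst (1) poly_mapping_sum_single[of u])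
      (simp add: sum_product)
  then have "push m (t * u) =
      (\<Sum>w\<in>Poly_Mapping.keys t. \<Sum>v\<in>Poly_Mapping.keys u. push m (?s t w) * push m (?s u v))"
    by (simp add: push_sum push_single mult_single map_word_add)
  also have "\<dots> = push m t * push m u"
    by (simp only: push_single) (simp add: push_def[of m t] push_def[of m u] sum_product)
  finally show ?thesis .
qed

lemma push_free_gen: "push m (free_gen v) = free_gen (m v)"
  and push_free_scalar: "push m (free_scalar c) = free_scalar c"
  by (simp_all add: free_gen_def free_scalar_def push_single map_word_0) (simp add: map_word_def)

lemma free_scalar_1: "free_scalar 1 = 1"
  by (simp add: free_scalar_def)

lemma free_algebra_simps:
  "mult (free_algebra V) = (*)" "one (free_algebra V) = 1" "zero (free_algebra V) = 0" "add (free_algebra V) = (+)"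
  by (simp_all add: free_algebra_def)

lemma free_algebra_carrier:
  "t \<in> carrier (free_algebra V) \<longleftrightarrow> (\<forall>w\<in>Poly_Mapping.keys t. set (letters w) \<subseteq> V)"
  by (simp add: free_algebra_def)

lemma free_algebra_add: "\<lbrakk>t \<in> carrier (free_algebra V); u \<in> carrier (free_algebra V)\<rbrakk> \<Longrightarrow> t + u \<in> carrier (free_algebra V)"
  unfolding free_algebra_carrier using keys_add[of t u] by blast

lemma free_algebra_uminus: "t \<in> carrier (free_algebra V) \<Longrightarrow> - t \<in> carrier (free_algebra V)"
  by (simp add: free_algebra_carrier in_keys_iff)

lemma free_algebra_diff: "\<lbrakk>t \<in> carrier (free_algebra V); u \<in> carrier (free_algebra V)\<rbrakk> \<Longrightarrow> t - u \<in> carrier (free_algebra V)"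
  using free_algebra_add[OF _ free_algebra_uminus, of t V u] by simp

lemma free_algebra_mult:
  assumes "t \<in> carrier (free_algebra V)" "u \<in> carrier (free_algebra V)"
  shows "t * u \<in> carrier (free_algebra V)"
  unfolding free_algebra_carrier
proof
  fix w assume "w \<in> Poly_Mapping.keys (t * u)"
  then obtain a b where "w = a + b" "a \<in> Poly_Mapping.keys t" "b \<in> Poly_Mapping.keys u"
    using keys_mult[of t u] by blast
  then show "set (letters w) \<subseteq> V"
    using assms by (auto simp: free_algebra_carrier plus_free_monoid_def)
qed

lemma free_algebra_gen: "v \<in> V \<Longrightarrow> free_gen v \<in> carrier (free_algebra V)"
  and free_algebra_scalar: "free_scalar c \<in> carrier (free_algebra V)"
  by (simp_all add: free_algebra_carrier free_gen_def free_scalar_def zero_free_monoid_def)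

lemma free_algebra_ring: "ring (free_algebra V :: ('v, 'k::field) free_algebra ring)"
proof (rule ringI)
  show "abelian_group (free_algebra V :: ('v, 'k) free_algebra ring)"
  proof (rule abelian_groupI)
    show "\<exists>y\<in>carrier (free_algebra V). y \<oplus>\<^bsub>free_algebra V\<^esub> x = \<zero>\<^bsub>free_algebra V\<^esub>"
      if "x \<in> carrier (free_algebra V)" for x :: "('v, 'k) free_algebra"
      using free_algebra_uminus[OF that] by (intro bexI[of _ "- x"]) (simp_all add: free_algebra_simps)
  qed (auto simp: free_algebra_simps free_algebra_add free_algebra_carrier[of 0] ac_simps)
  show "Group.monoid (free_algebra V :: ('v, 'k) free_algebra ring)"
  proof (rule monoidI)
    show "\<one>\<^bsub>free_algebra V\<^esub> \<in> carrier (free_algebra V :: ('v, 'k) free_algebra ring)"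
      using free_algebra_scalar[of 1 V] by (simp add: free_algebra_simps free_scalar_1)
  qed (auto simp: free_algebra_simps free_algebra_mult mult.assoc)
qed (auto simp: free_algebra_simps distrib_left distrib_right)

lemma free_algebra_induct [consumes 1, case_names scalar gen add mult]:
  assumes t: "t \<in> carrier (free_algebra V)"
    and scalar: "\<And>c. Q (free_scalar c)" and gen: "\<And>v. v \<in> V \<Longrightarrow> Q (free_gen v)"
    and add: "\<And>t u. \<lbrakk>t \<in> carrier (free_algebra V); u \<in> carrier (free_algebra V); Q t; Q u\<rbrakk> \<Longrightarrow> Q (t + u)"
    and mult: "\<And>t u. \<lbrakk>t \<in> carrier (free_algebra V); u \<in> carrier (free_algebra V); Q t; Q u\<rbrakk> \<Longrightarrow> Q (t * u)"
  shows "Q (t :: ('v, 'k::field) free_algebra)"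
proof -
  have word: "Poly_Mapping.single (Word xs) c \<in> carrier (free_algebra V) \<and> Q (Poly_Mapping.single (Word xs) c)"
    if "set xs \<subseteq> V" for xs and c :: 'k
    using that
  proof (induction xs)
    case Nil
    then show ?case
      using scalar[of c] free_algebra_scalar[of c V] by (simp add: free_scalar_def zero_free_monoid_def)
  next
    case (Cons v xs)
    then have v: "v \<in> V" by simp
    have "free_gen v * Poly_Mapping.single (Word xs) c = Poly_Mapping.single (Word (v # xs)) c"
      by (simp add: free_gen_def mult_single plus_free_monoid_def)
    moreover have "free_gen v * Poly_Mapping.single (Word xs) c \<in> carrier (free_algebra V)"
      "Q (free_gen v * Poly_Mapping.single (Word xs) c)"
      using Cons gen[OF v] free_algebra_gen[OF v] by (auto intro: free_algebra_mult mult)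
    ultimately show ?case by simp
  qed
  have "(\<Sum>w\<in>S. Poly_Mapping.single w (Poly_Mapping.lookup t w)) \<in> carrier (free_algebra V) \<and>
      Q (\<Sum>w\<in>S. Poly_Mapping.single w (Poly_Mapping.lookup t w))" if "finite S" "S \<subseteq> Poly_Mapping.keys t" for S
    using that
  proof (induction S rule: finite_induct)
    case empty
    then show ?case
      using scalar[of 0] free_algebra_scalar[of 0 V] by (simp add: free_scalar_def)
  next
    case (insert w S)
    have "set (letters w) \<subseteq> V" using insert.prems t by (auto simp: free_algebra_carrier)
    then have "Poly_Mapping.single w (Poly_Mapping.lookup t w) \<in> carrier (free_algebra V) \<and>
        Q (Poly_Mapping.single w (Poly_Mapping.lookup t w))"
      using word[of "letters w"] by simp
    then show ?case
      using insert by (simp add: free_algebra_add add)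
  qed
  from this[OF finite_keys order_refl] show ?thesis
    by (simp flip: poly_mapping_sum_single)
qed

lemma push_carrier:
  assumes "m ` V \<subseteq> V'" "t \<in> carrier (free_algebra V)"
  shows "push m t \<in> carrier (free_algebra V')"
  using assms(2)
proof (induction t rule: free_algebra_induct)
  case (gen v)
  then show ?case using assms(1) by (auto simp: push_free_gen intro: free_algebra_gen)
qed (auto simp: push_free_scalar push_add push_mult intro: free_algebra_scalar free_algebra_add free_algebra_mult)

lemma push_hom:
  assumes "m ` V \<subseteq> V'"
  shows "push m \<in> ring_hom (free_algebra V) (free_algebra V' :: ('w, 'k::field) free_algebra ring)"
proof (rule ring_hom_memI)
  show "push m \<one>\<^bsub>free_algebra V\<^esub> = \<one>\<^bsub>free_algebra V' :: ('w, 'k) free_algebra ring\<^esub>"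
    using push_free_scalar[of m 1] by (simp add: free_algebra_simps free_scalar_1)
qed (simp_all add: push_carrier[OF assms] free_algebra_simps push_add push_mult)

lemma push_surj:
  assumes "m ` V = V'" "u \<in> carrier (free_algebra V')"
  shows "\<exists>t\<in>carrier (free_algebra V). push m t = u"
  using assms(2)
proof (induction u rule: free_algebra_induct)
  case (scalar c)
  then show ?case using free_algebra_scalar push_free_scalar by blast
next
  case (gen v)
  then obtain w where "w \<in> V" "v = m w" using assms(1) by blast
  then show ?case using free_algebra_gen push_free_gen by metis
next
  case (add t u)
  then show ?case using free_algebra_add push_add by metis
next
  case (mult t u)
  then show ?case using free_algebra_mult push_mult by metis
qed

section \<open>Functoriality of tensor algebras\<close>

definition linear_closed :: "('x \<Rightarrow> 'k::field) set \<Rightarrow> bool" where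
  "linear_closed V \<longleftrightarrow> (\<forall>v\<in>V. \<forall>w\<in>V. (\<lambda>x. v x + w x) \<in> V) \<and> (\<forall>c. \<forall>v\<in>V. (\<lambda>x. c * v x) \<in> V)"

definition linearity_relations :: "('x \<Rightarrow> 'k::field) set \<Rightarrow> ('x \<Rightarrow> 'k, 'k) free_algebra set" where
  "linearity_relations V =
     {free_gen (\<lambda>x. v x + w x) - free_gen v - free_gen w | v w. v \<in> V \<and> w \<in> V} \<union>
     {free_gen (\<lambda>x. c * v x) - free_scalar c * free_gen v | c v. v \<in> V}"

lemma linearity_ideal_eq: "linearity_ideal V = Idl\<^bsub>free_algebra V\<^esub> (linearity_relations V)"
  by (simp add: linearity_ideal_def linearity_relations_def)

lemma linearity_relations_carrier:
  "linear_closed V \<Longrightarrow> linearity_relations V \<subseteq> carrier (free_algebra V)"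
  unfolding linear_closed_def linearity_relations_def
  by (auto intro!: free_algebra_diff free_algebra_mult free_algebra_scalar free_algebra_gen)

lemma linearity_ideal: "linear_closed V \<Longrightarrow> ideal (linearity_ideal V) (free_algebra V)"
  unfolding linearity_ideal_eq
  by (intro ring.genideal_ideal free_algebra_ring linearity_relations_carrier)

lemma tensor_algebra_ring: "linear_closed V \<Longrightarrow> ring (tensor_algebra V)"
  unfolding tensor_algebra_def by (intro ideal.quotient_is_ring linearity_ideal)

lemma tensor_gen_carrier: "\<lbrakk>linear_closed V; v \<in> V\<rbrakk> \<Longrightarrow> tensor_gen V v \<in> carrier (tensor_algebra V)"
  unfolding tensor_algebra_def tensor_gen_def
  by (intro ring_hom_closed[OF ideal.rcos_ring_hom] linearity_ideal free_algebra_gen)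

text \<open>A linear map of letters carries each linearity relation to a linearity relation, so
  \<open>push m\<close> descends to the quotients.\<close>

lemma tensor_algebra_map:
  assumes V: "linear_closed V" "linear_closed V'" and m: "m ` V \<subseteq> V'"
    and m_add: "\<And>v w. \<lbrakk>v \<in> V; w \<in> V\<rbrakk> \<Longrightarrow> m (\<lambda>x. v x + w x) = (\<lambda>x. m v x + m w x)"
    and m_scale: "\<And>c v. v \<in> V \<Longrightarrow> m (\<lambda>x. c * v x) = (\<lambda>x. c * m v x)"
  obtains h where "h \<in> ring_hom (tensor_algebra V) (tensor_algebra V')"
    "\<And>t. t \<in> carrier (free_algebra V) \<Longrightarrow>
      h (linearity_ideal V +>\<^bsub>free_algebra V\<^esub> t) = linearity_ideal V' +>\<^bsub>free_algebra V'\<^esub> push m t"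
proof (rule quotient_hom[OF free_algebra_ring free_algebra_ring linearity_ideal[OF V(1)] linearity_ideal[OF V(2)] push_hom[OF m]])
  show "push m ` linearity_ideal V \<subseteq> linearity_ideal V'"
    unfolding linearity_ideal_eq[of V]
  proof (rule ring_hom_genideal[OF free_algebra_ring free_algebra_ring linearity_ideal[OF V(2)] push_hom[OF m]
        linearity_relations_carrier[OF V(1)]])
    have "push m ` linearity_relations V \<subseteq> linearity_relations V'"
    proof clarify
      fix t assume "t \<in> linearity_relations V"
      then consider (add) v w where "v \<in> V" "w \<in> V" "t = free_gen (\<lambda>x. v x + w x) - free_gen v - free_gen w"
        | (scale) c v where "v \<in> V" "t = free_gen (\<lambda>x. c * v x) - free_scalar c * free_gen v"
        unfolding linearity_relations_def by blast
      then show "push m t \<in> linearity_relations V'"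
      proof cases
        case add
        then have "push m t = free_gen (\<lambda>x. m v x + m w x) - free_gen (m v) - free_gen (m w)"
          by (simp add: push_diff push_free_gen m_add)
        moreover have "m v \<in> V'" "m w \<in> V'" using add m by auto
        ultimately show ?thesis unfolding linearity_relations_def by blast
      next
        case scale
        then have "push m t = free_gen (\<lambda>x. c * m v x) - free_scalar c * free_gen (m v)"
          by (simp add: push_diff push_mult push_free_gen push_free_scalar m_scale)
        moreover have "m v \<in> V'" using scale m by auto
        ultimately show ?thesis unfolding linearity_relations_def by blast
      qed
    qed
    also have "\<dots> \<subseteq> linearity_ideal V'"
      unfolding linearity_ideal_eq
      by (intro ring.genideal_self free_algebra_ring linearity_relations_carrier V)
    finally show "push m ` linearity_relations V \<subseteq> linearity_ideal V'" .
  qed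
qed (use that in \<open>simp add: tensor_algebra_def\<close>)

lemma div_add_bounds:
  fixes q :: nat
  assumes "q > 0"
  shows "i + j < n * q \<Longrightarrow> i div q + j div q < n" "i + j \<le> n * q \<Longrightarrow> i div q + j div q \<le> n"
proof -
  have le: "(i div q + j div q) * q \<le> i + j"
    by (simp add: add_mult_distrib add_mono)
  show "i + j < n * q \<Longrightarrow> i div q + j div q < n"
    using le_less_trans[OF le, of "n * q"] assms by simp
  show "i + j \<le> n * q \<Longrightarrow> i div q + j div q \<le> n"
    using le_trans[OF le, of "n * q"] assms by simp
qed

section \<open>Higher enveloping algebras and the homomorphism between them\<close>

context group_with_form
begin

text \<open>A constant, so that the simplifier leaves the exponent inside \<^term>\<open>hue_space G A r\<close> alone.\<close>

definition HS :: "nat \<Rightarrow> ('g, 'k) functional set" where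
  "HS r = hue_space G A r"

lemmas HS_iff = hue_space_iff[folded HS_def]
lemmas Dist_plus_HS = Dist_plus_hue_space[folded HS_def]
lemmas dist_mult_HS = dist_mult_hue_space[folded HS_def]
lemmas dist_commutator_HS = dist_commutator_hue_space[folded HS_def]

definition hue_relations :: "nat \<Rightarrow> (('g, 'k) functional, 'k) free_algebra set set" where
  "hue_relations r =
    (let q = CHAR('k) ^ (r + 1); V = HS r; T = tensor_algebra V; \<iota> = tensor_gen V in
      {\<iota> x \<otimes>\<^bsub>T\<^esub> \<iota> y \<ominus>\<^bsub>T\<^esub> \<iota> (dist_mult G A x y) | x y i j.
          x \<in> Dist_plus G A i \<and> y \<in> Dist_plus G A j \<and> i + j < q} \<union>
      {\<iota> x \<otimes>\<^bsub>T\<^esub> \<iota> y \<ominus>\<^bsub>T\<^esub> \<iota> y \<otimes>\<^bsub>T\<^esub> \<iota> x \<ominus>\<^bsub>T\<^esub> \<iota> (dist_commutator G A x y) | x y i j.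
          x \<in> Dist_plus G A i \<and> y \<in> Dist_plus G A j \<and> i < q \<and> j < q \<and> i + j \<le> q})"

lemma hue_ideal_eq: "hue_ideal G A r = Idl\<^bsub>tensor_algebra (HS r)\<^esub> (hue_relations r)"
  by (simp add: hue_ideal_def hue_relations_def Let_def HS_def)

lemma hue_algebra_eq: "hue_algebra G A r = tensor_algebra (HS r) Quot hue_ideal G A r"
  by (simp add: hue_algebra_def HS_def)

lemma dual_space_closed: "linear_closed (dual_space A)"
  unfolding linear_closed_def dual_space_iff
  by (intro conjI ballI allI impI) (simp_all add: dual_add dual_scl dual_outside algebra_simps)

lemma hue_space_closed: "linear_closed (HS r)"
  using dual_space_closed by (auto simp: linear_closed_def HS_iff)

lemma hue_space_dual: "\<mu> \<in> HS r \<Longrightarrow> \<mu> \<in> dual_space A"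
  unfolding HS_iff by blast

abbreviation T :: "nat \<Rightarrow> (('g, 'k) functional, 'k) free_algebra set ring" where
  "T r \<equiv> tensor_algebra (HS r)"

abbreviation \<iota> :: "nat \<Rightarrow> ('g, 'k) functional \<Rightarrow> (('g, 'k) functional, 'k) free_algebra set" where
  "\<iota> r \<equiv> tensor_gen (HS r)"

lemmas T_ring = tensor_algebra_ring[OF hue_space_closed]
lemmas \<iota>_carrier = tensor_gen_carrier[OF hue_space_closed]

lemma hue_relations_cases:
  assumes "t \<in> hue_relations r"
  obtains (mult) x y i j where "x \<in> Dist_plus G A i" "y \<in> Dist_plus G A j" "i + j < CHAR('k) ^ (r + 1)"
      "t = \<iota> r x \<otimes>\<^bsub>T r\<^esub> \<iota> r y \<ominus>\<^bsub>T r\<^esub> \<iota> r (dist_mult G A x y)"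
    | (commutator) x y i j where "x \<in> Dist_plus G A i" "y \<in> Dist_plus G A j"
      "i < CHAR('k) ^ (r + 1)" "j < CHAR('k) ^ (r + 1)" "i + j \<le> CHAR('k) ^ (r + 1)"
      "t = \<iota> r x \<otimes>\<^bsub>T r\<^esub> \<iota> r y \<ominus>\<^bsub>T r\<^esub> \<iota> r y \<otimes>\<^bsub>T r\<^esub> \<iota> r x \<ominus>\<^bsub>T r\<^esub> \<iota> r (dist_commutator G A x y)"
  using assms unfolding hue_relations_def Let_def by blast

lemma hue_relations_mult:
  assumes "x \<in> Dist_plus G A i" "y \<in> Dist_plus G A j" "i + j < CHAR('k) ^ (r + 1)"
  shows "\<iota> r x \<otimes>\<^bsub>T r\<^esub> \<iota> r y \<ominus>\<^bsub>T r\<^esub> \<iota> r (dist_mult G A x y) \<in> hue_relations r"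
  using assms unfolding hue_relations_def Let_def by blast

lemma hue_relations_commutator:
  assumes "x \<in> Dist_plus G A i" "y \<in> Dist_plus G A j"
    "i < CHAR('k) ^ (r + 1)" "j < CHAR('k) ^ (r + 1)" "i + j \<le> CHAR('k) ^ (r + 1)"
  shows "\<iota> r x \<otimes>\<^bsub>T r\<^esub> \<iota> r y \<ominus>\<^bsub>T r\<^esub> \<iota> r y \<otimes>\<^bsub>T r\<^esub> \<iota> r x \<ominus>\<^bsub>T r\<^esub> \<iota> r (dist_commutator G A x y) \<in> hue_relations r"
  using assms unfolding hue_relations_def Let_def by blast

lemma hue_relations_carrier: "hue_relations r \<subseteq> carrier (T r)"
proof
  fix t assume "t \<in> hue_relations r"
  interpret T: ring "T r" by (rule T_ring)
  from \<open>t \<in> hue_relations r\<close> show "t \<in> carrier (T r)"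
  proof (cases rule: hue_relations_cases)
    case (mult x y i j)
    then have "x \<in> HS r" "y \<in> HS r" "dist_mult G A x y \<in> HS r"
      using Dist_plus_HS[OF mult(1), of r] Dist_plus_HS[OF mult(2), of r]
        dist_mult_HS[OF mult(1,2,3)] by simp_all
    then show ?thesis unfolding mult(4) using \<iota>_carrier by simp
  next
    case (commutator x y i j)
    then have "x \<in> HS r" "y \<in> HS r" "dist_commutator G A x y \<in> HS r"
      using Dist_plus_HS[OF commutator(1,3)] Dist_plus_HS[OF commutator(2,4)]
        dist_commutator_HS[OF commutator(1,2,5)] by simp_all
    then show ?thesis unfolding commutator(6) using \<iota>_carrier by simp
  qed
qed

lemma hue_ideal: "ideal (hue_ideal G A r) (T r)"
  unfolding hue_ideal_eq by (intro ring.genideal_ideal T_ring hue_relations_carrier)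

lemma \<Xi>_linear:
  "\<Xi> s (\<lambda>f. \<mu> f + \<nu> f) = (\<lambda>f. \<Xi> s \<mu> f + \<Xi> s \<nu> f)" "\<Xi> s (\<lambda>f. c * \<mu> f) = (\<lambda>f. c * \<Xi> s \<mu> f)"
  by (auto simp: \<Xi>_def ext0_def fun_eq_iff)

lemma \<Xi>_image: "s \<le> r \<Longrightarrow> \<Xi> s ` HS r = HS (r - s)"
  unfolding HS_def using \<Xi>_hue_space \<Xi>_surj by blast

text \<open>The map \<open>\<Xi> s\<close> divides degrees by \<open>p^s\<close> and rounds down.
  These bounds say that the degree conditions of both families of relations survive.\<close>

lemma div_power_bounds:
  assumes "s \<le> r"
  shows "i + j < CHAR('k) ^ (r + 1) \<Longrightarrow> i div CHAR('k) ^ s + j div CHAR('k) ^ s < CHAR('k) ^ (r - s + 1)"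
    and "i + j \<le> CHAR('k) ^ (r + 1) \<Longrightarrow> i div CHAR('k) ^ s + j div CHAR('k) ^ s \<le> CHAR('k) ^ (r - s + 1)"
    and "i < CHAR('k) ^ (r + 1) \<Longrightarrow> i div CHAR('k) ^ s < CHAR('k) ^ (r - s + 1)"
    and "Suc i \<le> Suc (i div CHAR('k) ^ s) * CHAR('k) ^ s"
proof -
  let ?q = "CHAR('k) ^ s"
  have Q: "CHAR('k) ^ (r + 1) = CHAR('k) ^ (r - s + 1) * ?q"
    unfolding power_add[symmetric] using assms by simp
  show "i + j < CHAR('k) ^ (r + 1) \<Longrightarrow> i div ?q + j div ?q < CHAR('k) ^ (r - s + 1)"
    unfolding Q by (rule div_add_bounds(1)[OF q_pos])
  show "i + j \<le> CHAR('k) ^ (r + 1) \<Longrightarrow> i div ?q + j div ?q \<le> CHAR('k) ^ (r - s + 1)"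
    unfolding Q by (rule div_add_bounds(2)[OF q_pos])
  show "i < CHAR('k) ^ (r + 1) \<Longrightarrow> i div ?q < CHAR('k) ^ (r - s + 1)"
    unfolding Q by (rule less_mult_imp_div_less)
  have "i < Suc (i div ?q) * ?q"
    using dividend_less_div_times[OF q_pos, of i s] by simp
  then show "Suc i \<le> Suc (i div ?q) * ?q" by (rule Suc_leI)
qed

text \<open>The two successive quotient maps, from the free algebra to the tensor algebra and on to
  the enveloping algebra, as one map; computations can then be made on words.\<close>

definition class_map :: "nat \<Rightarrow> (('g, 'k) functional, 'k) free_algebra \<Rightarrow> ('g, 'k) hue" where
  "class_map r t = hue_ideal G A r +>\<^bsub>T r\<^esub> (linearity_ideal (HS r) +>\<^bsub>free_algebra (HS r)\<^esub> t)"

lemma class_map_hom: "class_map r \<in> ring_hom (free_algebra (HS r)) (hue_algebra G A r)"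
proof -
  have "class_map r = (\<lambda>x. hue_ideal G A r +>\<^bsub>T r\<^esub> x) \<circ>
      (\<lambda>x. linearity_ideal (HS r) +>\<^bsub>free_algebra (HS r)\<^esub> x)"
    by (simp add: class_map_def fun_eq_iff)
  also have "\<dots> \<in> ring_hom (free_algebra (HS r)) (hue_algebra G A r)"
    unfolding hue_algebra_eq
    by (rule ring_hom_trans[OF _ ideal.rcos_ring_hom[OF hue_ideal]])
      (simp add: tensor_algebra_def ideal.rcos_ring_hom[OF linearity_ideal[OF hue_space_closed]])
  finally show ?thesis .
qed

lemma class_map_surj: "carrier (hue_algebra G A r) = class_map r ` carrier (free_algebra (HS r))"
proof -
  have "carrier (T r) = (\<lambda>x. linearity_ideal (HS r) +>\<^bsub>free_algebra (HS r)\<^esub> x) ` carrier (free_algebra (HS r))"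
    by (simp only: tensor_algebra_def FactRing_carrier)
  then show ?thesis
    by (simp only: hue_algebra_eq FactRing_carrier image_image class_map_def[abs_def])
qed

lemma class_map_gen: "class_map r (free_gen \<delta>) = hue_class G A r \<delta>"
  and class_map_scalar: "class_map r (free_scalar c) = hue_scalar G A r c"
  by (simp_all add: class_map_def hue_class_def hue_scalar_def HS_def tensor_gen_def tensor_scalar_def)

text \<open>Since \<open>\<Xi> s\<close> respects products and commutators and divides degrees, each
  defining relation of level \<open>r\<close> goes to a defining relation of level
  \<open>r - s\<close>, so the map on words descends through both quotients.\<close>

lemma hue_map:
  assumes "s \<le> r"
  obtains h where "h \<in> ring_hom (hue_algebra G A r) (hue_algebra G A (r - s))"
    "\<And>t. t \<in> carrier (free_algebra (HS r)) \<Longrightarrow> h (class_map r t) = class_map (r - s) (push (\<Xi> s) t)"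
proof -
  let ?V = "HS r" and ?V' = "HS (r - s)"
  have \<Xi>: "\<Xi> s ` ?V \<subseteq> ?V'" using \<Xi>_image[OF assms] by simp
  obtain g where g: "g \<in> ring_hom (T r) (T (r - s))"
    "\<And>t :: (('g, 'k) functional, 'k) free_algebra. t \<in> carrier (free_algebra ?V) \<Longrightarrow>
      g (linearity_ideal ?V +>\<^bsub>free_algebra ?V\<^esub> t) = linearity_ideal ?V' +>\<^bsub>free_algebra ?V'\<^esub> push (\<Xi> s) t"
    using tensor_algebra_map[OF hue_space_closed hue_space_closed \<Xi> \<Xi>_linear] by blast
  interpret T: ring "T r" by (rule T_ring)
  interpret T': ring "T (r - s)" by (rule T_ring)
  interpret g: ring_hom_ring "T r" "T (r - s)" g
    by (rule ring_hom_ringI2) (use g(1) T.ring_axioms T'.ring_axioms in auto)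
  have g_\<iota>: "g (\<iota> r v) = \<iota> (r - s) (\<Xi> s v)" if "v \<in> ?V" for v
    using g(2)[OF free_algebra_gen[OF that]] by (simp add: tensor_gen_def push_free_gen)
  have g_minus: "g (a \<ominus>\<^bsub>T r\<^esub> b) = g a \<ominus>\<^bsub>T (r - s)\<^esub> g b" if "a \<in> carrier (T r)" "b \<in> carrier (T r)" for a b
    using that by (simp add: a_minus_def)
  have "g ` hue_ideal G A r \<subseteq> hue_ideal G A (r - s)"
    unfolding hue_ideal_eq[of r]
  proof (rule ring_hom_genideal[OF T_ring T_ring hue_ideal g(1) hue_relations_carrier])
    have "g ` hue_relations r \<subseteq> hue_relations (r - s)"
    proof clarify
      fix t assume "t \<in> hue_relations r"
      then show "g t \<in> hue_relations (r - s)"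
      proof (cases rule: hue_relations_cases)
        case (mult x y i j)
        then have V: "x \<in> ?V" "y \<in> ?V" "dist_mult G A x y \<in> ?V"
          using Dist_plus_HS[OF mult(1), of r] Dist_plus_HS[OF mult(2), of r]
            dist_mult_HS[OF mult(1,2,3)] by simp_all
        have "g t = \<iota> (r - s) (\<Xi> s x) \<otimes>\<^bsub>T (r - s)\<^esub> \<iota> (r - s) (\<Xi> s y) \<ominus>\<^bsub>T (r - s)\<^esub>
            \<iota> (r - s) (dist_mult G A (\<Xi> s x) (\<Xi> s y))"
          unfolding mult(4) using V
          by (simp add: g_minus \<iota>_carrier g_\<iota> \<Xi>_dist_mult hue_space_dual)
        moreover have "\<Xi> s x \<in> Dist_plus G A (i div CHAR('k) ^ s)" "\<Xi> s y \<in> Dist_plus G A (j div CHAR('k) ^ s)"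
          using mult div_power_bounds(4)[OF assms] by (auto intro: \<Xi>_Dist_plus)
        ultimately show ?thesis
          using hue_relations_mult[OF _ _ div_power_bounds(1)[OF assms mult(3)]] by simp
      next
        case (commutator x y i j)
        then have V: "x \<in> ?V" "y \<in> ?V" "dist_commutator G A x y \<in> ?V"
          using Dist_plus_HS[OF commutator(1,3)] Dist_plus_HS[OF commutator(2,4)]
            dist_commutator_HS[OF commutator(1,2,5)] by simp_all
        have "g t = \<iota> (r - s) (\<Xi> s x) \<otimes>\<^bsub>T (r - s)\<^esub> \<iota> (r - s) (\<Xi> s y) \<ominus>\<^bsub>T (r - s)\<^esub>
            \<iota> (r - s) (\<Xi> s y) \<otimes>\<^bsub>T (r - s)\<^esub> \<iota> (r - s) (\<Xi> s x) \<ominus>\<^bsub>T (r - s)\<^esub>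
            \<iota> (r - s) (dist_commutator G A (\<Xi> s x) (\<Xi> s y))"
          unfolding commutator(6) using V
          by (simp add: g_minus \<iota>_carrier g_\<iota> \<Xi>_dist_commutator hue_space_dual)
        moreover have "\<Xi> s x \<in> Dist_plus G A (i div CHAR('k) ^ s)" "\<Xi> s y \<in> Dist_plus G A (j div CHAR('k) ^ s)"
          using commutator div_power_bounds(4)[OF assms] by (auto intro: \<Xi>_Dist_plus)
        ultimately show ?thesis
          using hue_relations_commutator[OF _ _ div_power_bounds(3)[OF assms commutator(3)]
              div_power_bounds(3)[OF assms commutator(4)] div_power_bounds(2)[OF assms commutator(5)]] by simp
      qed
    qed
    also have "\<dots> \<subseteq> hue_ideal G A (r - s)"
      unfolding hue_ideal_eq by (rule T'.genideal_self[OF hue_relations_carrier])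
    finally show "g ` hue_relations r \<subseteq> hue_ideal G A (r - s)" .
  qed
  then obtain h where h: "h \<in> ring_hom (T r Quot hue_ideal G A r) (T (r - s) Quot hue_ideal G A (r - s))"
    "\<And>x. x \<in> carrier (T r) \<Longrightarrow> h (hue_ideal G A r +>\<^bsub>T r\<^esub> x) = hue_ideal G A (r - s) +>\<^bsub>T (r - s)\<^esub> g x"
    using quotient_hom[OF T_ring T_ring hue_ideal hue_ideal g(1)] by blast
  show ?thesis
  proof (rule that[of h])
    show "h \<in> ring_hom (hue_algebra G A r) (hue_algebra G A (r - s))"
      using h(1) by (simp add: hue_algebra_eq)
    fix t :: "(('g, 'k) functional, 'k) free_algebra"
    assume t: "t \<in> carrier (free_algebra ?V)"
    have "linearity_ideal ?V +>\<^bsub>free_algebra ?V\<^esub> t \<in> carrier (T r)"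
      unfolding tensor_algebra_def
      by (rule ring_hom_closed[OF ideal.rcos_ring_hom[OF linearity_ideal[OF hue_space_closed]] t])
    then show "h (class_map r t) = class_map (r - s) (push (\<Xi> s) t)"
      by (simp add: class_map_def h(2) g(2)[OF t])
  qed
qed

text \<open>The uniqueness half of the description \<open>upsilon\<close>: scalars and classes of
  distributions generate the algebra.\<close>

lemma hue_hom_unique:
  assumes h: "h \<in> ring_hom (hue_algebra G A r) S" "h' \<in> ring_hom (hue_algebra G A r) S"
    and scalar: "\<And>c. h (hue_scalar G A r c) = h' (hue_scalar G A r c)"
    and gen: "\<And>\<delta>. \<delta> \<in> HS r \<Longrightarrow> h (hue_class G A r \<delta>) = h' (hue_class G A r \<delta>)"
    and x: "x \<in> carrier (hue_algebra G A r)"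
  shows "h x = h' x"
proof -
  obtain t where t: "t \<in> carrier (free_algebra (HS r))" "x = class_map r t"
    using x class_map_surj by blast
  note c = ring_hom_memE[OF class_map_hom[of r]]
  have "h (class_map r t) = h' (class_map r t)"
    using t(1)
  proof (induction t rule: free_algebra_induct)
    case (scalar c)
    then show ?case using assms(3) by (simp add: class_map_scalar)
  next
    case (gen v)
    then show ?case using assms(4) by (simp add: class_map_gen)
  next
    case (add t u)
    then show ?case
      using c(3)[OF add(1,2)] c(1)[OF add(1)] c(1)[OF add(2)] ring_hom_add[OF h(1)] ring_hom_add[OF h(2)]
      by (simp add: free_algebra_simps)
  next
    case (mult t u)
    then show ?case
      using c(2)[OF mult(1,2)] c(1)[OF mult(1)] c(1)[OF mult(2)] ring_hom_mult[OF h(1)] ring_hom_mult[OF h(2)]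
      by (simp add: free_algebra_simps)
  qed
  then show ?thesis by (simp add: t(2))
qed

lemma upsilon_class_map:
  assumes "s \<le> r" "t \<in> carrier (free_algebra (HS r))"
  shows "upsilon G A A\<^sub>0 r s (class_map r t) = class_map (r - s) (push (\<Xi> s) t)"
proof -
  let ?U = "hue_algebra G A r" and ?U' = "hue_algebra G A (r - s)"
  obtain h where h: "h \<in> ring_hom ?U ?U'"
    "\<And>t. t \<in> carrier (free_algebra (HS r)) \<Longrightarrow> h (class_map r t) = class_map (r - s) (push (\<Xi> s) t)"
    using hue_map[OF assms(1)] by blast
  \<comment> \<open>The description asks for an \<open>extensional\<close> map, so values outside
    the carrier are reset.\<close>
  define h' where "h' = restrict h (carrier ?U)"
  have h'_eq: "h' x = h x" if "x \<in> carrier ?U" for x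
    using that by (simp add: h'_def)
  interpret U: ring ?U
    unfolding hue_algebra_eq by (rule ideal.quotient_is_ring[OF hue_ideal])
  have h': "h' \<in> ring_hom ?U ?U'"
    by (rule ring_hom_memI) (simp_all add: h'_eq ring_hom_memE[OF h(1)])
  have class_in: "class_map r t \<in> carrier ?U" if "t \<in> carrier (free_algebra (HS r))" for t
    using that class_map_surj by blast
  have h'_class: "h' (class_map r t) = class_map (r - s) (push (\<Xi> s) t)"
    if "t \<in> carrier (free_algebra (HS r))" for t
    using h'_eq[OF class_in[OF that]] h(2)[OF that] by simp
  have scalar: "h' (hue_scalar G A r c) = hue_scalar G A (r - s) c" for c
    using h'_class[OF free_algebra_scalar] by (simp add: class_map_scalar push_free_scalar)
  have gen: "h' (hue_class G A r \<delta>) = hue_class G A (r - s) (frobenius_dist A A\<^sub>0 s \<delta>)"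
    if "\<delta> \<in> HS r" for \<delta>
    using h'_class[OF free_algebra_gen[OF that]] frobenius_dist_eq[OF hue_space_dual[OF that]]
    by (simp add: class_map_gen push_free_gen)
  have "upsilon G A A\<^sub>0 r s = h'"
    unfolding upsilon_def HS_def[symmetric]
  proof (rule the_equality)
    show "h' \<in> ring_hom ?U ?U' \<and> h' \<in> extensional (carrier ?U) \<and>
        (\<forall>c. h' (hue_scalar G A r c) = hue_scalar G A (r - s) c) \<and>
        (\<forall>\<delta>\<in>HS r. h' (hue_class G A r \<delta>) = hue_class G A (r - s) (frobenius_dist A A\<^sub>0 s \<delta>))"
      using h' scalar gen by (auto simp: h'_def)
  next
    fix k
    assume k: "k \<in> ring_hom ?U ?U' \<and> k \<in> extensional (carrier ?U) \<and>
        (\<forall>c. k (hue_scalar G A r c) = hue_scalar G A (r - s) c) \<and>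
        (\<forall>\<delta>\<in>HS r. k (hue_class G A r \<delta>) = hue_class G A (r - s) (frobenius_dist A A\<^sub>0 s \<delta>))"
    show "k = h'"
    proof (rule extensionalityI)
      show "k \<in> extensional (carrier ?U)" using k by blast
      show "h' \<in> extensional (carrier ?U)" by (simp add: h'_def)
      fix x assume "x \<in> carrier ?U"
      then show "k x = h' x"
        using k h' scalar gen by (intro hue_hom_unique[of k r ?U' h' x]) auto
    qed
  qed
  then show ?thesis using h'_class[OF assms(2)] by simp
qed

lemma upsilon_surj:
  assumes "s \<le> r"
  shows "upsilon G A A\<^sub>0 r s ` carrier (hue_algebra G A r) = carrier (hue_algebra G A (r - s))"
proof -
  let ?F = "free_algebra (HS r) :: (('g, 'k) functional, 'k) free_algebra ring"
    and ?F' = "free_algebra (HS (r - s)) :: (('g, 'k) functional, 'k) free_algebra ring"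
  have "carrier ?F' = push (\<Xi> s) ` carrier ?F"
    using push_carrier[of "\<Xi> s" "HS r" "HS (r - s)"]
      push_surj[OF \<Xi>_image[OF assms]] \<Xi>_image[OF assms] by blast
  then have "carrier (hue_algebra G A (r - s)) = (\<lambda>t. class_map (r - s) (push (\<Xi> s) t)) ` carrier ?F"
    by (simp only: class_map_surj image_image)
  also have "\<dots> = upsilon G A A\<^sub>0 r s ` carrier (hue_algebra G A r)"
    unfolding class_map_surj image_image by (intro image_cong refl upsilon_class_map[symmetric] assms)
  finally show ?thesis ..
qed

end

theorem corollary4p1p3:
  fixes G :: "('g, 'm) monoid_scheme"
    and A A\<^sub>0 :: "('g \<Rightarrow> 'k::alg_closed_field) set"
    and r s :: nat
  assumes "CHAR('k) > 0"
    and "reductive_group G A"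
    and "split_prime_field_form G A A\<^sub>0"
    and "r \<ge> s"
  shows "upsilon G A A\<^sub>0 r s ` carrier (hue_algebra G A r) = carrier (hue_algebra G A (r - s))"
proof -
  interpret affine_algebraic_group G A
    using assms(2) by (simp add: reductive_group_def)
  interpret prime_field_form G A A\<^sub>0
    using assms(3) by (simp add: split_prime_field_form_def)
  interpret group_with_form G A A\<^sub>0
    by unfold_locales (rule assms(1))
  show ?thesis by (rule upsilon_surj[OF assms(4)])
qed

end
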